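(* Let $\mathbb{F}$ be a finite field, $G=\mathrm{GL}_2(\mathbb{F})$, and let $B,T,N,T',N'\subset G$ be the subgroups defined in the context. Let $\mathcal{C}$ be an additive, $\mathbb{Q}$-linear category. Let $M$ be an object of $\mathcal{C}$ equipped with an action $\alpha$ of $G$, and suppose that $M$ admits invariants by all subgroups of $G$. Then there exist isomorphisms, functorial in $(M,\alpha)$: $$ M^T \oplus M^G \oplus M^G \;\cong\; M^{T'} \oplus M^B \oplus M^B, \tag{1} $$ $$ M^N \oplus M^G \;\cong\; M^{N'} \oplus M^B. \tag{2} $$
   Context: Let $\mathbb{F}'$ be a quadratic extension of the finite field $\mathbb{F}$. The group $G=\mathrm{GL}_2(\mathbb{F})$ acts on $\mathbb{P}^1(\mathbb{F})$ and on $\mathbb{P}^1(\mathbb{F}')$ in the usual way (as the sets of lines in $\mathbb{F}^2$ and $(\mathbb{F}')^2$). The following subgroups of $G$ are fixed: - $B$ is the stabilizer in $G$ of a point $\infty\in\mathbb{P}^1(\mathbb{F})$ (a Borel subgroup). - $T$ is the subgroup of $G$ fixing each of two distinct points $0,\infty\in\mathbb{P}^1(\mathbb{F})$ (a split maximal torus). - $N$ is the stabilizer in $G$ of the set $\{0,\infty\}$. - $T'$ is the stabilizer in $G$ of a point $P$ of $\mathbb{P}^1(\mathbb{F}')-\mathbb{P}^1(\mathbb{F})$ (a non-split maximal torus). - $N'$ is the stabilizer in $G$ of the $\mathrm{Aut}_{\mathbb{F}}(\mathbb{F}')$-orbit of $P$ (as a set). An action of a group $H$ on an object $M$ of a category $\mathcal{C}$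 is a group homomorphism $H\to\mathrm{Aut}_{\mathcal{C}}(M)$. One says that $M$ admits invariants by $H$ if the functor $\mathrm{Hom}_{\mathcal{C}}(-,M)^H$ (morphisms to $M$ that are fixed by the action of $H$ by composition) is representable; in that case $M^H$ denotes the subobject of $M$ representing this functor. "Functorial in $(M,\alpha)$" means natural with respect to $G$-equivariant morphisms between objects of $\mathcal{C}$ with $G$-action that admit invariants by the subgroups of $G$. *)

theory Defs
  imports
    "HOL-Analysis.Cartesian_Space"
    "HOL-Algebra.Group_Action"
    "HOL-Algebra.Module"
begin

definition type_ring :: "'a::comm_ring_1 ring" where
  "type_ring = \<lparr>carrier = UNIV, monoid.mult = (*), one = 1, zero = 0, add = (+)\<rparr>"


section \<open>Categories, functors, natural isomorphisms\<close>

record ('o, 'm) cat =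
  Ob :: "'o set"
  Arr :: "'m set"
  Dom :: "'m \<Rightarrow> 'o"
  Cod :: "'m \<Rightarrow> 'o"
  Id :: "'o \<Rightarrow> 'm"
  Comp :: "'m \<Rightarrow> 'm \<Rightarrow> 'm"  (infixl \<open>\<cdot>\<index>\<close> 75)

text \<open>\<open>g \<cdot>\<^bsub>C\<^esub> f\<close> is the composite of \<open>f\<close> followed by \<open>g\<close>.\<close>

definition Hom :: "('o, 'm, 'z) cat_scheme \<Rightarrow> 'o \<Rightarrow> 'o \<Rightarrow> 'm set" where
  "Hom C X Y = {f \<in> Arr C. Dom C f = X \<and> Cod C f = Y}"

locale category =
  fixes C :: "('o, 'm, 'z) cat_scheme" (structure)
  assumes Dom_Ob: "f \<in> Arr C \<Longrightarrow> Dom C f \<in> Ob C"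
    and Cod_Ob: "f \<in> Arr C \<Longrightarrow> Cod C f \<in> Ob C"
    and Id_Hom: "X \<in> Ob C \<Longrightarrow> Id C X \<in> Hom C X X"
    and Comp_Hom: "\<lbrakk>f \<in> Hom C X Y; g \<in> Hom C Y Z\<rbrakk> \<Longrightarrow> g \<cdot> f \<in> Hom C X Z"
    and Comp_Id: "f \<in> Hom C X Y \<Longrightarrow> f \<cdot> Id C X = f"
    and Id_Comp: "f \<in> Hom C X Y \<Longrightarrow> Id C Y \<cdot> f = f"
    and Comp_assoc: "\<lbrakk>f \<in> Hom C W X; g \<in> Hom C X Y; h \<in> Hom C Y Z\<rbrakk>
      \<Longrightarrow> h \<cdot> (g \<cdot> f) = (h \<cdot> g) \<cdot> f"

definition Iso :: "('o, 'm, 'z) cat_scheme \<Rightarrow> 'o \<Rightarrow> 'o \<Rightarrow> 'm set" where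
  "Iso C X Y = {f \<in> Hom C X Y. \<exists>g \<in> Hom C Y X. g \<cdot>\<^bsub>C\<^esub> f = Id C X \<and> f \<cdot>\<^bsub>C\<^esub> g = Id C Y}"

definition Aut_group :: "('o, 'm, 'z) cat_scheme \<Rightarrow> 'o \<Rightarrow> 'm monoid" where
  "Aut_group C X = \<lparr>carrier = Iso C X X, monoid.mult = Comp C, one = Id C X\<rparr>"

record ('o1, 'm1, 'o2, 'm2) fctr =
  on_Ob :: "'o1 \<Rightarrow> 'o2"
  on_Arr :: "'m1 \<Rightarrow> 'm2"

definition is_functor ::
  "('o1, 'm1, 'y) cat_scheme \<Rightarrow> ('o2, 'm2, 'z) cat_scheme \<Rightarrow> ('o1, 'm1, 'o2, 'm2) fctr \<Rightarrow> bool"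
  where
  "is_functor A C F \<longleftrightarrow>
     (\<forall>X \<in> Ob A. on_Ob F X \<in> Ob C) \<and>
     (\<forall>X \<in> Ob A. \<forall>Y \<in> Ob A. \<forall>f \<in> Hom A X Y. on_Arr F f \<in> Hom C (on_Ob F X) (on_Ob F Y)) \<and>
     (\<forall>X \<in> Ob A. on_Arr F (Id A X) = Id C (on_Ob F X)) \<and>
     (\<forall>X \<in> Ob A. \<forall>Y \<in> Ob A. \<forall>Z \<in> Ob A. \<forall>f \<in> Hom A X Y. \<forall>g \<in> Hom A Y Z.
        on_Arr F (g \<cdot>\<^bsub>A\<^esub> f) = on_Arr F g \<cdot>\<^bsub>C\<^esub> on_Arr F f)"

definition naturally_isomorphic ::
  "('o1, 'm1, 'y) cat_scheme \<Rightarrow> ('o2, 'm2, 'z) cat_scheme \<Rightarrow>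
   ('o1, 'm1, 'o2, 'm2) fctr \<Rightarrow> ('o1, 'm1, 'o2, 'm2) fctr \<Rightarrow> bool" where
  "naturally_isomorphic A C F F' \<longleftrightarrow>
     is_functor A C F \<and> is_functor A C F' \<and>
     (\<exists>\<theta>. (\<forall>X \<in> Ob A. \<theta> X \<in> Iso C (on_Ob F X) (on_Ob F' X)) \<and>
          (\<forall>X \<in> Ob A. \<forall>Y \<in> Ob A. \<forall>f \<in> Hom A X Y.
             \<theta> Y \<cdot>\<^bsub>C\<^esub> on_Arr F f = on_Arr F' f \<cdot>\<^bsub>C\<^esub> \<theta> X))"


section \<open>Additive rational-linear categories\<close>

record ('o, 'm) lin_cat = "('o, 'm) cat" +
  Zero :: "'o \<Rightarrow> 'o \<Rightarrow> 'm"
  Add :: "'m \<Rightarrow> 'm \<Rightarrow> 'm"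
  Scale :: "rat \<Rightarrow> 'm \<Rightarrow> 'm"

text \<open>The multiplicative fields of the record are irrelevant for \<open>Module.module\<close>.\<close>

definition hom_module ::
  "('o, 'm, 'z) lin_cat_scheme \<Rightarrow> 'o \<Rightarrow> 'o \<Rightarrow> (rat, 'm) Module.module" where
  "hom_module C X Y = \<lparr>carrier = Hom C X Y, monoid.mult = undefined, one = undefined,
     zero = Zero C X Y, add = Add C, smult = Scale C\<rparr>"

definition zero_object :: "('o, 'm, 'z) cat_scheme \<Rightarrow> 'o \<Rightarrow> bool" where
  "zero_object C Z \<longleftrightarrow> Z \<in> Ob C \<and>
     (\<forall>X \<in> Ob C. (\<exists>!f. f \<in> Hom C X Z) \<and> (\<exists>!f. f \<in> Hom C Z X))"

record ('o, 'm) dsum =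
  sum_Ob :: 'o
  in1 :: 'm
  in2 :: 'm
  pr1 :: 'm
  pr2 :: 'm

definition is_direct_sum ::
  "('o, 'm, 'z) lin_cat_scheme \<Rightarrow> 'o \<Rightarrow> 'o \<Rightarrow> ('o, 'm) dsum \<Rightarrow> bool" where
  "is_direct_sum C X Y S \<longleftrightarrow>
     sum_Ob S \<in> Ob C \<and>
     in1 S \<in> Hom C X (sum_Ob S) \<and> in2 S \<in> Hom C Y (sum_Ob S) \<and>
     pr1 S \<in> Hom C (sum_Ob S) X \<and> pr2 S \<in> Hom C (sum_Ob S) Y \<and>
     pr1 S \<cdot>\<^bsub>C\<^esub> in1 S = Id C X \<and> pr2 S \<cdot>\<^bsub>C\<^esub> in2 S = Id C Y \<and>
     pr2 S \<cdot>\<^bsub>C\<^esub> in1 S = Zero C X Y \<and> pr1 S \<cdot>\<^bsub>C\<^esub> in2 S = Zero C Y X \<and>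
     Add C (in1 S \<cdot>\<^bsub>C\<^esub> pr1 S) (in2 S \<cdot>\<^bsub>C\<^esub> pr2 S) = Id C (sum_Ob S)"

locale additive_rat_linear_category = category C
  for C :: "('o, 'm, 'z) lin_cat_scheme" (structure) +
  assumes hom_module:
      "\<lbrakk>X \<in> Ob C; Y \<in> Ob C\<rbrakk> \<Longrightarrow> Module.module (type_ring :: rat ring) (hom_module C X Y)"
    and Comp_Add_left: "\<lbrakk>f \<in> Hom C X Y; g \<in> Hom C Y Z; h \<in> Hom C Y Z\<rbrakk>
      \<Longrightarrow> Add C g h \<cdot> f = Add C (g \<cdot> f) (h \<cdot> f)"
    and Comp_Add_right: "\<lbrakk>f \<in> Hom C X Y; g \<in> Hom C X Y; h \<in> Hom C Y Z\<rbrakk>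
      \<Longrightarrow> h \<cdot> Add C f g = Add C (h \<cdot> f) (h \<cdot> g)"
    and Comp_Scale_left: "\<lbrakk>f \<in> Hom C X Y; g \<in> Hom C Y Z\<rbrakk> \<Longrightarrow> Scale C q g \<cdot> f = Scale C q (g \<cdot> f)"
    and Comp_Scale_right: "\<lbrakk>f \<in> Hom C X Y; g \<in> Hom C Y Z\<rbrakk> \<Longrightarrow> g \<cdot> Scale C q f = Scale C q (g \<cdot> f)"
    and ex_zero_object: "\<exists>Z. zero_object C Z"
    and ex_direct_sum: "\<lbrakk>X \<in> Ob C; Y \<in> Ob C\<rbrakk> \<Longrightarrow> \<exists>S. is_direct_sum C X Y S"

text \<open>The direct sum of two functors with values in \<open>C\<close>, for a choice \<open>D\<close> of direct sums.\<close>

definition sum_fctr ::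
  "('o, 'm, 'z) lin_cat_scheme \<Rightarrow> ('o \<Rightarrow> 'o \<Rightarrow> ('o, 'm) dsum) \<Rightarrow> ('o1, 'm1, 'y) cat_scheme \<Rightarrow>
   ('o1, 'm1, 'o, 'm) fctr \<Rightarrow> ('o1, 'm1, 'o, 'm) fctr \<Rightarrow> ('o1, 'm1, 'o, 'm) fctr" where
  "sum_fctr C D A F F' = \<lparr>
     on_Ob = (\<lambda>X. sum_Ob (D (on_Ob F X) (on_Ob F' X))),
     on_Arr = (\<lambda>f.
       let S = D (on_Ob F (Dom A f)) (on_Ob F' (Dom A f));
           S' = D (on_Ob F (Cod A f)) (on_Ob F' (Cod A f))
       in Add C (in1 S' \<cdot>\<^bsub>C\<^esub> on_Arr F f \<cdot>\<^bsub>C\<^esub> pr1 S) (in2 S' \<cdot>\<^bsub>C\<^esub> on_Arr F' f \<cdot>\<^bsub>C\<^esub> pr2 S))\<rparr>"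


section \<open>Group actions on objects and invariants\<close>

definition is_action ::
  "('o, 'm, 'z) cat_scheme \<Rightarrow> ('g, 'y) monoid_scheme \<Rightarrow> 'o \<Rightarrow> ('g \<Rightarrow> 'm) \<Rightarrow> bool" where
  "is_action C G M \<alpha> \<longleftrightarrow> M \<in> Ob C \<and> \<alpha> \<in> hom G (Aut_group C M)"

definition Hom_invariants ::
  "('o, 'm, 'z) cat_scheme \<Rightarrow> 'o \<Rightarrow> ('g \<Rightarrow> 'm) \<Rightarrow> 'g set \<Rightarrow> 'o \<Rightarrow> 'm set" where
  "Hom_invariants C M \<alpha> H X = {f \<in> Hom C X M. \<forall>h \<in> H. \<alpha> h \<cdot>\<^bsub>C\<^esub> f = f}"

text \<open>Representability of the contravariant functor \<open>X \<mapsto> Hom_invariants C M \<alpha> H X\<close>.\<close>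

definition admits_invariants ::
  "('o, 'm, 'z) cat_scheme \<Rightarrow> 'o \<Rightarrow> ('g \<Rightarrow> 'm) \<Rightarrow> 'g set \<Rightarrow> bool" where
  "admits_invariants C M \<alpha> H \<longleftrightarrow>
     (\<exists>I \<in> Ob C. \<exists>\<Phi>.
        (\<forall>X \<in> Ob C. bij_betw (\<Phi> X) (Hom C X I) (Hom_invariants C M \<alpha> H X)) \<and>
        (\<forall>X \<in> Ob C. \<forall>Y \<in> Ob C. \<forall>f \<in> Hom C X Y. \<forall>u \<in> Hom C Y I.
           \<Phi> X (u \<cdot>\<^bsub>C\<^esub> f) = \<Phi> Y u \<cdot>\<^bsub>C\<^esub> f))"

text \<open>\<open>(I, i)\<close> is the subobject of \<open>M\<close> representing that functor. Injectivity of
  \<open>u \<mapsto> i \<cdot>\<^bsub>C\<^esub> u\<close> for all \<open>X\<close> says that \<open>i\<close> is a monomorphism.\<close>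

definition is_invariants ::
  "('o, 'm, 'z) cat_scheme \<Rightarrow> 'o \<Rightarrow> ('g \<Rightarrow> 'm) \<Rightarrow> 'g set \<Rightarrow> 'o \<times> 'm \<Rightarrow> bool" where
  "is_invariants C M \<alpha> H = (\<lambda>(I, i).
     I \<in> Ob C \<and> i \<in> Hom C I M \<and>
     (\<forall>X \<in> Ob C. bij_betw (\<lambda>u. i \<cdot>\<^bsub>C\<^esub> u) (Hom C X I) (Hom_invariants C M \<alpha> H X)))"

lemma (in category) admits_invariants_iff:
  assumes "is_action C G M \<alpha>" and "H \<subseteq> carrier G"
  shows "admits_invariants C M \<alpha> H \<longleftrightarrow> (\<exists>J. is_invariants C M \<alpha> H J)"
proof
  assume "admits_invariants C M \<alpha> H"
  then obtain I \<Phi> where I: "I \<in> Ob C"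
    and bij: "\<And>X. X \<in> Ob C \<Longrightarrow> bij_betw (\<Phi> X) (Hom C X I) (Hom_invariants C M \<alpha> H X)"
    and nat: "\<And>X Y f u. \<lbrakk>X \<in> Ob C; Y \<in> Ob C; f \<in> Hom C X Y; u \<in> Hom C Y I\<rbrakk>
                \<Longrightarrow> \<Phi> X (u \<cdot> f) = \<Phi> Y u \<cdot> f"
    unfolding admits_invariants_def by blast
  define i where "i = \<Phi> I (Id C I)"
  have i: "i \<in> Hom C I M"
    using bij_betw_apply[OF bij[OF I] Id_Hom[OF I]] by (simp add: i_def Hom_invariants_def)
  have eq: "i \<cdot> u = \<Phi> X u" if "X \<in> Ob C" "u \<in> Hom C X I" for X u
    using nat[OF that(1) I that(2) Id_Hom[OF I]] Id_Comp[OF that(2)] by (simp add: i_def)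
  have "bij_betw (\<lambda>u. i \<cdot> u) (Hom C X I) (Hom_invariants C M \<alpha> H X)" if "X \<in> Ob C" for X
    using bij[OF that] eq[OF that] by (simp cong: bij_betw_cong)
  then have "is_invariants C M \<alpha> H (I, i)"
    using I i by (simp add: is_invariants_def)
  then show "\<exists>J. is_invariants C M \<alpha> H J" ..
next
  assume "\<exists>J. is_invariants C M \<alpha> H J"
  then obtain I i where "I \<in> Ob C" "i \<in> Hom C I M"
    and "\<And>X. X \<in> Ob C \<Longrightarrow> bij_betw (\<lambda>u. i \<cdot> u) (Hom C X I) (Hom_invariants C M \<alpha> H X)"
    by (auto simp: is_invariants_def)
  then show "admits_invariants C M \<alpha> H"
    unfolding admits_invariants_def
    by (intro bexI[of _ I] exI[of _ "\<lambda>X u. i \<cdot> u"]) (auto intro: Comp_assoc)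
qed

text \<open>The category of objects of \<open>C\<close> with an action of \<open>G\<close> that admit invariants by all subgroups
  of \<open>G\<close>, with the \<open>G\<close>-equivariant morphisms. An arrow is a triple of source, underlying
  morphism and target.\<close>

definition GObj ::
  "('o, 'm, 'z) cat_scheme \<Rightarrow> ('g, 'y) monoid_scheme \<Rightarrow>
   ('o \<times> ('g \<Rightarrow> 'm), ('o \<times> ('g \<Rightarrow> 'm)) \<times> 'm \<times> ('o \<times> ('g \<Rightarrow> 'm))) cat" where
  "GObj C G =
     (let Obs = {(M, \<alpha>). is_action C G M \<alpha> \<and>
                    (\<forall>H. subgroup H G \<longrightarrow> admits_invariants C M \<alpha> H)}
      in \<lparr>Ob = Obs,
          Arr = {((M, \<alpha>), f, (M', \<alpha>')) | M \<alpha> f M' \<alpha>'.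
                   (M, \<alpha>) \<in> Obs \<and> (M', \<alpha>') \<in> Obs \<and> f \<in> Hom C M M' \<and>
                   (\<forall>g \<in> carrier G. f \<cdot>\<^bsub>C\<^esub> \<alpha> g = \<alpha>' g \<cdot>\<^bsub>C\<^esub> f)},
          Dom = (\<lambda>(A, f, A'). A),
          Cod = (\<lambda>(A, f, A'). A'),
          Id = (\<lambda>(M, \<alpha>). ((M, \<alpha>), Id C M, (M, \<alpha>))),
          Comp = (\<lambda>(A', g, A'') (A, f, _). (A, g \<cdot>\<^bsub>C\<^esub> f, A''))\<rparr>)"

text \<open>A choice, for every object of \<open>GObj C G\<close> and every subgroup, of a subobject of invariants,
  and the resulting functor \<open>M \<mapsto> M\<^sup>H\<close>.\<close>

definition invariants_choice ::
  "('o, 'm, 'z) cat_scheme \<Rightarrow> ('g, 'y) monoid_scheme \<Rightarrow>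
   ('o \<times> ('g \<Rightarrow> 'm) \<Rightarrow> 'g set \<Rightarrow> 'o \<times> 'm) \<Rightarrow> bool" where
  "invariants_choice C G J \<longleftrightarrow>
     (\<forall>(M, \<alpha>) \<in> Ob (GObj C G). \<forall>H. subgroup H G \<longrightarrow> is_invariants C M \<alpha> H (J (M, \<alpha>) H))"

definition direct_sum_choice ::
  "('o, 'm, 'z) lin_cat_scheme \<Rightarrow> ('o \<Rightarrow> 'o \<Rightarrow> ('o, 'm) dsum) \<Rightarrow> bool" where
  "direct_sum_choice C D \<longleftrightarrow> (\<forall>X \<in> Ob C. \<forall>Y \<in> Ob C. is_direct_sum C X Y (D X Y))"

definition inv_fctr ::
  "('o, 'm, 'z) cat_scheme \<Rightarrow> ('o \<times> ('g \<Rightarrow> 'm) \<Rightarrow> 'g set \<Rightarrow> 'o \<times> 'm) \<Rightarrow> 'g set \<Rightarrow>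
   ('o \<times> ('g \<Rightarrow> 'm), ('o \<times> ('g \<Rightarrow> 'm)) \<times> 'm \<times> ('o \<times> ('g \<Rightarrow> 'm)), 'o, 'm) fctr" where
  "inv_fctr C J H = \<lparr>
     on_Ob = (\<lambda>A. fst (J A H)),
     on_Arr = (\<lambda>(A, f, A').
       THE u. u \<in> Hom C (fst (J A H)) (fst (J A' H)) \<and>
              snd (J A' H) \<cdot>\<^bsub>C\<^esub> u = f \<cdot>\<^bsub>C\<^esub> snd (J A H))\<rparr>"


section \<open>Subgroups of the general linear group of rank two\<close>

definition GL2 :: "('k::field ^ 2 ^ 2) monoid" where
  "GL2 = \<lparr>carrier = {A. invertible A}, monoid.mult = (**), one = mat 1\<rparr>"

definition P1 :: "('k::field ^ 2) set set" where
  "P1 = {L. vec.subspace L \<and> vec.dim L = 1}"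

definition line_act :: "'k::field ^ 2 ^ 2 \<Rightarrow> ('k ^ 2) set \<Rightarrow> ('k ^ 2) set" where
  "line_act A L = (\<lambda>v. A *v v) ` L"

definition map_vec2 :: "('k \<Rightarrow> 'l) \<Rightarrow> 'k ^ 2 \<Rightarrow> 'l ^ 2" where
  "map_vec2 \<sigma> v = (\<chi> i. \<sigma> (v $ i))"

text \<open>A field extension is given by its structure map \<open>\<iota>\<close>, here with target of dimension 2.\<close>

definition quadratic_extension :: "('k::field \<Rightarrow> 'l::field) \<Rightarrow> bool" where
  "quadratic_extension \<iota> \<longleftrightarrow>
     \<iota> \<in> ring_hom type_ring type_ring \<and>
     vector_space.dim (\<lambda>c x. \<iota> c * x) (UNIV :: 'l set) = 2"

definition field_aut :: "('k::field \<Rightarrow> 'l::field) \<Rightarrow> ('l \<Rightarrow> 'l) monoid" where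
  "field_aut \<iota> = \<lparr>
     carrier = {\<sigma>. \<sigma> \<in> ring_hom type_ring type_ring \<and> bij \<sigma> \<and>
                    (\<forall>c. \<sigma> (\<iota> c) = \<iota> c)},
     monoid.mult = (\<circ>), one = id\<rparr>"

text \<open>The inclusion of the projective line of the small field in that of the large field.\<close>

definition P1_incl :: "('k::field \<Rightarrow> 'l::field) \<Rightarrow> ('k ^ 2) set \<Rightarrow> ('l ^ 2) set" where
  "P1_incl \<iota> L = vec.span (map_vec2 \<iota> ` L)"

definition line_act_ext ::
  "('k::field \<Rightarrow> 'l::field) \<Rightarrow> 'k ^ 2 ^ 2 \<Rightarrow> ('l ^ 2) set \<Rightarrow> ('l ^ 2) set" where
  "line_act_ext \<iota> A = line_act (map_matrix \<iota> A)"

definition borel :: "('k::field ^ 2) set \<Rightarrow> ('k ^ 2 ^ 2) set" where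
  "borel L = stabilizer GL2 line_act L"

definition split_torus :: "('k::field ^ 2) set \<Rightarrow> ('k ^ 2) set \<Rightarrow> ('k ^ 2 ^ 2) set" where
  "split_torus L L' = stabilizer GL2 line_act L \<inter> stabilizer GL2 line_act L'"

definition split_normalizer :: "('k::field ^ 2) set \<Rightarrow> ('k ^ 2) set \<Rightarrow> ('k ^ 2 ^ 2) set" where
  "split_normalizer L L' = stabilizer GL2 (\<lambda>A. (`) (line_act A)) {L, L'}"

definition nonsplit_torus ::
  "('k::field \<Rightarrow> 'l::field) \<Rightarrow> ('l ^ 2) set \<Rightarrow> ('k ^ 2 ^ 2) set" where
  "nonsplit_torus \<iota> P = stabilizer GL2 (line_act_ext \<iota>) P"

definition nonsplit_normalizer ::
  "('k::field \<Rightarrow> 'l::field) \<Rightarrow> ('l ^ 2) set \<Rightarrow> ('k ^ 2 ^ 2) set" where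
  "nonsplit_normalizer \<iota> P =
     stabilizer GL2 (\<lambda>A. (`) (line_act_ext \<iota> A))
       (orbit (field_aut \<iota>) (\<lambda>\<sigma>. (`) (map_vec2 \<sigma>)) P)"

end

(* For a subgroup H, the object M^H is the image of the idempotent e_H = (1/|H|) (sum of H) acting
   on M, so a sum of objects M^(H_i) is the image of the diagonal matrix of the e_(H_i). Two such
   diagonal matrices over the rational group ring that are equivalent (a b = f, b a = e) give
   naturally isomorphic sums. They are equivalent as soon as the permutation representations on the
   disjoint unions of the G/H_i and of the G/K_j have the same character.

   For GL_2 write a, b for the numbers of fixed points of g on P^1(F) and on P^1(F') - P^1(F), and
   s, s' for the numbers of ordered pairs of distinct points of P^1(F) swapped by g, and of points of
   P^1(F') - P^1(F) sent by g to their conjugates. The characters are a (for B), a(a-1) (for T),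
   b (for T'), (a(a-1) + s)/2 (for N) and (b + s')/2 (for N'), so both identities reduce to
   b + 2a = a(a-1) + 2 and s = s'. By Burnside's lemma both sides of each have the same average over
   the group, so it suffices to prove the inequalities "<=", which only use that a polynomial has at
   most as many roots as its degree. *)
theory Submission
  imports Defs "HOL-Computational_Algebra.Polynomial" "HOL-Analysis.Determinants"
begin

section \<open>Invariant projections with equal characters\<close>

text \<open>Rational coefficients carry the algebra. A sum of squares over \<open>rat\<close>
  vanishes only termwise, so every self-adjoint matrix has a group inverse, a character orthogonal
  to itself is zero, and equal characters give equivalent idempotents without Wedderburn theory,
  splitting fields or a decomposition into irreducibles. Matrices over the group ring are treated as
  matrices commuting with left translation on copies of G: transposition is available there, and the
  averaging idempotents are self-adjoint.

  The isomorphisms are composed of an inclusion, a matrix over the group ring and a retraction. The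
  coefficients of that matrix do not depend on M, and this is the source of naturality.

  On the geometric side, comparing averages replaces the list of conjugacy classes of GL_2 and a
  separate treatment of characteristic 2. The averages of s and s' require Burnside's count twisted
  by a map that commutes with the group: the swap of a pair of lines, and conjugation of the
  quadratic extension.\<close>

definition act_invariant :: "('g, 'y) monoid_scheme \<Rightarrow> ('g \<Rightarrow> 'n \<Rightarrow> 'n) \<Rightarrow> 'a ^ 'n ^ 'n \<Rightarrow> bool" where
  "act_invariant G \<phi> m \<longleftrightarrow> (\<forall>g \<in> carrier G. \<forall>x y. m $ \<phi> g x $ \<phi> g y = m $ x $ y)"

text \<open>The trace of \<open>e\<close> times the inverse of the permutation of \<open>g\<close>.
  For an invariant idempotent this is the character of its image at the inverse of \<open>g\<close>;
  symmetry of \<open>e\<close> makes the inverse immaterial.\<close>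

definition act_character :: "('g \<Rightarrow> 'n \<Rightarrow> 'n) \<Rightarrow> 'a::comm_monoid_add ^ 'n ^ 'n \<Rightarrow> 'g \<Rightarrow> 'a" where
  "act_character \<phi> e g = (\<Sum>x\<in>UNIV. e $ \<phi> g x $ x)"

text \<open>With w = bv, symmetry gives <w,w> = <v,bw>, so bw = 0 forces w = 0. Hence
  \<open>b\<close> is injective on its range and, by dimension, maps it onto itself; each column of
  \<open>b\<close> is then b(bu) for some u, and these u are the columns of
  \<open>d\<close>.\<close>

lemma self_adjoint_regular:
  fixes b :: "rat ^ 'n ^ 'n"
  assumes "transpose b = b"
  obtains d where "b = b ** b ** d"
proof -
  have ker: "b *v v = 0" if "b *v (b *v v) = 0" for v
  proof -
    define w where "w = b *v v"
    have "(\<Sum>i\<in>UNIV. w $ i * w $ i) = (\<Sum>i\<in>UNIV. \<Sum>j\<in>UNIV. w $ i * (b $ i $ j * v $ j))"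
      by (simp add: w_def matrix_vector_mult_def sum_distrib_left)
    also have "\<dots> = (\<Sum>j\<in>UNIV. \<Sum>i\<in>UNIV. w $ i * (b $ i $ j * v $ j))"
      by (rule sum.swap)
    also have "\<dots> = (\<Sum>j\<in>UNIV. v $ j * (transpose b *v w) $ j)"
      by (simp add: matrix_vector_mult_def sum_distrib_left transpose_def ac_simps)
    also have "\<dots> = 0"
      using that by (simp add: assms w_def)
    finally have "\<forall>i. w $ i = 0"
      by (simp add: sum_nonneg_eq_0_iff)
    then show ?thesis
      by (simp add: w_def vec_eq_iff)
  qed
  let ?R = "range (\<lambda>v. b *v v)"
  have lin: "Vector_Spaces.linear (*s) (*s) (\<lambda>v. b *v v)"
    by (rule matrix_vector_mul_linear_gen)
  have sub: "vec.subspace ?R"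
    using vec.linear_subspace_image[OF lin vec.subspace_UNIV] by simp
  have inj: "inj_on (\<lambda>v. b *v v) (vec.span ?R)"
  proof (rule inj_onI)
    fix x y assume *: "x \<in> vec.span ?R" "y \<in> vec.span ?R" "b *v x = b *v y"
    then have "x \<in> ?R" "y \<in> ?R"
      by (simp_all only: vec.span_eq_iff[THEN iffD2, OF sub])
    then obtain u v where "x = b *v u" "y = b *v v"
      by auto
    then show "x = y"
      using ker[of "u - v"] *(3) by (simp add: matrix_vector_mult_diff_distrib)
  qed
  have "vec.dim ((\<lambda>v. b *v v) ` ?R) = vec.dim ?R"
    by (rule vec.dim_image_eq[OF lin inj])
  moreover have "(\<lambda>v. b *v v) ` ?R \<subseteq> ?R"
    by auto
  moreover have "vec.subspace ((\<lambda>v. b *v v) ` ?R)"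
    using vec.linear_subspace_image[OF lin sub] .
  ultimately have eq: "(\<lambda>v. b *v v) ` ?R = ?R"
    using sub by (intro vec.subspace_dim_equal) auto
  have "\<exists>u. b *v axis j 1 = b *v (b *v u)" for j :: 'n
    using eq by (metis (no_types, lifting) image_iff rangeI)
  then obtain u where u: "\<And>j. b *v axis j 1 = b *v (b *v u j)"
    by metis
  define d where "d = (\<chi> i j. u j $ i)"
  have "b $ i $ j = (b ** b ** d) $ i $ j" for i j
  proof -
    have "b $ i $ j = (b *v axis j 1) $ i"
      by (simp add: matrix_vector_mult_def axis_def if_distrib[of "\<lambda>t. _ * t"] cong: if_cong)
    also have "\<dots> = ((b ** b) *v u j) $ i"
      by (simp add: u matrix_vector_mul_assoc)
    also have "\<dots> = (b ** b ** d) $ i $ j"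
      by (simp add: matrix_matrix_mult_def matrix_vector_mult_def d_def)
    finally show ?thesis .
  qed
  then have "b = b ** b ** d"
    by (simp add: vec_eq_iff)
  then show thesis by (rule that)
qed

text \<open>The witness is \<open>t ** b ** d\<close> with \<open>t\<close> the transpose of
  \<open>d\<close>, which is symmetric by construction. From b = bbd and b = tbb follows tb = tbbd =
  bd, and both products of \<open>b\<close> with the witness reduce to bd.\<close>

lemma self_adjoint_group_inverse:
  fixes b :: "rat ^ 'n ^ 'n"
  assumes "transpose b = b"
  obtains c where "transpose c = c" "b ** c = c ** b" "b ** c ** b = b" "c ** b ** c = c"
proof -
  obtain d where d: "b = b ** b ** d"
    using self_adjoint_regular[OF assms] .
  define t where "t = transpose d"
  have d': "t ** b ** b = b"
    using arg_cong[OF d, of transpose] by (simp add: matrix_transpose_mul assms matrix_mul_assoc t_def)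
  have comm: "t ** b = b ** d"
    by (metis d d' matrix_mul_assoc)
  have 1: "b ** (t ** b ** d) = b ** d" by (metis comm d matrix_mul_assoc)
  have 2: "(t ** b ** d) ** b = b ** d"
    by (metis comm d' matrix_mul_assoc)
  show thesis
  proof
    show "transpose (t ** b ** d) = t ** b ** d"
      by (simp add: matrix_transpose_mul assms matrix_mul_assoc t_def)
    show "b ** (t ** b ** d) = (t ** b ** d) ** b"
      using 1 2 by simp
    show "b ** (t ** b ** d) ** b = b"
      unfolding 1 by (metis comm d')
    show "(t ** b ** d) ** b ** (t ** b ** d) = t ** b ** d"
      unfolding 2 by (metis comm d d' matrix_mul_assoc)
  qed
qed

text \<open>The idempotents bc and bc' absorb each other, hence coincide, and c is recovered from bc
  by cbc = c. Uniqueness lets the inverse inherit the symmetries of \<open>b\<close>.\<close>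

lemma group_inverse_unique:
  fixes b :: "'a::semiring_1 ^ 'n ^ 'n"
  assumes "b ** c = c ** b" "b ** c ** b = b" "c ** b ** c = c"
    and "b ** c' = c' ** b" "b ** c' ** b = b" "c' ** b ** c' = c'"
  shows "c = c'"
proof -
  have "b ** c = b ** c'"
    by (metis assms(1,2,4,5) matrix_mul_assoc)
  then show ?thesis
    by (metis assms(1,3,4,6) matrix_mul_assoc)
qed

lemma matrix_mult_add_left: "(a + b) ** c = a ** c + b ** (c :: 'a::semiring_1 ^ 'p ^ 'n)"
  by (simp add: vec_eq_iff matrix_matrix_mult_def sum.distrib distrib_right)

lemma matrix_mult_diff_left: "(a - b) ** c = a ** c - b ** (c :: 'a::ring_1 ^ 'p ^ 'n)"
  by (simp add: vec_eq_iff matrix_matrix_mult_def sum_subtractf left_diff_distrib)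

lemma matrix_mult_diff_right: "c ** (a - b) = c ** a - c ** (b :: 'a::ring_1 ^ 'p ^ 'n)"
  by (simp add: vec_eq_iff matrix_matrix_mult_def sum_subtractf right_diff_distrib)

lemma matrix_mult_zero_left: "0 ** c = (0 :: 'a::semiring_1 ^ 'p ^ 'n)"
  by (simp add: vec_eq_iff matrix_matrix_mult_def)

lemma matrix_mult_zero_right: "c ** 0 = (0 :: 'a::semiring_1 ^ 'p ^ 'n)"
  by (simp add: vec_eq_iff matrix_matrix_mult_def)

lemma transpose_diff: "transpose (a - b) = transpose a - transpose (b :: 'a::ring_1 ^ 'p ^ 'n)"
  by (simp add: vec_eq_iff transpose_def)

text \<open>The diagonal entries of the Gram matrix are the sums of squares of the columns of
  \<open>a\<close>.\<close>

lemma gram_matrix_eq_0: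
  fixes a :: "rat ^ 'n ^ 'm"
  assumes "transpose a ** a = 0"
  shows "a = 0"
proof -
  have "(\<Sum>i\<in>UNIV. a $ i $ j * a $ i $ j) = (transpose a ** a) $ j $ j" for j
    by (simp add: matrix_matrix_mult_def transpose_def)
  then show ?thesis
    using assms by (simp add: sum_nonneg_eq_0_iff vec_eq_iff)
qed

section \<open>Matrices invariant under a finite group of permutations\<close>

locale finite_group_action = group G for G :: "('g, 'y) monoid_scheme" (structure) +
  fixes \<phi> :: "'g \<Rightarrow> 'n \<Rightarrow> 'n"
  assumes fin: "finite (carrier G)"
    and act_one: "\<phi> \<one> x = x"
    and act_mult: "\<lbrakk>g \<in> carrier G; h \<in> carrier G\<rbrakk> \<Longrightarrow> \<phi> (g \<otimes> h) x = \<phi> g (\<phi> h x)"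
begin

lemma act_inv: "g \<in> carrier G \<Longrightarrow> \<phi> (inv g) (\<phi> g x) = x" "g \<in> carrier G \<Longrightarrow> \<phi> g (\<phi> (inv g) x) = x"
  by (metis act_mult act_one inv_closed l_inv, metis act_mult act_one inv_closed r_inv)

end

text \<open>Finiteness of \<open>'n\<close> is what matrices require. The locale
  \<open>finite_group_action\<close> also serves for actions on lines, pairs of lines and sets of
  lines, where \<open>'n\<close> is built from set types.\<close>

locale finite_permutation_action = finite_group_action G \<phi>
  for G :: "('g, 'y) monoid_scheme" (structure) and \<phi> :: "'g \<Rightarrow> 'n::finite \<Rightarrow> 'n"
begin

lemma act_bij: "g \<in> carrier G \<Longrightarrow> bij (\<phi> g)"
  by (rule bij_betw_byWitness[where f' = "\<phi> (inv g)"]) (auto simp: act_inv)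

lemma act_eq_iff: "g \<in> carrier G \<Longrightarrow> \<phi> g x = y \<longleftrightarrow> x = \<phi> (inv g) y"
  using act_inv by auto

lemma invariant_transpose: "act_invariant G \<phi> m \<Longrightarrow> act_invariant G \<phi> (transpose m)"
  by (simp add: act_invariant_def transpose_def)

lemma invariant_mult:
  fixes m m' :: "'a::semiring_1 ^ 'n ^ 'n"
  assumes "act_invariant G \<phi> m" "act_invariant G \<phi> m'"
  shows "act_invariant G \<phi> (m ** m')"
  unfolding act_invariant_def
proof (intro ballI allI)
  fix g x y assume g: "g \<in> carrier G"
  have "(\<Sum>k\<in>UNIV. m $ \<phi> g x $ k * m' $ k $ \<phi> g y) =
        (\<Sum>k\<in>UNIV. m $ \<phi> g x $ \<phi> g k * m' $ \<phi> g k $ \<phi> g y)"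
    by (rule sum.reindex_bij_betw[OF act_bij[OF g], symmetric])
  then show "(m ** m') $ \<phi> g x $ \<phi> g y = (m ** m') $ x $ y"
    using assms g by (simp add: matrix_matrix_mult_def act_invariant_def)
qed

lemma invariant_diff:
  fixes m m' :: "'a::ring_1 ^ 'n ^ 'n"
  shows "\<lbrakk>act_invariant G \<phi> m; act_invariant G \<phi> m'\<rbrakk> \<Longrightarrow> act_invariant G \<phi> (m - m')"
  by (simp add: act_invariant_def)

lemma invariant_add:
  fixes m m' :: "'a::ring_1 ^ 'n ^ 'n"
  shows "\<lbrakk>act_invariant G \<phi> m; act_invariant G \<phi> m'\<rbrakk> \<Longrightarrow> act_invariant G \<phi> (m + m')"
  by (simp add: act_invariant_def)

text \<open>Reindexing by the permutation of \<open>g\<close> respects matrix products and fixes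
  \<open>b\<close>, so it carries \<open>c\<close> to a group inverse of \<open>b\<close>, which is
  \<open>c\<close> by uniqueness.\<close>

lemma invariant_group_inverse:
  fixes b :: "rat ^ 'n ^ 'n"
  assumes "act_invariant G \<phi> b"
    and c: "b ** c = c ** b" "b ** c ** b = b" "c ** b ** c = c"
  shows "act_invariant G \<phi> c"
  unfolding act_invariant_def
proof (intro ballI allI)
  fix g x y assume g: "g \<in> carrier G"
  define tr :: "rat ^ 'n ^ 'n \<Rightarrow> rat ^ 'n ^ 'n" where "tr m = (\<chi> x y. m $ \<phi> g x $ \<phi> g y)" for m
  have tr_mult: "tr (m ** m') = tr m ** tr m'" for m m'
    by (simp add: tr_def vec_eq_iff matrix_matrix_mult_def
        sum.reindex_bij_betw[OF act_bij[OF g], of "\<lambda>k. m $ _ $ k * m' $ k $ _"])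
  have "tr b = b"
    using assms(1) g by (simp add: tr_def act_invariant_def vec_eq_iff)
  then have "b ** tr c = tr c ** b" "b ** tr c ** b = b" "tr c ** b ** tr c = tr c"
    using arg_cong[OF c(1), of tr] arg_cong[OF c(2), of tr] arg_cong[OF c(3), of tr]
    by (simp_all only: tr_mult)
  then have "tr c = c"
    using c by (rule group_inverse_unique)
  then show "c $ \<phi> g x $ \<phi> g y = c $ x $ y"
    by (simp add: tr_def vec_eq_iff)
qed

text \<open>Average the matrix units and take traces.\<close>

lemma character_orthogonality:
  fixes e f :: "'a::comm_ring_1 ^ 'n ^ 'n"
  assumes f: "transpose f = f"
    and no_hom: "\<And>a. act_invariant G \<phi> a \<Longrightarrow> f ** a ** e = 0"
  shows "(\<Sum>g\<in>carrier G. act_character \<phi> f g * act_character \<phi> e g) = 0"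
proof -
  have zero: "(\<Sum>g\<in>carrier G. f $ \<phi> g u $ u * e $ \<phi> g v $ v) = 0" for u v
  proof -
    \<comment> \<open>The orbit sum of the matrix unit at (u, v) is invariant, and the (u, v) entry
      of \<open>f ** a ** e\<close> is the wanted sum over the group.\<close>
    define a :: "'a ^ 'n ^ 'n" where
      "a = (\<chi> x y. \<Sum>g\<in>carrier G. of_bool (x = \<phi> g u) * of_bool (y = \<phi> g v))"
    have "act_invariant G \<phi> a"
      unfolding act_invariant_def
    proof (intro ballI allI)
      fix h x y assume h: "h \<in> carrier G"
      have "(\<Sum>g\<in>carrier G. of_bool (\<phi> h x = \<phi> g u) * of_bool (\<phi> h y = \<phi> g v)) =
            (\<Sum>g\<in>carrier G. of_bool (x = \<phi> g u) * (of_bool (y = \<phi> g v) :: 'a))"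
        by (rule sum.reindex_bij_witness[of _ "\<lambda>g. h \<otimes> g" "\<lambda>g. inv h \<otimes> g"])
          (use h in \<open>auto simp: act_mult act_inv m_assoc[symmetric] act_eq_iff[OF h]\<close>)
      then show "a $ \<phi> h x $ \<phi> h y = a $ x $ y"
        by (simp add: a_def)
    qed
    then have "(f ** a ** e) $ u $ v = 0"
      using no_hom by simp
    moreover have "(f ** a ** e) $ u $ v =
      (\<Sum>y\<in>UNIV. \<Sum>x\<in>UNIV. \<Sum>g\<in>carrier G. f $ u $ x * of_bool (x = \<phi> g u) * (of_bool (y = \<phi> g v) * e $ y $ v))"
      by (simp add: matrix_matrix_mult_def a_def sum_distrib_left sum_distrib_right mult.assoc)
    also have "\<dots> = (\<Sum>y\<in>UNIV. \<Sum>g\<in>carrier G. \<Sum>x\<in>UNIV. f $ u $ x * of_bool (x = \<phi> g u) * (of_bool (y = \<phi> g v) * e $ y $ v))"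
      by (intro sum.cong refl sum.swap)
    also have "\<dots> = (\<Sum>g\<in>carrier G. \<Sum>y\<in>UNIV. \<Sum>x\<in>UNIV. f $ u $ x * of_bool (x = \<phi> g u) * (of_bool (y = \<phi> g v) * e $ y $ v))"
      by (rule sum.swap)
    also have "\<dots> = (\<Sum>g\<in>carrier G. f $ u $ \<phi> g u * e $ \<phi> g v $ v)"
    proof (intro sum.cong refl)
      fix g
      have "(\<Sum>x\<in>UNIV. f $ u $ x * of_bool (x = \<phi> g u) * t) = f $ u $ \<phi> g u * t" for t
        by (simp flip: sum_distrib_right add: of_bool_def if_distrib[of "\<lambda>t. _ * t"] cong: if_cong)
      then show "(\<Sum>y\<in>UNIV. \<Sum>x\<in>UNIV. f $ u $ x * of_bool (x = \<phi> g u) * (of_bool (y = \<phi> g v) * e $ y $ v))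
          = f $ u $ \<phi> g u * e $ \<phi> g v $ v"
        by (simp flip: sum_distrib_left add: of_bool_def if_distrib[of "\<lambda>t. t * _"] cong: if_cong)
    qed
    \<comment> \<open>Symmetry of \<open>f\<close> exchanges the indices \<open>u\<close> and
      \<open>\<phi> g u\<close>.\<close>
    finally show ?thesis
      using f by (simp add: transpose_def vec_eq_iff)
  qed
  have "(\<Sum>g\<in>carrier G. act_character \<phi> f g * act_character \<phi> e g) =
      (\<Sum>g\<in>carrier G. \<Sum>u\<in>UNIV. \<Sum>v\<in>UNIV. f $ \<phi> g u $ u * e $ \<phi> g v $ v)"
    by (simp add: act_character_def sum_product)
  also have "\<dots> = (\<Sum>u\<in>UNIV. \<Sum>g\<in>carrier G. \<Sum>v\<in>UNIV. f $ \<phi> g u $ u * e $ \<phi> g v $ v)"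
    by (rule sum.swap)
  also have "\<dots> = (\<Sum>u\<in>UNIV. \<Sum>v\<in>UNIV. \<Sum>g\<in>carrier G. f $ \<phi> g u $ u * e $ \<phi> g v $ v)"
    by (intro sum.cong refl sum.swap)
  finally show ?thesis
    by (simp add: zero)
qed

text \<open>This is tr(ab) = tr(ba) in the presence of a permutation: reindexing the inner sum by
  \<open>g\<close> and invariance of \<open>a\<close> move the permutation from \<open>a\<close> to
  \<open>b\<close>.\<close>

lemma character_commute:
  fixes a b :: "'a::comm_ring_1 ^ 'n ^ 'n"
  assumes "act_invariant G \<phi> a" "act_invariant G \<phi> b" "g \<in> carrier G"
  shows "act_character \<phi> (a ** b) g = act_character \<phi> (b ** a) g"
proof -
  have "act_character \<phi> (a ** b) g = (\<Sum>x\<in>UNIV. \<Sum>k\<in>UNIV. a $ \<phi> g x $ \<phi> g k * b $ \<phi> g k $ x)"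
    unfolding act_character_def matrix_matrix_mult_def
    by (simp add: sum.reindex_bij_betw[OF act_bij[OF assms(3)], of "\<lambda>k. a $ _ $ k * b $ k $ _"])
  also have "\<dots> = (\<Sum>x\<in>UNIV. \<Sum>k\<in>UNIV. b $ \<phi> g k $ x * a $ x $ k)"
    using assms(1,3) by (simp add: act_invariant_def mult.commute)
  also have "\<dots> = act_character \<phi> (b ** a) g"
    unfolding act_character_def matrix_matrix_mult_def by (subst sum.swap) simp
  finally show ?thesis .
qed

text \<open>The trace of a self-adjoint idempotent is the sum of the squares of all its
  entries.\<close>

lemma self_adjoint_idempotent_trace_zero:
  fixes e :: "rat ^ 'n ^ 'n"
  assumes "transpose e = e" "e ** e = e" "act_character \<phi> e \<one> = 0"
  shows "e = 0"
proof -
  have "e $ x $ x = (\<Sum>y\<in>UNIV. e $ x $ y * e $ x $ y)" for x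
  proof -
    have "e $ x $ x = (e ** transpose e) $ x $ x"
      by (simp add: assms)
    then show ?thesis
      by (simp add: matrix_matrix_mult_def transpose_def)
  qed
  then have "(\<Sum>x\<in>UNIV. \<Sum>y\<in>UNIV. e $ x $ y * e $ x $ y) = 0"
    using assms(3) by (simp add: act_character_def act_one)
  then show ?thesis
    by (simp add: sum_nonneg_eq_0_iff sum_nonneg vec_eq_iff)
qed

lemma character_diff:
  fixes e f :: "'a::ring_1 ^ 'n ^ 'n"
  shows "act_character \<phi> (e - f) g = act_character \<phi> e g - act_character \<phi> f g"
  by (simp add: act_character_def sum_subtractf)

text \<open>If no invariant \<open>f ** a ** e\<close> is nonzero, orthogonality of characters forces \<open>e = 0\<close>.
  Otherwise the pseudo-inverse of a nonzero one matches nonzero pieces of \<open>e\<close> and \<open>f\<close>, and the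
  complementary pieces again have equal characters.\<close>

theorem invariant_projections_equivalent:
  fixes e f :: "rat ^ 'n ^ 'n"
  assumes "act_invariant G \<phi> e" "transpose e = e" "e ** e = e"
    and "act_invariant G \<phi> f" "transpose f = f" "f ** f = f"
    and "\<And>g. g \<in> carrier G \<Longrightarrow> act_character \<phi> e g = act_character \<phi> f g"
  shows "\<exists>a b. act_invariant G \<phi> a \<and> act_invariant G \<phi> b \<and>
    f ** a = a \<and> a ** e = a \<and> e ** b = b \<and> b ** f = b \<and> a ** b = f \<and> b ** a = e"
  using assms
\<comment> \<open>The induction is on the rank of \<open>e\<close>; each round splits off a nonzero
  idempotent \<open>e1\<close> below \<open>e\<close>.\<close>
proof (induction "vec.dim (range (\<lambda>v. e *v v))" arbitrary: e f rule: less_induct)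
  case less
  show ?case
  proof (cases "\<forall>a. act_invariant G \<phi> a \<longrightarrow> f ** a ** e = 0")
    case True
    then have "(\<Sum>g\<in>carrier G. act_character \<phi> f g * act_character \<phi> e g) = 0"
      using less.prems by (intro character_orthogonality) auto
    then have "(\<Sum>g\<in>carrier G. act_character \<phi> e g * act_character \<phi> e g) = 0"
      using less.prems(7) by simp
    \<comment> \<open>A sum of rational squares vanishes termwise, and at the unit the character is
      the trace.\<close>
    then have "act_character \<phi> e \<one> = 0"
      using fin by (simp add: sum_nonneg_eq_0_iff)
    moreover from this have "act_character \<phi> f \<one> = 0"
      using less.prems(7) by simp
    ultimately have "e = 0" "f = 0"
      using self_adjoint_idempotent_trace_zero less.prems by blast+
    then show ?thesis
      by (intro exI[of _ 0]) (auto simp: act_invariant_def matrix_mult_zero_left)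
  next
    case False
    then obtain a0 where a0: "act_invariant G \<phi> a0" "f ** a0 ** e \<noteq> 0"
      by auto
    define a where "a = f ** a0 ** e"
    have a: "act_invariant G \<phi> a" "a \<noteq> 0"
      using a0 less.prems(1,4) by (auto simp: a_def invariant_mult)
    have fa: "f ** a = a"
      by (simp add: a_def matrix_mul_assoc less.prems(6))
    have ae: "a ** e = a"
      by (simp add: a_def matrix_mul_assoc[symmetric] less.prems(3))
    define s where "s = transpose a"
    have es: "e ** s = s" and sf: "s ** f = s"
      using arg_cong[OF ae, of transpose] arg_cong[OF fa, of transpose]
      by (simp_all add: s_def matrix_transpose_mul less.prems)
    define b where "b = s ** a"
    have b: "act_invariant G \<phi> b" "transpose b = b" "b \<noteq> 0"
      using a gram_matrix_eq_0[of a]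
      by (auto simp: b_def s_def invariant_mult invariant_transpose matrix_transpose_mul)
    obtain c where c: "transpose c = c" "b ** c = c ** b" "b ** c ** b = b" "c ** b ** c = c"
      using self_adjoint_group_inverse[OF b(2)] .
    have c_inv: "act_invariant G \<phi> c"
      using invariant_group_inverse[OF b(1) c(2-4)] .
    \<comment> \<open>As \<open>b\<close> is the Gram matrix of \<open>a\<close> and
      \<open>c\<close> its group inverse, \<open>e1\<close> is the orthogonal projection onto the
      range of \<open>s\<close> and \<open>f1\<close> the one onto the range of \<open>a\<close>.
      The maps \<open>a1\<close> and \<open>b1\<close> identify these two ranges.\<close>
    define e1 where "e1 = c ** b"
    define f1 where "f1 = a ** c ** s"
    define a1 where "a1 = a ** e1"
    define b1 where "b1 = c ** s"
    have e1: "act_invariant G \<phi> e1" "transpose e1 = e1" "e1 ** e1 = e1"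
      using c b c_inv by (auto simp: e1_def invariant_mult matrix_transpose_mul matrix_mul_assoc)
    have eb: "e ** b = b" and be: "b ** e = b"
      by (simp add: b_def matrix_mul_assoc es) (simp add: b_def matrix_mul_assoc[symmetric] ae)
    have ee1: "e ** e1 = e1" "e1 ** e = e1"
      using eb be by (simp add: e1_def c(2)[symmetric] matrix_mul_assoc)
        (simp add: e1_def matrix_mul_assoc[symmetric] be)
    have e1c: "e1 ** c = c" and be1: "b ** e1 = b"
      using c by (simp_all add: e1_def matrix_mul_assoc)
    have sa: "x ** s ** a = x ** b" for x :: "rat ^ 'n ^ 'n"
      by (simp add: b_def matrix_mul_assoc)
    have f1: "act_invariant G \<phi> f1" "transpose f1 = f1" "f1 ** f1 = f1"
    proof -
      show "act_invariant G \<phi> f1"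
        using a c_inv by (simp add: f1_def s_def invariant_mult invariant_transpose)
      show "transpose f1 = f1"
        by (simp add: f1_def s_def matrix_transpose_mul c matrix_mul_assoc)
      have "f1 ** f1 = a ** (c ** b ** c) ** s"
        by (simp add: f1_def b_def matrix_mul_assoc)
      then show "f1 ** f1 = f1"
        by (simp add: c f1_def)
    qed
    have ff1: "f ** f1 = f1" "f1 ** f = f1"
      by (simp add: f1_def matrix_mul_assoc fa) (simp add: f1_def matrix_mul_assoc[symmetric] sf)
    have b1a1: "b1 ** a1 = e1"
      by (simp add: b1_def a1_def matrix_mul_assoc sa e1(3) flip: e1_def)
    have a1b1: "a1 ** b1 = f1"
      by (simp add: b1_def a1_def f1_def matrix_mul_assoc[symmetric])
        (simp add: matrix_mul_assoc e1c)
    have a1: "act_invariant G \<phi> a1" "a1 ** e1 = a1" "f1 ** a1 = a1"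
      using a e1 by (simp_all add: a1_def invariant_mult flip: matrix_mul_assoc)
        (metis a1_def a1b1 b1a1 e1(3) matrix_mul_assoc)
    have b1: "act_invariant G \<phi> b1" "e1 ** b1 = b1" "b1 ** f1 = b1"
      using a c_inv e1c by (simp_all add: b1_def s_def invariant_mult invariant_transpose matrix_mul_assoc)
        (metis a1b1 b1_def b1a1 e1c matrix_mul_assoc s_def)
    define e2 where "e2 = e - e1"
    define f2 where "f2 = f - f1"
    have e2: "act_invariant G \<phi> e2" "transpose e2 = e2" "e2 ** e2 = e2" "e1 ** e2 = 0" "e2 ** e1 = 0"
      using less.prems e1 ee1 by (simp_all add: e2_def invariant_diff transpose_diff
          matrix_mult_diff_left matrix_mult_diff_right)
    have f2: "act_invariant G \<phi> f2" "transpose f2 = f2" "f2 ** f2 = f2" "f1 ** f2 = 0" "f2 ** f1 = 0"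
      using less.prems f1 ff1 by (simp_all add: f2_def invariant_diff transpose_diff
          matrix_mult_diff_left matrix_mult_diff_right)
    \<comment> \<open>\<open>e1\<close> and \<open>f1\<close> are the products of \<open>a1\<close>
      and \<open>b1\<close> in the two orders, so their characters agree and can be
      subtracted.\<close>
    have char: "act_character \<phi> e2 g = act_character \<phi> f2 g" if "g \<in> carrier G" for g
      using less.prems(7)[OF that] character_commute[OF a1(1) b1(1) that]
      by (simp add: e2_def f2_def character_diff a1b1 b1a1)
    have dim: "vec.dim (range (\<lambda>v. e2 *v v)) < vec.dim (range (\<lambda>v. e *v v))"
    proof (rule vec.dim_psubset)
      have sub: "vec.subspace (range (\<lambda>v. m *v v))" for m :: "rat ^ 'n ^ 'n"
        using vec.linear_subspace_image[OF matrix_vector_mul_linear_gen vec.subspace_UNIV] by simp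
      \<comment> \<open>The range of \<open>e1\<close> lies in that of \<open>e\<close> and meets
        that of \<open>e2\<close> only in 0, so the rank drops.\<close>
      have "e1 \<noteq> 0"
        using be1 b(3) by (auto simp: matrix_mult_zero_right)
      then obtain w where w: "e1 *v w \<noteq> 0"
        by (metis matrix_eq matrix_vector_mult_0)
      have "range (\<lambda>v. e2 *v v) \<subseteq> range (\<lambda>v. e *v v)"
      proof clarify
        fix v
        have "e2 = e ** e2"
          by (simp add: e2_def matrix_mult_diff_right less.prems(3) ee1)
        then show "e2 *v v \<in> range (\<lambda>v. e *v v)"
          by (metis matrix_vector_mul_assoc rangeI)
      qed
      moreover have "e1 *v w \<in> range (\<lambda>v. e *v v)"
        by (metis ee1(1) matrix_vector_mul_assoc rangeI)
      moreover have "e1 *v w \<notin> range (\<lambda>v. e2 *v v)"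
      proof
        assume "e1 *v w \<in> range (\<lambda>v. e2 *v v)"
        then obtain v where "e1 *v w = e2 *v v"
          by auto
        then have "e1 *v (e1 *v w) = e1 *v (e2 *v v)"
          by simp
        then show False
          using w by (simp add: matrix_vector_mul_assoc e1 e2)
      qed
      ultimately show "vec.span (range (\<lambda>v. e2 *v v)) \<subset> vec.span (range (\<lambda>v. e *v v))"
        unfolding vec.span_eq_iff[THEN iffD2, OF sub] by blast
    qed
    obtain a2 b2 where *: "act_invariant G \<phi> a2" "act_invariant G \<phi> b2"
      "f2 ** a2 = a2" "a2 ** e2 = a2" "e2 ** b2 = b2" "b2 ** f2 = b2" "a2 ** b2 = f2" "b2 ** a2 = e2"
      using less.hyps[OF dim e2(1-3) f2(1-3) char] by blast
    \<comment> \<open>Every factor absorbs its idempotents on both sides, so products across the two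
      orthogonal pieces vanish.\<close>
    have 0: "a1 ** b2 = 0" "a2 ** b1 = 0" "b1 ** a2 = 0" "b2 ** a1 = 0"
      "f1 ** a2 = 0" "f2 ** a1 = 0" "a1 ** e2 = 0" "a2 ** e1 = 0"
      "e1 ** b2 = 0" "e2 ** b1 = 0" "b1 ** f2 = 0" "b2 ** f1 = 0"
      by (metis (no_types) * a1 b1 e2(4,5) f2(4,5) matrix_mul_assoc matrix_mult_zero_left matrix_mult_zero_right)+
    have "e = e1 + e2" "f = f1 + f2"
      by (simp_all add: e2_def f2_def)
    then show ?thesis
      using a1 b1 * 0 by (intro exI[of _ "a1 + a2"] exI[of _ "b1 + b2"])
        (simp add: invariant_add matrix_add_ldistrib matrix_mult_add_left a1b1 b1a1)
  qed
qed

end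

section \<open>Matrices over the group ring as translation-invariant matrices\<close>

definition group_ring_mult ::
  "('g, 'y) monoid_scheme \<Rightarrow> ('i \<Rightarrow> 'k \<Rightarrow> 'g \<Rightarrow> 'a::comm_semiring_1) \<Rightarrow> ('k \<Rightarrow> 'j \<Rightarrow> 'g \<Rightarrow> 'a) \<Rightarrow>
    'i \<Rightarrow> 'j \<Rightarrow> 'g \<Rightarrow> 'a" where
  "group_ring_mult G a b i j g =
     (\<Sum>k\<in>UNIV. \<Sum>h\<in>carrier G. a i k h * b k j (inv\<^bsub>G\<^esub> h \<otimes>\<^bsub>G\<^esub> g))"

text \<open>The diagonal matrix of the idempotents e_H, whose entries are coefficient functions.
  Only values on \<open>carrier G\<close> have a meaning, so equations between such matrices are
  stated there.\<close>

definition averaging :: "('i \<Rightarrow> 'g set) \<Rightarrow> 'i \<Rightarrow> 'i \<Rightarrow> 'g \<Rightarrow> rat" where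
  "averaging H i j g = of_bool (i = j \<and> g \<in> H i) / of_nat (card (H i))"

text \<open>Left translation on one copy of the group for each index. Keeping the elements outside
  \<open>carrier G\<close> fixed makes it a permutation of a whole type, as matrices indexed by
  types require.\<close>

definition translate :: "('g, 'y) monoid_scheme \<Rightarrow> 'g \<Rightarrow> 'i \<times> 'g \<Rightarrow> 'i \<times> 'g" where
  "translate G g p = (fst p, if snd p \<in> carrier G then g \<otimes>\<^bsub>G\<^esub> snd p else snd p)"

text \<open>Right multiplication by the averaging elements, extended by zero. Its image consists of
  the functions that are constant on the left cosets of \<open>H i\<close> in the copy of index i:
  the permutation representation on the disjoint union of the G/H_i.\<close>

definition coset_projection ::
  "('g, 'y) monoid_scheme \<Rightarrow> ('i::finite \<Rightarrow> 'g::finite set) \<Rightarrow> rat ^ ('i \<times> 'g) ^ ('i \<times> 'g)" where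
  "coset_projection G H = (\<chi> p q. of_bool (snd p \<in> carrier G \<and> snd q \<in> carrier G) *
     averaging H (fst p) (fst q) (inv\<^bsub>G\<^esub> (snd p) \<otimes>\<^bsub>G\<^esub> snd q))"

text \<open>For a subgroup \<open>S\<close>, division by the order of \<open>S\<close> gives the
  number of cosets xS fixed by \<open>g\<close>, the permutation character of G/S.\<close>

definition conj_count :: "('g, 'y) monoid_scheme \<Rightarrow> 'g set \<Rightarrow> 'g \<Rightarrow> nat" where
  "conj_count G S g = card {x \<in> carrier G. inv\<^bsub>G\<^esub> x \<otimes>\<^bsub>G\<^esub> g \<otimes>\<^bsub>G\<^esub> x \<in> S}"

lemma finite_permutation_action_translate:
  fixes G :: "('g::finite, 'y) monoid_scheme"
  assumes "group G"
  shows "finite_permutation_action G (translate G :: 'g \<Rightarrow> 'i::finite \<times> 'g \<Rightarrow> _)"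
proof -
  interpret group G by fact
  show ?thesis
    by unfold_locales (auto simp: translate_def m_assoc)
qed

lemma (in subgroup) inv_mult_mem_commute:
  assumes "group G" "x \<in> carrier G" "y \<in> carrier G"
  shows "inv x \<otimes> y \<in> H \<longleftrightarrow> inv y \<otimes> x \<in> H"
proof -
  interpret group G by fact
  have "inv x \<otimes> y = inv (inv y \<otimes> x)" "inv y \<otimes> x = inv (inv x \<otimes> y)"
    using assms by (simp_all add: inv_mult_group)
  then show ?thesis
    by (metis m_inv_closed)
qed

text \<open>These are the hypotheses of \<open>invariant_projections_equivalent\<close>, with the
  character made explicit as the permutation character of the disjoint union of the coset
  spaces.\<close>

lemma coset_projection_properties:
  fixes G :: "('g::finite, 'y) monoid_scheme" (structure) and H :: "'i::finite \<Rightarrow> 'g set"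
  assumes "group G" and H: "\<And>i. subgroup (H i) G"
  shows "act_invariant G (translate G) (coset_projection G H)"
    and "transpose (coset_projection G H) = coset_projection G H"
    and "coset_projection G H ** coset_projection G H = coset_projection G H"
    and "g \<in> carrier G \<Longrightarrow> act_character (translate G) (coset_projection G H) g =
           (\<Sum>i\<in>UNIV. of_nat (conj_count G (H i) g) / of_nat (card (H i)))"
proof -
  interpret group G by fact
  show "act_invariant G (translate G) (coset_projection G H)"
    by (auto simp: act_invariant_def coset_projection_def translate_def inv_mult_group m_assoc)
      (simp_all flip: m_assoc)
  show "transpose (coset_projection G H) = coset_projection G H"
    using subgroup.inv_mult_mem_commute[OF H \<open>group G\<close>]
    by (auto simp: vec_eq_iff transpose_def coset_projection_def averaging_def)
  show "coset_projection G H ** coset_projection G H = coset_projection G H"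
  proof -
    have "(\<Sum>q\<in>UNIV. coset_projection G H $ (i, x) $ q * coset_projection G H $ q $ (j, z)) =
      coset_projection G H $ (i, x) $ (j, z)" for i x j z
    proof (cases "x \<in> carrier G \<and> z \<in> carrier G")
      case True
      have "(\<Sum>q\<in>UNIV. coset_projection G H $ (i, x) $ q * coset_projection G H $ q $ (j, z)) =
        (\<Sum>k\<in>UNIV. \<Sum>y\<in>UNIV. coset_projection G H $ (i, x) $ (k, y) * coset_projection G H $ (k, y) $ (j, z))"
        by (simp add: sum.cartesian_product flip: UNIV_Times_UNIV)
      also have "\<dots> = (\<Sum>k\<in>UNIV. if k = i then
        \<Sum>y\<in>UNIV. coset_projection G H $ (i, x) $ (i, y) * coset_projection G H $ (i, y) $ (j, z) else 0)"
        by (rule sum.cong) (auto simp: coset_projection_def averaging_def)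
      also have "\<dots> = (\<Sum>y\<in>UNIV. coset_projection G H $ (i, x) $ (i, y) * coset_projection G H $ (i, y) $ (j, z))"
        by simp
      \<comment> \<open>Only y in the coset of x by \<open>H i\<close> contribute. The rows of x and
        y then agree, so these terms are all equal.\<close>
      also have "\<dots> = (\<Sum>y\<in>{y \<in> carrier G. inv x \<otimes> y \<in> H i}.
          1 / of_nat (card (H i)) * coset_projection G H $ (i, x) $ (j, z))"
      proof (rule sum.mono_neutral_cong_right)
        fix y assume y: "y \<in> {y \<in> carrier G. inv x \<otimes> y \<in> H i}"
        have xz: "(inv x \<otimes> y) \<otimes> (inv y \<otimes> z) = inv x \<otimes> z"
          using y True by (simp add: m_assoc) (simp add: m_assoc[symmetric])
        have yz: "inv (inv x \<otimes> y) \<otimes> (inv x \<otimes> z) = inv y \<otimes> z"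
          using y True by (simp add: inv_mult_group m_assoc) (simp add: m_assoc[symmetric])
        have "inv y \<otimes> z \<in> H i \<longleftrightarrow> inv x \<otimes> z \<in> H i"
          using subgroup.m_closed[OF H] subgroup.m_inv_closed[OF H] y xz yz
          by (metis (no_types, lifting) mem_Collect_eq)
        then show "coset_projection G H $ (i, x) $ (i, y) * coset_projection G H $ (i, y) $ (j, z) =
           1 / of_nat (card (H i)) * coset_projection G H $ (i, x) $ (j, z)"
          using y True by (auto simp: coset_projection_def averaging_def)
      qed (auto simp: coset_projection_def averaging_def)
      also have "card {y \<in> carrier G. inv x \<otimes> y \<in> H i} = card (H i)"
        by (rule bij_betw_same_card[of "\<lambda>y. inv x \<otimes> y"], rule bij_betw_byWitness[where f' = "\<lambda>h. x \<otimes> h"])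
          (use True subgroup.mem_carrier[OF H] in \<open>auto simp flip: m_assoc\<close>)
      moreover have "card (H i) \<noteq> 0"
        using subgroup.one_closed[OF H] by auto
      ultimately show ?thesis
        by simp
    next
      case False
      then show ?thesis
        by (auto simp: coset_projection_def)
    qed
    then show ?thesis
      by (simp add: vec_eq_iff matrix_matrix_mult_def split_paired_all)
  qed
  show "act_character (translate G) (coset_projection G H) g =
           (\<Sum>i\<in>UNIV. of_nat (conj_count G (H i) g) / of_nat (card (H i)))" if g: "g \<in> carrier G"
  proof -
    \<comment> \<open>The diagonal entry compares gx with x, which yields the inverse of the
      conjugate of g by x.\<close>
    have mem: "inv (g \<otimes> x) \<otimes> x \<in> H i \<longleftrightarrow> inv x \<otimes> g \<otimes> x \<in> H i" if "x \<in> carrier G" for x i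
      using that g subgroup.inv_mult_mem_commute[OF H \<open>group G\<close>, of "g \<otimes> x" x]
      by (simp add: m_assoc)
    have "act_character (translate G) (coset_projection G H) g =
      (\<Sum>i\<in>UNIV. \<Sum>x\<in>UNIV. coset_projection G H $ translate G g (i, x) $ (i, x))"
      by (simp add: act_character_def sum.cartesian_product flip: UNIV_Times_UNIV)
    also have "\<dots> = (\<Sum>i\<in>UNIV. \<Sum>x\<in>{x \<in> carrier G. inv x \<otimes> g \<otimes> x \<in> H i}. 1 / of_nat (card (H i)))"
      by (intro sum.cong refl sum.mono_neutral_cong_right)
        (use g mem in \<open>auto simp: coset_projection_def averaging_def translate_def\<close>)
    finally show ?thesis
      by (simp add: conj_count_def)
  qed
qed

text \<open>A matrix over the group ring is the same as a translation-invariant matrix indexed by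
  \<open>'i \<times> carrier G\<close>; its entries are read off from the rows at the unit.\<close>

lemma averaging_equivalent:
  fixes G :: "('g::finite, 'y) monoid_scheme" (structure) and H K :: "'i::finite \<Rightarrow> 'g set"
  assumes "group G" and H: "\<And>i. subgroup (H i) G" and K: "\<And>i. subgroup (K i) G"
    and count: "\<And>g. g \<in> carrier G \<Longrightarrow>
      (\<Sum>i\<in>UNIV. of_nat (conj_count G (H i) g) / of_nat (card (H i)) :: rat) =
      (\<Sum>i\<in>UNIV. of_nat (conj_count G (K i) g) / of_nat (card (K i)))"
  shows "\<exists>a b :: 'i \<Rightarrow> 'i \<Rightarrow> 'g \<Rightarrow> rat. \<forall>i j. \<forall>g \<in> carrier G.
      group_ring_mult G (averaging K) a i j g = a i j g \<and>
      group_ring_mult G (averaging H) b i j g = b i j g \<and>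
      group_ring_mult G a b i j g = averaging K i j g \<and>
      group_ring_mult G b a i j g = averaging H i j g"
proof -
  interpret finite_permutation_action G "translate G :: 'g \<Rightarrow> 'i \<times> 'g \<Rightarrow> _"
    by (rule finite_permutation_action_translate) fact
  let ?e = "coset_projection G H" and ?f = "coset_projection G K"
  have char: "act_character (translate G) ?e g = act_character (translate G) ?f g" if "g \<in> carrier G" for g
    using count[OF that] by (simp add: coset_projection_properties(4) assms(1) H K that)
  obtain a b where ab: "act_invariant G (translate G) a" "act_invariant G (translate G) b"
    "?f ** a = a" "a ** ?e = a" "?e ** b = b" "b ** ?f = b" "a ** b = ?f" "b ** a = ?e"
    using invariant_projections_equivalent[OF coset_projection_properties(1,2,3)[OF assms(1) H]
        coset_projection_properties(1,2,3)[OF assms(1) K] char] by blast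
  define entry :: "rat ^ ('i \<times> 'g) ^ ('i \<times> 'g) \<Rightarrow> 'i \<Rightarrow> 'i \<Rightarrow> 'g \<Rightarrow> rat" where
    "entry m i j g = m $ (i, \<one>) $ (j, g)" for m i j g
  \<comment> \<open>A matrix that absorbs a coset projection on the left has zero rows outside
    \<open>carrier G\<close>, so matrix products reduce to sums over the group.\<close>
  have supp: "m $ (i, x) $ q = 0" if "coset_projection G L ** m = m" "x \<notin> carrier G"
    for L m i x q
  proof -
    have "m $ (i, x) $ q = (coset_projection G L ** m) $ (i, x) $ q"
      by (simp add: that)
    also have "\<dots> = 0"
      using that(2) by (simp add: matrix_matrix_mult_def coset_projection_def)
    finally show ?thesis .
  qed
  have mult: "entry (m ** m') i j g = group_ring_mult G (entry m) (entry m') i j g"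
    if m': "act_invariant G (translate G) m'" "coset_projection G L ** m' = m'" and g: "g \<in> carrier G"
    for m m' L i j g
  proof -
    have "entry (m ** m') i j g =
      (\<Sum>k\<in>UNIV. \<Sum>h\<in>UNIV. m $ (i, \<one>) $ (k, h) * m' $ (k, h) $ (j, g))"
      by (simp add: entry_def matrix_matrix_mult_def sum.cartesian_product flip: UNIV_Times_UNIV)
    also have "\<dots> = (\<Sum>k\<in>UNIV. \<Sum>h\<in>carrier G. m $ (i, \<one>) $ (k, h) * m' $ (k, h) $ (j, g))"
      by (intro sum.cong refl sum.mono_neutral_right) (auto simp: supp[OF m'(2)])
    also have "\<dots> = group_ring_mult G (entry m) (entry m') i j g"
      unfolding group_ring_mult_def entry_def
    proof (intro sum.cong refl)
      fix k h assume h: "h \<in> carrier G"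
      \<comment> \<open>Translation by the inverse of h carries row h to the row of the unit; this
        is where the convolution comes from.\<close>
      have "m' $ (k, h) $ (j, g) = m' $ translate G (inv h) (k, h) $ translate G (inv h) (j, g)"
        using m'(1) h unfolding act_invariant_def by (metis inv_closed)
      then show "m $ (i, \<one>) $ (k, h) * m' $ (k, h) $ (j, g) =
          m $ (i, \<one>) $ (k, h) * m' $ (k, \<one>) $ (j, inv h \<otimes> g)"
        using h g by (simp add: translate_def)
    qed
    finally show ?thesis .
  qed
  have entry_coset: "entry (coset_projection G L) i j g = averaging L i j g" if "g \<in> carrier G"
    for L i j g
    using that by (simp add: entry_def coset_projection_def)
  have coset_mult: "group_ring_mult G (averaging L) (entry m) i j g = entry m i j g"
    if "act_invariant G (translate G) m" "coset_projection G L ** m = m" "g \<in> carrier G" for L m i j g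
  proof -
    have "group_ring_mult G (averaging L) (entry m) i j g =
        group_ring_mult G (entry (coset_projection G L)) (entry m) i j g"
      by (simp add: group_ring_mult_def entry_coset)
    then show ?thesis
      using mult[OF that, of "coset_projection G L" i j] that(2) by simp
  qed
  have "group_ring_mult G (averaging K) (entry a) i j g = entry a i j g \<and>
      group_ring_mult G (averaging H) (entry b) i j g = entry b i j g \<and>
      group_ring_mult G (entry a) (entry b) i j g = averaging K i j g \<and>
      group_ring_mult G (entry b) (entry a) i j g = averaging H i j g"
    if g: "g \<in> carrier G" for i j g
    using coset_mult[OF ab(1,3) g] coset_mult[OF ab(2,5) g] mult[OF ab(1,3) g, of b i j]
      mult[OF ab(2,5) g, of a i j] entry_coset[OF g] ab(7,8) by simp
  then show ?thesis
    by blast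
qed

section \<open>Group rings acting on objects of a rational-linear category\<close>

context category
begin

lemma Hom_Ob: "f \<in> Hom C X Y \<Longrightarrow> X \<in> Ob C" "f \<in> Hom C X Y \<Longrightarrow> Y \<in> Ob C"
  using Dom_Ob Cod_Ob by (auto simp: Hom_def)

end

section \<open>Finite sums and scalar multiples of morphisms\<close>

context additive_rat_linear_category
begin

abbreviation msum :: "'o \<Rightarrow> 'o \<Rightarrow> ('i \<Rightarrow> 'm) \<Rightarrow> 'i set \<Rightarrow> 'm" where
  "msum X Y \<equiv> finsum (hom_module C X Y)"

lemma hom_module_simps [simp]:
  "carrier (hom_module C X Y) = Hom C X Y" "zero (hom_module C X Y) = Zero C X Y"
  "add (hom_module C X Y) = Add C" "module.smult (hom_module C X Y) = Scale C"
  by (simp_all add: hom_module_def)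

lemma hom_abelian_group: "\<lbrakk>X \<in> Ob C; Y \<in> Ob C\<rbrakk> \<Longrightarrow> abelian_group (hom_module C X Y)"
  using hom_module by (simp add: Module.module_def)

lemma hom_abelian_monoid: "\<lbrakk>X \<in> Ob C; Y \<in> Ob C\<rbrakk> \<Longrightarrow> abelian_monoid (hom_module C X Y)"
  using hom_abelian_group abelian_group_def by blast

lemma Zero_Hom: "\<lbrakk>X \<in> Ob C; Y \<in> Ob C\<rbrakk> \<Longrightarrow> Zero C X Y \<in> Hom C X Y"
  using abelian_monoid.zero_closed[OF hom_abelian_monoid] by simp

lemma Add_Hom: "\<lbrakk>f \<in> Hom C X Y; g \<in> Hom C X Y\<rbrakk> \<Longrightarrow> Add C f g \<in> Hom C X Y"
  using abelian_monoid.a_closed[OF hom_abelian_monoid] Hom_Ob by fastforce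

lemma Zero_Add: "f \<in> Hom C X Y \<Longrightarrow> Add C (Zero C X Y) f = f"
  using abelian_monoid.l_zero[OF hom_abelian_monoid] Hom_Ob by fastforce

lemma Add_Zero: "f \<in> Hom C X Y \<Longrightarrow> Add C f (Zero C X Y) = f"
  using abelian_monoid.r_zero[OF hom_abelian_monoid] Hom_Ob by fastforce

text \<open>Cancellation in the group of morphisms. By bilinearity, a composite with
  \<open>Zero\<close> satisfies the assumed equation.\<close>

lemma Add_self_eq_Zero:
  assumes "f \<in> Hom C X Y" "Add C f f = f"
  shows "f = Zero C X Y"
proof -
  interpret abelian_group "hom_module C X Y"
    using hom_abelian_group Hom_Ob[OF assms(1)] by blast
  show ?thesis
    using assms add.r_cancel_one[of f f] by simp
qed

lemma Scale_Hom: "f \<in> Hom C X Y \<Longrightarrow> Scale C q f \<in> Hom C X Y"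
  using Module.module.smult_closed[OF hom_module, of X Y q f] Hom_Ob by (simp add: type_ring_def)

lemma Scale_one: "f \<in> Hom C X Y \<Longrightarrow> Scale C 1 f = f"
  using Module.module.smult_one[OF hom_module, of X Y f] Hom_Ob by (simp add: type_ring_def)

lemma Scale_Scale: "f \<in> Hom C X Y \<Longrightarrow> Scale C q (Scale C r f) = Scale C (q * r) f"
  using Module.module.smult_assoc1[OF hom_module, of X Y q r f] Hom_Ob by (simp add: type_ring_def)

lemma Scale_add_left: "f \<in> Hom C X Y \<Longrightarrow> Scale C (q + r) f = Add C (Scale C q f) (Scale C r f)"
  using Module.module.smult_l_distr[OF hom_module, of X Y q r f] Hom_Ob by (simp add: type_ring_def)

lemma Scale_zero: "f \<in> Hom C X Y \<Longrightarrow> Scale C 0 f = Zero C X Y"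
  using Module.module.smult_l_null[OF hom_module, of X Y f] Hom_Ob by (simp add: type_ring_def)

lemma Scale_Add: "\<lbrakk>f \<in> Hom C X Y; g \<in> Hom C X Y\<rbrakk> \<Longrightarrow> Scale C q (Add C f g) = Add C (Scale C q f) (Scale C q g)"
  using Module.module.smult_r_distr[OF hom_module, of X Y q f g] Hom_Ob by (simp add: type_ring_def)

lemma Comp_Zero:
  assumes "X \<in> Ob C" "g \<in> Hom C Y Z"
  shows "g \<cdot> Zero C X Y = Zero C X Z"
proof -
  have z: "Zero C X Y \<in> Hom C X Y"
    using Zero_Hom assms Hom_Ob by blast
  show ?thesis
    using Comp_Add_right[OF z z assms(2)] Zero_Add[OF z]
    by (intro Add_self_eq_Zero Comp_Hom[OF z assms(2)]) simp
qed

lemma Zero_Comp: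
  assumes "Z \<in> Ob C" "f \<in> Hom C X Y"
  shows "Zero C Y Z \<cdot> f = Zero C X Z"
proof -
  have z: "Zero C Y Z \<in> Hom C Y Z"
    using Zero_Hom assms Hom_Ob by blast
  show ?thesis
    using Comp_Add_left[OF assms(2) z z] Zero_Add[OF z]
    by (intro Add_self_eq_Zero Comp_Hom[OF assms(2) z]) simp
qed

lemma msum_Hom: "\<lbrakk>X \<in> Ob C; Y \<in> Ob C; \<And>i. i \<in> A \<Longrightarrow> f i \<in> Hom C X Y\<rbrakk> \<Longrightarrow> msum X Y f A \<in> Hom C X Y"
  using abelian_monoid.finsum_closed[OF hom_abelian_monoid, of X Y f A] by (simp add: Pi_iff)

lemma msum_empty: "\<lbrakk>X \<in> Ob C; Y \<in> Ob C\<rbrakk> \<Longrightarrow> msum X Y f {} = Zero C X Y"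
  using abelian_monoid.finsum_empty[OF hom_abelian_monoid] by simp

lemma msum_insert:
  "\<lbrakk>X \<in> Ob C; Y \<in> Ob C; finite A; a \<notin> A; f a \<in> Hom C X Y; \<And>i. i \<in> A \<Longrightarrow> f i \<in> Hom C X Y\<rbrakk>
    \<Longrightarrow> msum X Y f (insert a A) = Add C (f a) (msum X Y f A)"
  using abelian_monoid.finsum_insert[OF hom_abelian_monoid, of X Y A a f] by (simp add: Pi_iff)

lemma msum_cong:
  assumes "X \<in> Ob C" "Y \<in> Ob C" "A = B" "\<And>i. i \<in> B \<Longrightarrow> f i = g i" "\<And>i. i \<in> B \<Longrightarrow> g i \<in> Hom C X Y"
  shows "msum X Y f A = msum X Y g B"
  using abelian_monoid.finsum_cong'[OF hom_abelian_monoid[OF assms(1,2)], of A B g f] assms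
  by (simp add: Pi_iff)

lemma msum_Un_disjoint:
  assumes "X \<in> Ob C" "Y \<in> Ob C" "finite A" "finite B" "A \<inter> B = {}"
    "\<And>i. i \<in> A \<union> B \<Longrightarrow> f i \<in> Hom C X Y"
  shows "msum X Y f (A \<union> B) = Add C (msum X Y f A) (msum X Y f B)"
  using abelian_monoid.finsum_Un_disjoint[OF hom_abelian_monoid[OF assms(1,2)], of A B f] assms
  by (simp add: Pi_iff)

lemma msum_Add:
  assumes "X \<in> Ob C" "Y \<in> Ob C" "\<And>i. i \<in> A \<Longrightarrow> f i \<in> Hom C X Y" "\<And>i. i \<in> A \<Longrightarrow> g i \<in> Hom C X Y"
  shows "msum X Y (\<lambda>i. Add C (f i) (g i)) A = Add C (msum X Y f A) (msum X Y g A)"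
  using abelian_monoid.finsum_addf[OF hom_abelian_monoid[OF assms(1,2)], of f A g] assms
  by (simp add: Pi_iff)

lemma msum_Zero: "\<lbrakk>X \<in> Ob C; Y \<in> Ob C\<rbrakk> \<Longrightarrow> msum X Y (\<lambda>i. Zero C X Y) A = Zero C X Y"
  using abelian_monoid.finsum_zero[OF hom_abelian_monoid, of X Y A] by simp

lemma msum_singleton: "f i \<in> Hom C X Y \<Longrightarrow> msum X Y f {i} = f i"
  using msum_insert[of X Y "{}" i f] Hom_Ob[of "f i" X Y] by (simp add: msum_empty Add_Zero)

lemma msum_reindex:
  assumes "X \<in> Ob C" "Y \<in> Ob C" "inj_on h A" "\<And>i. i \<in> h ` A \<Longrightarrow> f i \<in> Hom C X Y"
  shows "msum X Y f (h ` A) = msum X Y (\<lambda>i. f (h i)) A"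
  using abelian_monoid.finsum_reindex[OF hom_abelian_monoid[OF assms(1,2)], of f h A] assms
  by (auto simp add: Pi_iff)

lemma Comp_msum:
  assumes "finite A" "X \<in> Ob C" "h \<in> Hom C Y Z" "\<And>i. i \<in> A \<Longrightarrow> f i \<in> Hom C X Y"
  shows "h \<cdot> msum X Y f A = msum X Z (\<lambda>i. h \<cdot> f i) A"
  using assms(1,4)
proof (induction A rule: finite_induct)
  case empty
  then show ?case
    using assms Hom_Ob[OF assms(3)] by (simp add: msum_empty Comp_Zero)
next
  case (insert a A)
  then show ?case
    using assms(2) Hom_Ob[OF assms(3)] Comp_Hom[OF _ assms(3)]
      Comp_Add_right[OF _ _ assms(3), of "f a" X "msum X Y f A"]
    by (simp add: msum_insert msum_Hom)
qed

lemma msum_Comp: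
  assumes "finite A" "Z \<in> Ob C" "h \<in> Hom C X Y" "\<And>i. i \<in> A \<Longrightarrow> f i \<in> Hom C Y Z"
  shows "msum Y Z f A \<cdot> h = msum X Z (\<lambda>i. f i \<cdot> h) A"
  using assms(1,4)
proof (induction A rule: finite_induct)
  case empty
  then show ?case
    using assms Hom_Ob[OF assms(3)] by (simp add: msum_empty Zero_Comp)
next
  case (insert a A)
  then show ?case
    using assms(2) Hom_Ob[OF assms(3)] Comp_Hom[OF assms(3)]
      Comp_Add_left[OF assms(3), of "f a" Z "msum Y Z f A"]
    by (simp add: msum_insert msum_Hom)
qed

lemma msum_swap:
  assumes "finite A" "finite B" "X \<in> Ob C" "Y \<in> Ob C"
    "\<And>i j. \<lbrakk>i \<in> A; j \<in> B\<rbrakk> \<Longrightarrow> f i j \<in> Hom C X Y"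
  shows "msum X Y (\<lambda>i. msum X Y (f i) B) A = msum X Y (\<lambda>j. msum X Y (\<lambda>i. f i j) A) B"
  using assms(1,5)
proof (induction A rule: finite_induct)
  case empty
  then show ?case
    using assms by (simp add: msum_empty msum_Zero)
next
  case (insert a A)
  have "msum X Y (\<lambda>j. msum X Y (\<lambda>i. f i j) (insert a A)) B =
      msum X Y (\<lambda>j. Add C (f a j) (msum X Y (\<lambda>i. f i j) A)) B"
    using assms insert by (intro msum_cong) (auto simp: msum_insert Add_Hom msum_Hom)
  then show ?case
    using assms insert by (simp add: msum_insert msum_Hom msum_Add)
qed

lemma msum_Scale_left:
  assumes "finite A" "f \<in> Hom C X Y"
  shows "msum X Y (\<lambda>i. Scale C (c i) f) A = Scale C (\<Sum>i\<in>A. c i) f"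
  using assms(1)
proof (induction A rule: finite_induct)
  case empty
  then show ?case
    using assms Hom_Ob[OF assms(2)] by (simp add: msum_empty Scale_zero)
next
  case (insert a A)
  then show ?case
    using assms Hom_Ob[OF assms(2)] by (simp add: msum_insert Scale_Hom Scale_add_left)
qed

lemma Scale_msum:
  assumes "finite A" "X \<in> Ob C" "Y \<in> Ob C" "\<And>i. i \<in> A \<Longrightarrow> f i \<in> Hom C X Y"
  shows "Scale C q (msum X Y f A) = msum X Y (\<lambda>i. Scale C q (f i)) A"
  using assms(1,4)
proof (induction A rule: finite_induct)
  case empty
  \<comment> \<open>\<open>Zero C X Y\<close> is 0 times itself, so a further scalar is absorbed by
    that 0.\<close>
  then show ?case
    using assms Scale_Scale[of "Zero C X Y" X Y q 0] Scale_zero[of "Zero C X Y" X Y]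
    by (simp add: msum_empty Zero_Hom)
next
  case (insert a A)
  then show ?case
    using assms(2,3) Scale_Add[of "f a" X Y "msum X Y f A" q]
    by (simp add: msum_insert Scale_Hom msum_Hom)
qed

end

section \<open>The rational group ring acting on an object\<close>

locale finite_group_in_category = additive_rat_linear_category C + G: group G
  for C :: "('o, 'm, 'z) lin_cat_scheme" (structure) and G :: "('g, 'y) monoid_scheme" +
  assumes finite_G: "finite (carrier G)"
begin

definition group_ring_action :: "'o \<times> ('g \<Rightarrow> 'm) \<Rightarrow> ('g \<Rightarrow> rat) \<Rightarrow> 'm" where
  "group_ring_action A c = msum (fst A) (fst A) (\<lambda>g. Scale C (c g) (snd A g)) (carrier G)"

lemma action_Ob: "is_action C G M \<alpha> \<Longrightarrow> M \<in> Ob C"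
  by (simp add: is_action_def)

lemma action_Hom: "\<lbrakk>is_action C G M \<alpha>; g \<in> carrier G\<rbrakk> \<Longrightarrow> \<alpha> g \<in> Hom C M M"
  by (auto simp: is_action_def hom_def Aut_group_def Iso_def)

lemma action_mult:
  "\<lbrakk>is_action C G M \<alpha>; g \<in> carrier G; h \<in> carrier G\<rbrakk> \<Longrightarrow> \<alpha> (g \<otimes>\<^bsub>G\<^esub> h) = \<alpha> g \<cdot> \<alpha> h"
  by (auto simp: is_action_def hom_def Aut_group_def)

lemma group_ring_action_Hom: "is_action C G M \<alpha> \<Longrightarrow> group_ring_action (M, \<alpha>) c \<in> Hom C M M"
  by (simp add: group_ring_action_def msum_Hom action_Ob Scale_Hom action_Hom)

lemma group_ring_action_cong:
  "\<lbrakk>is_action C G M \<alpha>; \<And>g. g \<in> carrier G \<Longrightarrow> c g = d g\<rbrakk>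
    \<Longrightarrow> group_ring_action (M, \<alpha>) c = group_ring_action (M, \<alpha>) d"
  unfolding group_ring_action_def
  by (rule msum_cong) (auto simp: action_Ob Scale_Hom action_Hom)

lemma group_ring_action_zero:
  assumes "is_action C G M \<alpha>"
  shows "group_ring_action (M, \<alpha>) (\<lambda>g. 0) = Zero C M M"
proof -
  have "group_ring_action (M, \<alpha>) (\<lambda>g. 0) = msum M M (\<lambda>g. Zero C M M) (carrier G)"
    unfolding group_ring_action_def fst_conv snd_conv using assms
    by (intro msum_cong) (auto simp: action_Ob Scale_zero action_Hom Zero_Hom)
  then show ?thesis
    using assms by (simp add: msum_Zero action_Ob)
qed

lemma group_ring_action_sum:
  assumes "is_action C G M \<alpha>" "finite S"
  shows "msum M M (\<lambda>s. Scale C (r s) (group_ring_action (M, \<alpha>) (D s))) S =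
    group_ring_action (M, \<alpha>) (\<lambda>g. \<Sum>s\<in>S. r s * D s g)"
proof -
  have "msum M M (\<lambda>s. Scale C (r s) (group_ring_action (M, \<alpha>) (D s))) S =
      msum M M (\<lambda>s. msum M M (\<lambda>g. Scale C (r s * D s g) (\<alpha> g)) (carrier G)) S"
    unfolding group_ring_action_def fst_conv snd_conv using assms finite_G
    by (intro msum_cong)
      (auto simp: action_Ob action_Hom Scale_msum Scale_Hom msum_Hom Scale_Scale[OF action_Hom] intro!: msum_cong)
  also have "\<dots> = msum M M (\<lambda>g. msum M M (\<lambda>s. Scale C (r s * D s g) (\<alpha> g)) S) (carrier G)"
    using assms finite_G by (intro msum_swap) (auto simp: action_Ob action_Hom Scale_Hom)
  also have "\<dots> = group_ring_action (M, \<alpha>) (\<lambda>g. \<Sum>s\<in>S. r s * D s g)"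
    unfolding group_ring_action_def fst_conv snd_conv using assms
    by (intro msum_cong) (auto simp: action_Ob action_Hom Scale_Hom msum_Scale_left)
  finally show ?thesis .
qed

lemma group_ring_action_translate:
  assumes "is_action C G M \<alpha>" "h \<in> carrier G"
  shows "\<alpha> h \<cdot> group_ring_action (M, \<alpha>) d = group_ring_action (M, \<alpha>) (\<lambda>g. d (inv\<^bsub>G\<^esub> h \<otimes>\<^bsub>G\<^esub> g))"
proof -
  have img: "(\<lambda>g. h \<otimes>\<^bsub>G\<^esub> g) ` carrier G = carrier G"
    by (rule G.surj_const_mult) fact
  have "\<alpha> h \<cdot> group_ring_action (M, \<alpha>) d = msum M M (\<lambda>g. Scale C (d g) (\<alpha> (h \<otimes>\<^bsub>G\<^esub> g))) (carrier G)"
    unfolding group_ring_action_def fst_conv snd_conv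
    using assms finite_G
    by (subst Comp_msum[OF finite_G action_Ob action_Hom])
      (auto intro!: msum_cong simp: action_Ob action_Hom action_mult Scale_Hom Comp_Hom[OF action_Hom action_Hom]
        Comp_Scale_right[OF action_Hom action_Hom])
  \<comment> \<open>The coefficient is expressed through hg so that the sum can be reindexed by left
    translation.\<close>
  also have "\<dots> = msum M M (\<lambda>g. Scale C (d (inv\<^bsub>G\<^esub> h \<otimes>\<^bsub>G\<^esub> (h \<otimes>\<^bsub>G\<^esub> g))) (\<alpha> (h \<otimes>\<^bsub>G\<^esub> g))) (carrier G)"
    using assms by (intro msum_cong) (auto simp: action_Ob action_Hom Scale_Hom simp flip: G.m_assoc)
  also have "\<dots> = msum M M (\<lambda>g. Scale C (d (inv\<^bsub>G\<^esub> h \<otimes>\<^bsub>G\<^esub> g)) (\<alpha> g)) ((\<lambda>g. h \<otimes>\<^bsub>G\<^esub> g) ` carrier G)"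
    using assms by (intro msum_reindex[symmetric])
      (auto simp: action_Ob action_Hom Scale_Hom intro: inj_onI)
  finally show ?thesis
    by (simp add: img group_ring_action_def)
qed

text \<open>The coefficients on the right are the convolution inside \<open>group_ring_mult\<close>,
  so products of matrices over the group ring become composites of morphisms.\<close>

lemma group_ring_action_mult:
  assumes "is_action C G M \<alpha>"
  shows "group_ring_action (M, \<alpha>) c \<cdot> group_ring_action (M, \<alpha>) d =
    group_ring_action (M, \<alpha>) (\<lambda>g. \<Sum>h\<in>carrier G. c h * d (inv\<^bsub>G\<^esub> h \<otimes>\<^bsub>G\<^esub> g))"
proof -
  let ?d = "group_ring_action (M, \<alpha>) d"
  have d: "?d \<in> Hom C M M"
    using assms by (rule group_ring_action_Hom)
  have "group_ring_action (M, \<alpha>) c \<cdot> ?d =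
      msum M M (\<lambda>h. Scale C (c h) (\<alpha> h) \<cdot> ?d) (carrier G)"
    unfolding group_ring_action_def[of "(M, \<alpha>)" c] fst_conv snd_conv using assms finite_G d
    by (intro msum_Comp) (auto simp: action_Ob action_Hom Scale_Hom)
  also have "\<dots> = msum M M (\<lambda>h. Scale C (c h)
      (group_ring_action (M, \<alpha>) (\<lambda>g. d (inv\<^bsub>G\<^esub> h \<otimes>\<^bsub>G\<^esub> g)))) (carrier G)"
    using assms d by (intro msum_cong)
      (auto simp: action_Ob Comp_Scale_left[OF d action_Hom] group_ring_action_translate Scale_Hom group_ring_action_Hom)
  also have "\<dots> = group_ring_action (M, \<alpha>) (\<lambda>g. \<Sum>h\<in>carrier G. c h * d (inv\<^bsub>G\<^esub> h \<otimes>\<^bsub>G\<^esub> g))"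
    using assms finite_G by (rule group_ring_action_sum)
  finally show ?thesis .
qed

text \<open>The coefficients do not depend on the object, so equivariance of \<open>f\<close> passes
  to the linear combination.\<close>

lemma group_ring_action_natural:
  assumes "is_action C G M \<alpha>" "is_action C G M' \<alpha>'" "f \<in> Hom C M M'"
    and "\<And>g. g \<in> carrier G \<Longrightarrow> f \<cdot> \<alpha> g = \<alpha>' g \<cdot> f"
  shows "f \<cdot> group_ring_action (M, \<alpha>) c = group_ring_action (M', \<alpha>') c \<cdot> f"
proof -
  have "f \<cdot> group_ring_action (M, \<alpha>) c = msum M M' (\<lambda>g. f \<cdot> Scale C (c g) (\<alpha> g)) (carrier G)"
    unfolding group_ring_action_def fst_conv snd_conv using assms finite_G
    by (intro Comp_msum) (auto simp: action_Ob action_Hom Scale_Hom)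
  also have "\<dots> = msum M M' (\<lambda>g. Scale C (c g) (\<alpha>' g) \<cdot> f) (carrier G)"
    using assms by (intro msum_cong)
      (auto simp: action_Ob Comp_Scale_left[OF assms(3) action_Hom] Comp_Scale_right[OF action_Hom assms(3)]
        intro!: Scale_Hom Comp_Hom[OF assms(3)] action_Hom)
  also have "\<dots> = group_ring_action (M', \<alpha>') c \<cdot> f"
    unfolding group_ring_action_def fst_conv snd_conv using assms finite_G
    by (intro msum_Comp[symmetric]) (auto simp: action_Ob action_Hom Scale_Hom)
  finally show ?thesis .
qed

text \<open>Elements of the subgroup leave \<open>f\<close> unchanged, so only the sum of the
  coefficients matters, and it is 1.\<close>

lemma averaging_fixes_invariants:
  assumes \<alpha>: "is_action C G M \<alpha>" and H: "subgroup (H i) G" and f: "f \<in> Hom_invariants C M \<alpha> (H i) X"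
  shows "group_ring_action (M, \<alpha>) (averaging H i i) \<cdot> f = f"
proof -
  have fH: "f \<in> Hom C X M"
    using f by (simp add: Hom_invariants_def)
  have "group_ring_action (M, \<alpha>) (averaging H i i) \<cdot> f =
      msum X M (\<lambda>g. Scale C (averaging H i i g) (\<alpha> g) \<cdot> f) (carrier G)"
    unfolding group_ring_action_def fst_conv snd_conv using \<alpha> fH finite_G
    by (intro msum_Comp) (auto simp: action_Ob action_Hom Scale_Hom)
  also have "\<dots> = msum X M (\<lambda>g. Scale C (averaging H i i g) f) (carrier G)"
  proof (intro msum_cong refl)
    fix g assume g: "g \<in> carrier G"
    have "\<alpha> g \<cdot> f = f" if "g \<in> H i"
      using f that by (simp add: Hom_invariants_def)
    moreover have "Scale C (averaging H i i g) (\<alpha> g) \<cdot> f = Scale C (averaging H i i g) (\<alpha> g \<cdot> f)"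
      by (rule Comp_Scale_left[OF fH action_Hom[OF \<alpha> g]])
    ultimately show "Scale C (averaging H i i g) (\<alpha> g) \<cdot> f = Scale C (averaging H i i g) f"
      by (cases "g \<in> H i")
        (simp_all add: averaging_def Scale_zero[OF fH] Scale_zero[OF Comp_Hom[OF fH action_Hom[OF \<alpha> g]]])
  qed (use Hom_Ob[OF fH] Scale_Hom[OF fH] in auto)
  also have "\<dots> = Scale C (\<Sum>g\<in>carrier G. averaging H i i g) f"
    by (rule msum_Scale_left[OF finite_G fH])
  also have "(\<Sum>g\<in>carrier G. averaging H i i g) = 1"
  proof -
    have "(\<Sum>g\<in>carrier G. averaging H i i g) = (\<Sum>g\<in>H i. 1 / of_nat (card (H i)))"
      using subgroup.subset[OF H] finite_G
      by (intro sum.mono_neutral_cong_right) (auto simp: averaging_def)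
    also have "\<dots> = 1"
      using subgroup.one_closed[OF H] finite_subset[OF subgroup.subset[OF H] finite_G] by auto
    finally show ?thesis .
  qed
  finally show ?thesis
    by (simp add: Scale_one[OF fH])
qed

text \<open>Left translation by an element of \<open>H i\<close> permutes \<open>H i\<close>.
  Together with \<open>averaging_fixes_invariants\<close> this makes the averaging operator a
  projection onto the invariants.\<close>

lemma averaging_invariant:
  assumes \<alpha>: "is_action C G M \<alpha>" and H: "subgroup (H i) G"
  shows "group_ring_action (M, \<alpha>) (averaging H i i) \<in> Hom_invariants C M \<alpha> (H i) M"
proof -
  have "\<alpha> h \<cdot> group_ring_action (M, \<alpha>) (averaging H i i) = group_ring_action (M, \<alpha>) (averaging H i i)"
    if h: "h \<in> H i" for h
  proof -
    have hG: "h \<in> carrier G"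
      using h subgroup.mem_carrier[OF H] by blast
    have "inv\<^bsub>G\<^esub> h \<otimes>\<^bsub>G\<^esub> g \<in> H i \<longleftrightarrow> g \<in> H i" if "g \<in> carrier G" for g
    proof
      assume "inv\<^bsub>G\<^esub> h \<otimes>\<^bsub>G\<^esub> g \<in> H i"
      then have "h \<otimes>\<^bsub>G\<^esub> (inv\<^bsub>G\<^esub> h \<otimes>\<^bsub>G\<^esub> g) \<in> H i"
        by (rule subgroup.m_closed[OF H h])
      then show "g \<in> H i"
        using hG that by (simp flip: G.m_assoc)
    next
      assume "g \<in> H i"
      then show "inv\<^bsub>G\<^esub> h \<otimes>\<^bsub>G\<^esub> g \<in> H i"
        by (intro subgroup.m_closed[OF H] subgroup.m_inv_closed[OF H] h)
    qed
    then show ?thesis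
      using group_ring_action_translate[OF \<alpha> hG] \<alpha>
      by (auto simp: averaging_def intro: group_ring_action_cong)
  qed
  then show ?thesis
    using group_ring_action_Hom[OF \<alpha>] by (simp add: Hom_invariants_def)
qed

end

section \<open>Functors of invariants and their direct sums\<close>

context finite_group_in_category
begin

abbreviation "\<G> \<equiv> GObj C G"

lemma GObj_Ob: "A \<in> Ob \<G> \<Longrightarrow> is_action C G (fst A) (snd A)"
  by (auto simp: GObj_def)

lemma GObj_fst_Ob: "A \<in> Ob \<G> \<Longrightarrow> fst A \<in> Ob C"
  using GObj_Ob action_Ob by blast

lemma GObj_Id: "A \<in> Ob \<G> \<Longrightarrow> Id \<G> A \<in> Hom \<G> A A" "fst (snd (Id \<G> A)) = Id C (fst A)"
  using Comp_Id[OF action_Hom] Id_Comp[OF action_Hom] Id_Hom[OF action_Ob]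
  by (auto simp: GObj_def Hom_def split: prod.splits) 

lemma GObj_Hom:
  assumes "f \<in> Hom \<G> A B"
  shows "fst (snd f) \<in> Hom C (fst A) (fst B)"
    and "g \<in> carrier G \<Longrightarrow> fst (snd f) \<cdot> snd A g = snd B g \<cdot> fst (snd f)"
    and "A \<in> Ob \<G>" "B \<in> Ob \<G>" "f = (A, fst (snd f), B)"
  using assms by (auto simp: GObj_def Hom_def)

lemma GObj_Comp:
  assumes f: "f \<in> Hom \<G> A B" and g: "g \<in> Hom \<G> B B'"
  shows "g \<cdot>\<^bsub>\<G>\<^esub> f \<in> Hom \<G> A B'" "fst (snd (g \<cdot>\<^bsub>\<G>\<^esub> f)) = fst (snd g) \<cdot> fst (snd f)"
proof -
  let ?f = "fst (snd f)" and ?g = "fst (snd g)"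
  note F = GObj_Hom[OF f] and K = GObj_Hom[OF g]
  have eq: "g \<cdot>\<^bsub>\<G>\<^esub> f = (A, ?g \<cdot> ?f, B')"
    by (subst F(5), subst K(5)) (simp add: GObj_def)
  then show "fst (snd (g \<cdot>\<^bsub>\<G>\<^esub> f)) = ?g \<cdot> ?f"
    by simp
  have "?g \<cdot> ?f \<cdot> snd A x = snd B' x \<cdot> (?g \<cdot> ?f)" if x: "x \<in> carrier G" for x
    using Comp_assoc[OF action_Hom[OF GObj_Ob[OF F(3)] x] F(1) K(1)]
      Comp_assoc[OF F(1) action_Hom[OF GObj_Ob[OF F(4)] x] K(1)]
      Comp_assoc[OF F(1) K(1) action_Hom[OF GObj_Ob[OF K(4)] x]] F(2)[OF x] K(2)[OF x] by simp
  then show "g \<cdot>\<^bsub>\<G>\<^esub> f \<in> Hom \<G> A B'"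
    using F(3) K(4) Comp_Hom[OF F(1) K(1)] unfolding eq by (auto simp: GObj_def Hom_def)
qed

text \<open>\<open>F\<close> is a direct sum of the functors \<open>M \<mapsto> M\<^sup>H\<^sup>i\<close>, \<open>i \<in> I\<close>: the maps \<open>\<iota> M i\<close> are the
  components of the inclusion into a power of \<open>M\<close>, the maps \<open>\<pi> M i\<close> those of a retraction, and the
  resulting idempotent on the power of \<open>M\<close> is the diagonal matrix of the averaging elements.\<close>

definition sum_of_invariants ::
  "('o \<times> ('g \<Rightarrow> 'm), ('o \<times> ('g \<Rightarrow> 'm)) \<times> 'm \<times> ('o \<times> ('g \<Rightarrow> 'm)), 'o, 'm) fctr \<Rightarrow>
   ('i \<Rightarrow> 'g set) \<Rightarrow> 'i set \<Rightarrow> ('o \<times> ('g \<Rightarrow> 'm) \<Rightarrow> 'i \<Rightarrow> 'm) \<Rightarrow> ('o \<times> ('g \<Rightarrow> 'm) \<Rightarrow> 'i \<Rightarrow> 'm) \<Rightarrow> bool"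
  where
  "sum_of_invariants F H I \<iota> \<pi> \<longleftrightarrow>
     (\<forall>A \<in> Ob \<G>. on_Ob F A \<in> Ob C \<and>
        (\<forall>i \<in> I. \<iota> A i \<in> Hom C (on_Ob F A) (fst A) \<and> \<pi> A i \<in> Hom C (fst A) (on_Ob F A)) \<and>
        (\<forall>i \<in> I. \<forall>j \<in> I. \<iota> A i \<cdot> \<pi> A j = group_ring_action A (averaging H i j)) \<and>
        msum (on_Ob F A) (on_Ob F A) (\<lambda>i. \<pi> A i \<cdot> \<iota> A i) I = Id C (on_Ob F A)) \<and>
     (\<forall>A B f. f \<in> Hom \<G> A B \<longrightarrow> on_Arr F f \<in> Hom C (on_Ob F A) (on_Ob F B) \<and>
        (\<forall>i \<in> I. fst (snd f) \<cdot> \<iota> A i = \<iota> B i \<cdot> on_Arr F f \<and>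
                on_Arr F f \<cdot> \<pi> A i = \<pi> B i \<cdot> fst (snd f)))"

lemma sum_of_invariantsD:
  assumes "sum_of_invariants F H I \<iota> \<pi>"
  shows "A \<in> Ob \<G> \<Longrightarrow> on_Ob F A \<in> Ob C"
    and "\<lbrakk>A \<in> Ob \<G>; i \<in> I\<rbrakk> \<Longrightarrow> \<iota> A i \<in> Hom C (on_Ob F A) (fst A)"
    and "\<lbrakk>A \<in> Ob \<G>; i \<in> I\<rbrakk> \<Longrightarrow> \<pi> A i \<in> Hom C (fst A) (on_Ob F A)"
    and "\<lbrakk>A \<in> Ob \<G>; i \<in> I; j \<in> I\<rbrakk> \<Longrightarrow> \<iota> A i \<cdot> \<pi> A j = group_ring_action A (averaging H i j)"
    and "A \<in> Ob \<G> \<Longrightarrow> msum (on_Ob F A) (on_Ob F A) (\<lambda>i. \<pi> A i \<cdot> \<iota> A i) I = Id C (on_Ob F A)"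
    and "f \<in> Hom \<G> A B \<Longrightarrow> on_Arr F f \<in> Hom C (on_Ob F A) (on_Ob F B)"
    and "\<lbrakk>f \<in> Hom \<G> A B; i \<in> I\<rbrakk> \<Longrightarrow> fst (snd f) \<cdot> \<iota> A i = \<iota> B i \<cdot> on_Arr F f"
    and "\<lbrakk>f \<in> Hom \<G> A B; i \<in> I\<rbrakk> \<Longrightarrow> on_Arr F f \<cdot> \<pi> A i = \<pi> B i \<cdot> fst (snd f)"
  using assms unfolding sum_of_invariants_def by blast+

text \<open>The formula \<open>expand\<close> determines \<open>on_Arr F f\<close> through
  retractions and inclusions. Functoriality thus follows once for invariants and all their direct
  sums.\<close>

lemma sum_of_invariants_functor:
  assumes S: "sum_of_invariants F H I \<iota> \<pi>" and I: "finite I"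
  shows "is_functor \<G> C F"
proof -
  note D = sum_of_invariantsD[OF S]
  \<comment> \<open>\<open>on_Arr F f\<close> is determined by its composites with the \<open>\<pi> A i\<close>.\<close>
  have expand: "on_Arr F f = msum (on_Ob F A) (on_Ob F B) (\<lambda>i. \<pi> B i \<cdot> fst (snd f) \<cdot> \<iota> A i) I"
    if f: "f \<in> Hom \<G> A B" for f A B
  proof -
    note A = GObj_Hom(3)[OF f] and B = GObj_Hom(4)[OF f]
    have "on_Arr F f = on_Arr F f \<cdot> msum (on_Ob F A) (on_Ob F A) (\<lambda>i. \<pi> A i \<cdot> \<iota> A i) I"
      using Comp_Id[OF D(6)[OF f]] D(5)[OF A] by simp
    also have "\<dots> = msum (on_Ob F A) (on_Ob F B) (\<lambda>i. on_Arr F f \<cdot> (\<pi> A i \<cdot> \<iota> A i)) I"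
      using A by (intro Comp_msum I D Comp_Hom[OF D(2) D(3)] f)
    also have "\<dots> = msum (on_Ob F A) (on_Ob F B) (\<lambda>i. \<pi> B i \<cdot> fst (snd f) \<cdot> \<iota> A i) I"
    proof (intro msum_cong refl D A B)
      fix i assume i: "i \<in> I"
      show "on_Arr F f \<cdot> (\<pi> A i \<cdot> \<iota> A i) = \<pi> B i \<cdot> fst (snd f) \<cdot> \<iota> A i"
        using Comp_assoc[OF D(2)[OF A i] D(3)[OF A i] D(6)[OF f]] D(8)[OF f i] by simp
      show "\<pi> B i \<cdot> fst (snd f) \<cdot> \<iota> A i \<in> Hom C (on_Ob F A) (on_Ob F B)"
        by (rule Comp_Hom[OF D(2)[OF A i] Comp_Hom[OF GObj_Hom(1)[OF f] D(3)[OF B i]]])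
    qed
    finally show ?thesis .
  qed
  have "on_Arr F (Id \<G> A) = Id C (on_Ob F A)" if A: "A \<in> Ob \<G>" for A
  proof -
    have "on_Arr F (Id \<G> A) = msum (on_Ob F A) (on_Ob F A) (\<lambda>i. \<pi> A i \<cdot> Id C (fst A) \<cdot> \<iota> A i) I"
      using expand[OF GObj_Id(1)[OF A]] by (simp add: GObj_Id(2))
    also have "\<dots> = msum (on_Ob F A) (on_Ob F A) (\<lambda>i. \<pi> A i \<cdot> \<iota> A i) I"
      using A by (intro msum_cong refl D Comp_Hom[OF D(2) D(3)]) (auto simp: Comp_Id[OF D(3)])
    finally show ?thesis
      using D(5)[OF A] by simp
  qed
  moreover have "on_Arr F (g \<cdot>\<^bsub>\<G>\<^esub> f) = on_Arr F g \<cdot> on_Arr F f"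
    if f: "f \<in> Hom \<G> A B" and g: "g \<in> Hom \<G> B B'" for f g A B B'
  proof -
    note A = GObj_Hom(3)[OF f] and B = GObj_Hom(3)[OF g] and B' = GObj_Hom(4)[OF g]
    have "on_Arr F (g \<cdot>\<^bsub>\<G>\<^esub> f) =
        msum (on_Ob F A) (on_Ob F B') (\<lambda>i. \<pi> B' i \<cdot> (fst (snd g) \<cdot> fst (snd f)) \<cdot> \<iota> A i) I"
      using expand[OF GObj_Comp(1)[OF f g]] GObj_Comp(2)[OF f g] by simp
    also have "\<dots> = msum (on_Ob F A) (on_Ob F B') (\<lambda>i. on_Arr F g \<cdot> (\<pi> B i \<cdot> fst (snd f) \<cdot> \<iota> A i)) I"
    proof (intro msum_cong refl D A B')
      fix i assume i: "i \<in> I"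
      let ?h = "\<pi> B i \<cdot> fst (snd f)"
      have h: "?h \<in> Hom C (fst A) (on_Ob F B)"
        by (rule Comp_Hom[OF GObj_Hom(1)[OF f] D(3)[OF B i]])
      have "\<pi> B' i \<cdot> (fst (snd g) \<cdot> fst (snd f)) = on_Arr F g \<cdot> ?h"
        using Comp_assoc[OF GObj_Hom(1)[OF f] GObj_Hom(1)[OF g] D(3)[OF B' i]]
          Comp_assoc[OF GObj_Hom(1)[OF f] D(3)[OF B i] D(6)[OF g]] D(8)[OF g i] by simp
      then show "\<pi> B' i \<cdot> (fst (snd g) \<cdot> fst (snd f)) \<cdot> \<iota> A i = on_Arr F g \<cdot> (?h \<cdot> \<iota> A i)"
        using Comp_assoc[OF D(2)[OF A i] h D(6)[OF g]] by simp
      show "on_Arr F g \<cdot> (?h \<cdot> \<iota> A i) \<in> Hom C (on_Ob F A) (on_Ob F B')"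
        by (rule Comp_Hom[OF Comp_Hom[OF D(2)[OF A i] h] D(6)[OF g]])
    qed
    also have "\<dots> = on_Arr F g \<cdot> on_Arr F f"
      unfolding expand[OF f]
      by (intro Comp_msum[symmetric] I D A g Comp_Hom[OF D(2)[OF A] Comp_Hom[OF GObj_Hom(1)[OF f] D(3)[OF B]]])
    finally show ?thesis .
  qed
  ultimately show ?thesis
    unfolding is_functor_def using D by blast
qed

text \<open>The family \<open>v\<close> stands for a morphism from \<open>X\<close> into a power of
  the object, multiplied from the left by the matrix \<open>a\<close>. Working with components
  avoids forming the power.\<close>

definition row_action :: "'o \<times> ('g \<Rightarrow> 'm) \<Rightarrow> 'o \<Rightarrow> ('i::finite \<Rightarrow> 'i \<Rightarrow> 'g \<Rightarrow> rat) \<Rightarrow> ('i \<Rightarrow> 'm) \<Rightarrow> 'i \<Rightarrow> 'm" where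
  "row_action A X a v k = msum X (fst A) (\<lambda>j. group_ring_action A (a k j) \<cdot> v j) UNIV"

context
  fixes A :: "'o \<times> ('g \<Rightarrow> 'm)" and X :: 'o and v :: "'i::finite \<Rightarrow> 'm"
  assumes A: "A \<in> Ob \<G>" and X: "X \<in> Ob C" and v: "\<And>i. v i \<in> Hom C X (fst A)"
begin

lemma gr_Hom: "group_ring_action A c \<in> Hom C (fst A) (fst A)"
  using group_ring_action_Hom[OF GObj_Ob[OF A]] by simp

lemma row_action_Hom: "row_action A X a v k \<in> Hom C X (fst A)"
  unfolding row_action_def by (intro msum_Hom X GObj_fst_Ob A Comp_Hom[OF v gr_Hom])

lemma row_action_cong:
  assumes "\<And>i j g. g \<in> carrier G \<Longrightarrow> a i j g = b i j g"
  shows "row_action A X a v k = row_action A X b v k"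
proof -
  have "group_ring_action A (a k j) = group_ring_action A (b k j)" for j
    using group_ring_action_cong[OF GObj_Ob[OF A], of "a k j" "b k j"] assms by simp
  then show ?thesis
    by (simp add: row_action_def)
qed

text \<open>Interchanging the two sums and multiplicativity of the group ring action assemble the
  entries of the matrix product.\<close>

lemma row_action_row_action:
  "row_action A X a (row_action A X b v) k = row_action A X (group_ring_mult G a b) v k"
proof -
  let ?L = "group_ring_action A"
  note M = GObj_fst_Ob[OF A]
  have "row_action A X a (row_action A X b v) k =
      msum X (fst A) (\<lambda>j. msum X (fst A) (\<lambda>i. ?L (a k j) \<cdot> ?L (b j i) \<cdot> v i) UNIV) UNIV"
    unfolding row_action_def[of A X a]
  proof (intro msum_cong refl X M msum_Hom Comp_Hom[OF v] Comp_Hom[OF gr_Hom gr_Hom])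
    fix j
    have "?L (a k j) \<cdot> row_action A X b v j = msum X (fst A) (\<lambda>i. ?L (a k j) \<cdot> (?L (b j i) \<cdot> v i)) UNIV"
      unfolding row_action_def by (intro Comp_msum X gr_Hom Comp_Hom[OF v gr_Hom]) simp
    then show "?L (a k j) \<cdot> row_action A X b v j = msum X (fst A) (\<lambda>i. ?L (a k j) \<cdot> ?L (b j i) \<cdot> v i) UNIV"
      by (simp add: Comp_assoc[OF v gr_Hom gr_Hom])
  qed
  also have "\<dots> = msum X (fst A) (\<lambda>i. msum X (fst A) (\<lambda>j. ?L (a k j) \<cdot> ?L (b j i) \<cdot> v i) UNIV) UNIV"
    by (intro msum_swap X M Comp_Hom[OF v] Comp_Hom[OF gr_Hom gr_Hom]) simp_all
  also have "\<dots> = msum X (fst A) (\<lambda>i. ?L (group_ring_mult G a b k i) \<cdot> v i) UNIV"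
  proof (intro msum_cong refl X M Comp_Hom[OF v gr_Hom])
    fix i
    let ?ab = "\<lambda>j g. \<Sum>h\<in>carrier G. a k j h * b j i (inv\<^bsub>G\<^esub> h \<otimes>\<^bsub>G\<^esub> g)"
    have "msum X (fst A) (\<lambda>j. ?L (a k j) \<cdot> ?L (b j i) \<cdot> v i) UNIV =
        msum (fst A) (fst A) (\<lambda>j. ?L (a k j) \<cdot> ?L (b j i)) UNIV \<cdot> v i"
      by (intro msum_Comp[symmetric] M v Comp_Hom[OF gr_Hom gr_Hom]) simp
    also have "msum (fst A) (fst A) (\<lambda>j. ?L (a k j) \<cdot> ?L (b j i)) UNIV =
        msum (fst A) (fst A) (\<lambda>j. Scale C 1 (?L (?ab j))) UNIV"
    proof (intro msum_cong refl M Scale_Hom gr_Hom)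
      fix j
      show "?L (a k j) \<cdot> ?L (b j i) = Scale C 1 (?L (?ab j))"
        using group_ring_action_mult[OF GObj_Ob[OF A], of "a k j" "b j i"] by (simp add: Scale_one[OF gr_Hom])
    qed
    also have "\<dots> = ?L (group_ring_mult G a b k i)"
      using group_ring_action_sum[OF GObj_Ob[OF A], of UNIV "\<lambda>j. 1" ?ab]
      by (simp add: group_ring_mult_def[abs_def])
    finally show "msum X (fst A) (\<lambda>j. ?L (a k j) \<cdot> ?L (b j i) \<cdot> v i) UNIV = ?L (group_ring_mult G a b k i) \<cdot> v i" .
  qed
  finally show ?thesis
    by (simp add: row_action_def)
qed

lemma row_action_Comp:
  assumes f: "f \<in> Hom C Y X"
  shows "row_action A X a v k \<cdot> f = row_action A Y a (\<lambda>i. v i \<cdot> f) k"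
  unfolding row_action_def using msum_Comp[OF finite GObj_fst_Ob[OF A] f Comp_Hom[OF v gr_Hom]]
  by (simp add: Comp_assoc[OF f v gr_Hom, symmetric])

lemma Comp_row_action:
  assumes f: "f \<in> Hom \<G> A B"
  shows "fst (snd f) \<cdot> row_action A X a v k = row_action B X a (\<lambda>i. fst (snd f) \<cdot> v i) k"
proof -
  note B = GObj_Hom(4)[OF f] and fC = GObj_Hom(1)[OF f]
  have nat: "fst (snd f) \<cdot> group_ring_action A c = group_ring_action B c \<cdot> fst (snd f)" for c
    using group_ring_action_natural[OF GObj_Ob[OF A] GObj_Ob[OF B] fC] GObj_Hom(2)[OF f] by simp
  have LB: "group_ring_action B c \<in> Hom C (fst B) (fst B)" for c
    using group_ring_action_Hom[OF GObj_Ob[OF B]] by simp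
  have "fst (snd f) \<cdot> row_action A X a v k =
      msum X (fst B) (\<lambda>j. fst (snd f) \<cdot> (group_ring_action A (a k j) \<cdot> v j)) UNIV"
    unfolding row_action_def by (intro Comp_msum X fC Comp_Hom[OF v gr_Hom]) simp
  then show ?thesis
    by (simp add: row_action_def Comp_assoc[OF v gr_Hom fC] nat Comp_assoc[OF v fC LB])
qed

end

text \<open>The inclusion of \<open>F\<close> into a power of the object, then the matrix
  \<open>a\<close>, then the retraction onto \<open>F'\<close>.\<close>

definition transition ::
  "('o \<times> ('g \<Rightarrow> 'm), 't, 'o, 'm) fctr \<Rightarrow> ('o \<times> ('g \<Rightarrow> 'm), 't, 'o, 'm) fctr \<Rightarrow>
   ('o \<times> ('g \<Rightarrow> 'm) \<Rightarrow> 'i::finite \<Rightarrow> 'm) \<Rightarrow> ('o \<times> ('g \<Rightarrow> 'm) \<Rightarrow> 'i \<Rightarrow> 'm) \<Rightarrow> ('i \<Rightarrow> 'i \<Rightarrow> 'g \<Rightarrow> rat) \<Rightarrow>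
   'o \<times> ('g \<Rightarrow> 'm) \<Rightarrow> 'm" where
  "transition F F' \<iota> \<pi>' a A = msum (on_Ob F A) (on_Ob F' A)
     (\<lambda>l. \<pi>' A l \<cdot> row_action A (on_Ob F A) a (\<iota> A) l) UNIV"

lemma transition_Hom:
  assumes "sum_of_invariants F H UNIV \<iota> \<pi>" "sum_of_invariants F' K UNIV \<iota>' \<pi>'" "A \<in> Ob \<G>"
  shows "transition F F' \<iota> \<pi>' a A \<in> Hom C (on_Ob F A) (on_Ob F' A)"
  unfolding transition_def
  by (intro msum_Hom sum_of_invariantsD[OF assms(1)] sum_of_invariantsD[OF assms(2)] assms(3)
      Comp_Hom[OF row_action_Hom sum_of_invariantsD(3)[OF assms(2)]]) simp

text \<open>In block notation the composite is \<pi> b (\<iota>' \<pi>') a \<iota>. The middle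
  product is the averaging matrix of \<open>K\<close>, which \<open>a\<close> absorbs; then ba is
  the averaging matrix of \<open>H\<close>, that is \<iota> \<pi>, and \<pi> \<iota> is the
  identity.\<close>

lemma transition_inverse:
  fixes a b :: "'i::finite \<Rightarrow> 'i \<Rightarrow> 'g \<Rightarrow> rat"
  assumes S: "sum_of_invariants F H UNIV \<iota> \<pi>" and S': "sum_of_invariants F' K UNIV \<iota>' \<pi>'"
    and A: "A \<in> Ob \<G>"
    and Ka: "\<And>i j g. g \<in> carrier G \<Longrightarrow> group_ring_mult G (averaging K) a i j g = a i j g"
    and ba: "\<And>i j g. g \<in> carrier G \<Longrightarrow> group_ring_mult G b a i j g = averaging H i j g"
  shows "transition F' F \<iota>' \<pi> b A \<cdot> transition F F' \<iota> \<pi>' a A = Id C (on_Ob F A)"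
proof -
  let ?X = "on_Ob F A" and ?X' = "on_Ob F' A" and ?L = "group_ring_action A"
  let ?\<theta> = "transition F F' \<iota> \<pi>' a A"
  note D = sum_of_invariantsD[OF S] and D' = sum_of_invariantsD[OF S']
  have \<iota>: "\<iota> A i \<in> Hom C ?X (fst A)" and \<iota>': "\<iota>' A i \<in> Hom C ?X' (fst A)"
    and \<pi>: "\<pi> A i \<in> Hom C (fst A) ?X" and \<pi>': "\<pi>' A i \<in> Hom C (fst A) ?X'" for i
    using D D' A by auto
  note X = D(1)[OF A] and X' = D'(1)[OF A]
  have \<theta>: "?\<theta> \<in> Hom C ?X ?X'"
    by (rule transition_Hom[OF S S' A])
  have ra: "row_action A ?X a (\<iota> A) l \<in> Hom C ?X (fst A)" for a l
    by (rule row_action_Hom[OF A X \<iota>])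
  have "\<iota>' A j \<cdot> ?\<theta> = row_action A ?X a (\<iota> A) j" for j
  proof -
    have "\<iota>' A j \<cdot> ?\<theta> = msum ?X (fst A) (\<lambda>l. \<iota>' A j \<cdot> (\<pi>' A l \<cdot> row_action A ?X a (\<iota> A) l)) UNIV"
      unfolding transition_def by (intro Comp_msum X \<iota>' Comp_Hom[OF ra \<pi>']) simp
    also have "\<dots> = row_action A ?X (averaging K) (row_action A ?X a (\<iota> A)) j"
      unfolding row_action_def[of A ?X "averaging K"]
      by (simp add: Comp_assoc[OF ra \<pi>' \<iota>'] D'(4)[OF A])
    also have "\<dots> = row_action A ?X a (\<iota> A) j"
      unfolding row_action_row_action[OF A X \<iota>] by (rule row_action_cong[OF A X \<iota>]) (rule Ka)
    finally show ?thesis .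
  qed
  then have \<iota>'\<theta>: "row_action A ?X' b (\<iota>' A) k \<cdot> ?\<theta> = row_action A ?X b (row_action A ?X a (\<iota> A)) k" for k
    unfolding row_action_Comp[OF A X' \<iota>' \<theta>] by (simp add: row_action_def[of A ?X b])
  have rb: "row_action A ?X' b (\<iota>' A) k \<in> Hom C ?X' (fst A)" for k
    by (rule row_action_Hom[OF A X' \<iota>'])
  have "transition F' F \<iota>' \<pi> b A \<cdot> ?\<theta> = msum ?X ?X (\<lambda>k. \<pi> A k \<cdot> row_action A ?X' b (\<iota>' A) k \<cdot> ?\<theta>) UNIV"
    unfolding transition_def[of F' F] by (intro msum_Comp X \<theta> Comp_Hom[OF rb \<pi>]) simp
  also have "\<dots> = msum ?X ?X (\<lambda>k. \<pi> A k \<cdot> row_action A ?X b (row_action A ?X a (\<iota> A)) k) UNIV"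
    by (simp add: Comp_assoc[OF \<theta> rb \<pi>, symmetric] \<iota>'\<theta>)
  also have "\<dots> = msum ?X ?X (\<lambda>k. \<pi> A k \<cdot> \<iota> A k) UNIV"
  proof (intro msum_cong refl X Comp_Hom[OF \<iota> \<pi>])
    fix k
    have "row_action A ?X b (row_action A ?X a (\<iota> A)) k = row_action A ?X (averaging H) (\<iota> A) k"
      unfolding row_action_row_action[OF A X \<iota>] by (rule row_action_cong[OF A X \<iota>]) (rule ba)
    also have "\<dots> = msum ?X (fst A) (\<lambda>i. \<iota> A k \<cdot> (\<pi> A i \<cdot> \<iota> A i)) UNIV"
      unfolding row_action_def by (simp add: Comp_assoc[OF \<iota> \<pi> \<iota>] D(4)[OF A])
    also have "\<dots> = \<iota> A k \<cdot> msum ?X ?X (\<lambda>i. \<pi> A i \<cdot> \<iota> A i) UNIV"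
      by (intro Comp_msum[symmetric] X \<iota> Comp_Hom[OF \<iota> \<pi>]) simp
    also have "\<dots> = \<iota> A k"
      by (simp add: D(5)[OF A] Comp_Id[OF \<iota>])
    finally show "\<pi> A k \<cdot> row_action A ?X b (row_action A ?X a (\<iota> A)) k = \<pi> A k \<cdot> \<iota> A k"
      by simp
  qed
  finally show ?thesis
    by (simp add: D(5)[OF A])
qed

text \<open>All three constituents are natural: inclusions and retractions by
  \<open>sum_of_invariants\<close>, the entries of \<open>a\<close> by
  \<open>group_ring_action_natural\<close>.\<close>

lemma transition_natural:
  fixes a :: "'i::finite \<Rightarrow> 'i \<Rightarrow> 'g \<Rightarrow> rat"
  assumes S: "sum_of_invariants F H UNIV \<iota> \<pi>" and S': "sum_of_invariants F' K UNIV \<iota>' \<pi>'"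
    and f: "f \<in> Hom \<G> A B"
  shows "transition F F' \<iota> \<pi>' a B \<cdot> on_Arr F f = on_Arr F' f \<cdot> transition F F' \<iota> \<pi>' a A"
proof -
  note D = sum_of_invariantsD[OF S] and D' = sum_of_invariantsD[OF S']
  note A = GObj_Hom(3)[OF f] and B = GObj_Hom(4)[OF f] and fC = GObj_Hom(1)[OF f]
  have \<iota>: "\<iota> A i \<in> Hom C (on_Ob F A) (fst A)" and \<iota>B: "\<iota> B i \<in> Hom C (on_Ob F B) (fst B)"
    and \<pi>': "\<pi>' A i \<in> Hom C (fst A) (on_Ob F' A)" and \<pi>'B: "\<pi>' B i \<in> Hom C (fst B) (on_Ob F' B)" for i
    using D D' A B by auto
  note X = D(1)[OF A] and Y = D(1)[OF B] and X' = D'(1)[OF A] and Y' = D'(1)[OF B]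
  note Ff = D(6)[OF f] and F'f = D'(6)[OF f]
  let ?r = "\<lambda>l. row_action A (on_Ob F A) a (\<iota> A) l" and ?s = "\<lambda>l. row_action B (on_Ob F B) a (\<iota> B) l"
  have r: "?r l \<in> Hom C (on_Ob F A) (fst A)" and s: "?s l \<in> Hom C (on_Ob F B) (fst B)" for l
    by (rule row_action_Hom[OF A X \<iota>], rule row_action_Hom[OF B Y \<iota>B])
  have rs: "?s l \<cdot> on_Arr F f = fst (snd f) \<cdot> ?r l" for l
    unfolding row_action_Comp[OF B Y \<iota>B Ff] Comp_row_action[OF A X \<iota> f] by (simp add: D(7)[OF f])
  have "transition F F' \<iota> \<pi>' a B \<cdot> on_Arr F f =
      msum (on_Ob F A) (on_Ob F' B) (\<lambda>l. \<pi>' B l \<cdot> ?s l \<cdot> on_Arr F f) UNIV"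
    unfolding transition_def by (intro msum_Comp Y' Ff Comp_Hom[OF s \<pi>'B]) simp
  also have "\<dots> = msum (on_Ob F A) (on_Ob F' B) (\<lambda>l. on_Arr F' f \<cdot> (\<pi>' A l \<cdot> ?r l)) UNIV"
    by (simp add: Comp_assoc[OF Ff s \<pi>'B, symmetric] rs Comp_assoc[OF r fC \<pi>'B]
        Comp_assoc[OF r \<pi>' F'f] D'(8)[OF f])
  also have "\<dots> = on_Arr F' f \<cdot> transition F F' \<iota> \<pi>' a A"
    unfolding transition_def by (intro Comp_msum[symmetric] X F'f Comp_Hom[OF r \<pi>']) simp
  finally show ?thesis .
qed

theorem sums_of_invariants_naturally_isomorphic:
  fixes H K :: "'i::finite \<Rightarrow> 'g set"
  assumes "\<exists>\<iota> \<pi>. sum_of_invariants F H UNIV \<iota> \<pi>" and "\<exists>\<iota> \<pi>. sum_of_invariants F' K UNIV \<iota> \<pi>"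
    and "\<exists>a b :: 'i \<Rightarrow> 'i \<Rightarrow> 'g \<Rightarrow> rat. \<forall>i j. \<forall>g \<in> carrier G.
      group_ring_mult G (averaging K) a i j g = a i j g \<and>
      group_ring_mult G (averaging H) b i j g = b i j g \<and>
      group_ring_mult G a b i j g = averaging K i j g \<and>
      group_ring_mult G b a i j g = averaging H i j g"
  shows "naturally_isomorphic \<G> C F F'"
proof -
  obtain \<iota> \<pi> \<iota>' \<pi>' a b where S: "sum_of_invariants F H UNIV \<iota> \<pi>" and S': "sum_of_invariants F' K UNIV \<iota>' \<pi>'"
    and ab: "\<And>i j g. g \<in> carrier G \<Longrightarrow> group_ring_mult G (averaging K) a i j g = a i j g"
      "\<And>i j g. g \<in> carrier G \<Longrightarrow> group_ring_mult G (averaging H) b i j g = b i j g"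
      "\<And>i j g. g \<in> carrier G \<Longrightarrow> group_ring_mult G a b i j g = averaging K i j g"
      "\<And>i j g. g \<in> carrier G \<Longrightarrow> group_ring_mult G b a i j g = averaging H i j g"
    using assms by blast
  show ?thesis
    unfolding naturally_isomorphic_def
  proof (intro conjI exI ballI)
    show "is_functor \<G> C F" "is_functor \<G> C F'"
      by (rule sum_of_invariants_functor[OF S finite], rule sum_of_invariants_functor[OF S' finite])
    fix A assume A: "A \<in> Ob \<G>"
    show "transition F F' \<iota> \<pi>' a A \<in> Iso C (on_Ob F A) (on_Ob F' A)"
      unfolding Iso_def using transition_Hom[OF S S' A] transition_Hom[OF S' S A]
        transition_inverse[OF S S' A ab(1,4)] transition_inverse[OF S' S A ab(2,3)] by blast
  next
    fix A B f assume "f \<in> Hom \<G> A B"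
    then show "transition F F' \<iota> \<pi>' a B \<cdot> on_Arr F f = on_Arr F' f \<cdot> transition F F' \<iota> \<pi>' a A"
      by (rule transition_natural[OF S S'])
  qed
qed

end

section \<open>Invariants and their direct sums as images of averaging matrices\<close>

context finite_group_in_category
begin

text \<open>The averaging operator has invariant values, so it factors as \<iota> p through the
  representing subobject. Then \<iota> p \<iota> = \<iota>, and p \<iota> is the identity since
  \<iota> is a monomorphism. A singleton index set allows summands to be joined later along disjoint
  index sets.\<close>

lemma inv_fctr_sum_of_invariants:
  fixes H :: "'i \<Rightarrow> 'g set"
  assumes J: "invariants_choice C G J" and H: "subgroup (H i) G"
  shows "\<exists>\<iota> \<pi>. sum_of_invariants (inv_fctr C J (H i)) H {i} \<iota> \<pi>"
proof -
  let ?I = "\<lambda>A. fst (J A (H i))" and ?\<iota> = "\<lambda>A. snd (J A (H i))"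
  let ?e = "\<lambda>A. group_ring_action A (averaging H i i)"
  have inv: "is_invariants C (fst A) (snd A) (H i) (?I A, ?\<iota> A)" if "A \<in> Ob \<G>" for A
    using J H that by (cases A) (auto simp: invariants_choice_def)
  have I: "?I A \<in> Ob C" and \<iota>: "?\<iota> A \<in> Hom C (?I A) (fst A)" if "A \<in> Ob \<G>" for A
    using inv[OF that] by (auto simp: is_invariants_def)
  have bij: "bij_betw (\<lambda>u. ?\<iota> A \<cdot> u) (Hom C X (?I A)) (Hom_invariants C (fst A) (snd A) (H i) X)"
    if "A \<in> Ob \<G>" "X \<in> Ob C" for A X
    using inv[OF that(1)] that(2) by (auto simp: is_invariants_def)
  have factor: "\<exists>u \<in> Hom C X (?I A). ?\<iota> A \<cdot> u = f"
    if "A \<in> Ob \<G>" "f \<in> Hom_invariants C (fst A) (snd A) (H i) X" for A X f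
  proof -
    have "X \<in> Ob C"
      using that(2) Hom_Ob by (auto simp: Hom_invariants_def)
    then show ?thesis
      using bij_betw_imp_surj_on[OF bij[OF that(1)]] that(2) by (metis (no_types, lifting) imageE)
  qed
  have mono: "u = u'"
    if "A \<in> Ob \<G>" "u \<in> Hom C X (?I A)" "u' \<in> Hom C X (?I A)" "?\<iota> A \<cdot> u = ?\<iota> A \<cdot> u'" for A X u u'
    using bij_betw_imp_inj_on[OF bij[OF that(1) Hom_Ob(1)[OF that(2)]]] that(2-) by (auto dest: inj_onD)
  have "\<exists>p. \<forall>A \<in> Ob \<G>. p A \<in> Hom C (fst A) (?I A) \<and> ?\<iota> A \<cdot> p A = ?e A"
  proof (intro bchoice ballI)
    fix A assume A: "A \<in> Ob \<G>"
    show "\<exists>p. p \<in> Hom C (fst A) (?I A) \<and> ?\<iota> A \<cdot> p = ?e A"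
      using factor[OF A] averaging_invariant[where i = i and H = H, OF GObj_Ob[OF A] H] by auto
  qed
  then obtain p where p: "\<And>A. A \<in> Ob \<G> \<Longrightarrow> p A \<in> Hom C (fst A) (?I A)"
    and \<iota>p: "\<And>A. A \<in> Ob \<G> \<Longrightarrow> ?\<iota> A \<cdot> p A = ?e A"
    by blast
  have e: "?e A \<in> Hom C (fst A) (fst A)" if "A \<in> Ob \<G>" for A
    using group_ring_action_Hom[OF GObj_Ob[OF that]] by simp
  have \<iota>_inv: "?\<iota> A \<in> Hom_invariants C (fst A) (snd A) (H i) (?I A)" if "A \<in> Ob \<G>" for A
    using bij_betw_apply[OF bij[OF that I[OF that]] Id_Hom[OF I[OF that]]] Comp_Id[OF \<iota>[OF that]] by simp
  have p\<iota>: "p A \<cdot> ?\<iota> A = Id C (?I A)" if A: "A \<in> Ob \<G>" for A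
  proof (rule mono[OF A Comp_Hom[OF \<iota>[OF A] p[OF A]] Id_Hom[OF I[OF A]]])
    show "?\<iota> A \<cdot> (p A \<cdot> ?\<iota> A) = ?\<iota> A \<cdot> Id C (?I A)"
      using averaging_fixes_invariants[where i = i and H = H, OF GObj_Ob[OF A] H \<iota>_inv[OF A]]
      by (simp add: Comp_assoc[OF \<iota>[OF A] p[OF A] \<iota>[OF A]] \<iota>p[OF A] Comp_Id[OF \<iota>[OF A]])
  qed
  have arr: "on_Arr (inv_fctr C J (H i)) f \<in> Hom C (?I A) (?I B) \<and>
      ?\<iota> B \<cdot> on_Arr (inv_fctr C J (H i)) f = fst (snd f) \<cdot> ?\<iota> A" if f: "f \<in> Hom \<G> A B" for f A B
  proof -
    note A = GObj_Hom(3)[OF f] and B = GObj_Hom(4)[OF f] and fC = GObj_Hom(1)[OF f]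
    \<comment> \<open>Equivariance makes the composite of \<open>f\<close> with the inclusion
      invariant under \<open>H i\<close>, so it factors through the invariants of
      \<open>B\<close>.\<close>
    have "snd B h \<cdot> (fst (snd f) \<cdot> ?\<iota> A) = fst (snd f) \<cdot> ?\<iota> A" if h: "h \<in> H i" for h
    proof -
      have hG: "h \<in> carrier G"
        using h subgroup.mem_carrier[OF H] by blast
      note hA = action_Hom[OF GObj_Ob[OF A] hG] and hB = action_Hom[OF GObj_Ob[OF B] hG]
      show ?thesis
        using \<iota>_inv[OF A] h by (simp add: Comp_assoc[OF \<iota>[OF A] fC hB] flip: GObj_Hom(2)[OF f hG])
          (simp add: Hom_invariants_def flip: Comp_assoc[OF \<iota>[OF A] hA fC])
    qed
    then have "fst (snd f) \<cdot> ?\<iota> A \<in> Hom_invariants C (fst B) (snd B) (H i) (?I A)"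
      using Comp_Hom[OF \<iota>[OF A] fC] by (simp add: Hom_invariants_def)
    then have ex1: "\<exists>!u. u \<in> Hom C (?I A) (?I B) \<and> ?\<iota> B \<cdot> u = fst (snd f) \<cdot> ?\<iota> A"
      using factor[OF B] mono[OF B] by metis
    have "on_Arr (inv_fctr C J (H i)) f =
        (THE u. u \<in> Hom C (?I A) (?I B) \<and> ?\<iota> B \<cdot> u = fst (snd f) \<cdot> ?\<iota> A)"
      by (subst GObj_Hom(5)[OF f]) (simp add: inv_fctr_def)
    then show ?thesis
      using theI'[OF ex1] by simp
  qed
  have "sum_of_invariants (inv_fctr C J (H i)) H {i} (\<lambda>A _. ?\<iota> A) (\<lambda>A _. p A)"
    unfolding sum_of_invariants_def
  proof (intro conjI ballI allI impI)
    fix A j k assume A: "A \<in> Ob \<G>" and "j \<in> {i}" "k \<in> {i}"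
    then show "?\<iota> A \<cdot> p A = group_ring_action A (averaging H j k)"
      using \<iota>p by simp
  next
    fix A assume A: "A \<in> Ob \<G>"
    show "on_Ob (inv_fctr C J (H i)) A \<in> Ob C"
      using I[OF A] by (simp add: inv_fctr_def)
    show "?\<iota> A \<in> Hom C (on_Ob (inv_fctr C J (H i)) A) (fst A)"
      "p A \<in> Hom C (fst A) (on_Ob (inv_fctr C J (H i)) A)"
      using \<iota>[OF A] p[OF A] by (simp_all add: inv_fctr_def)
    show "msum (on_Ob (inv_fctr C J (H i)) A) (on_Ob (inv_fctr C J (H i)) A) (\<lambda>i. p A \<cdot> ?\<iota> A) {i} =
        Id C (on_Ob (inv_fctr C J (H i)) A)"
      using msum_singleton[of "\<lambda>_. p A \<cdot> ?\<iota> A" i] p\<iota>[OF A] Id_Hom[OF I[OF A]] by (simp add: inv_fctr_def)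
  next
    fix A B f j assume f: "f \<in> Hom \<G> A B"
    note A = GObj_Hom(3)[OF f] and B = GObj_Hom(4)[OF f] and fC = GObj_Hom(1)[OF f]
    let ?u = "on_Arr (inv_fctr C J (H i)) f"
    have u: "?u \<in> Hom C (?I A) (?I B)" "?\<iota> B \<cdot> ?u = fst (snd f) \<cdot> ?\<iota> A"
      using arr[OF f] by auto
    show "?u \<in> Hom C (on_Ob (inv_fctr C J (H i)) A) (on_Ob (inv_fctr C J (H i)) B)"
      using u(1) by (simp add: inv_fctr_def)
    show "fst (snd f) \<cdot> ?\<iota> A = ?\<iota> B \<cdot> ?u"
      using u(2) by simp
    \<comment> \<open>Both sides are compared after the monomorphism into \<open>B\<close>, where
      naturality of the averaging operator applies.\<close>
    show "?u \<cdot> p A = p B \<cdot> fst (snd f)"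
    proof (rule mono[OF B Comp_Hom[OF p[OF A] u(1)] Comp_Hom[OF fC p[OF B]]])
      have "?\<iota> B \<cdot> (?u \<cdot> p A) = fst (snd f) \<cdot> ?e A"
        by (simp add: Comp_assoc[OF p[OF A] u(1) \<iota>[OF B]] u(2) \<iota>p[OF A, symmetric]
            Comp_assoc[OF p[OF A] \<iota>[OF A] fC])
      also have "\<dots> = ?e B \<cdot> fst (snd f)"
        using group_ring_action_natural[OF GObj_Ob[OF A] GObj_Ob[OF B] fC] GObj_Hom(2)[OF f] by simp
      also have "\<dots> = ?\<iota> B \<cdot> (p B \<cdot> fst (snd f))"
        by (simp add: Comp_assoc[OF fC p[OF B] \<iota>[OF B]] \<iota>p[OF B])
      finally show "?\<iota> B \<cdot> (?u \<cdot> p A) = ?\<iota> B \<cdot> (p B \<cdot> fst (snd f))" .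
    qed
  qed
  then show ?thesis
    by blast
qed

text \<open>Inclusions are preceded by the projections of the direct sum, retractions followed by
  its injections. Nested direct sums thus become one family over a disjoint union, which removes the
  bracketing.\<close>

lemma sum_fctr_sum_of_invariants:
  fixes H :: "'i \<Rightarrow> 'g set"
  assumes D: "direct_sum_choice C D"
    and S: "\<exists>\<iota> \<pi>. sum_of_invariants F H I \<iota> \<pi>" and S': "\<exists>\<iota> \<pi>. sum_of_invariants F' H I' \<iota> \<pi>"
    and fin: "finite I" "finite I'" and disj: "I \<inter> I' = {}"
  shows "\<exists>\<iota> \<pi>. sum_of_invariants (sum_fctr C D \<G> F F') H (I \<union> I') \<iota> \<pi>"
proof -
  obtain \<iota> \<pi> \<iota>' \<pi>' where S: "sum_of_invariants F H I \<iota> \<pi>" and S': "sum_of_invariants F' H I' \<iota>' \<pi>'"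
    using S S' by blast
  note P = sum_of_invariantsD[OF S] and P' = sum_of_invariantsD[OF S']
  let ?S = "\<lambda>A. D (on_Ob F A) (on_Ob F' A)" and ?F = "sum_fctr C D \<G> F F'"
  define \<iota>S where "\<iota>S A i = (if i \<in> I then \<iota> A i \<cdot> pr1 (?S A) else \<iota>' A i \<cdot> pr2 (?S A))" for A i
  define \<pi>S where "\<pi>S A i = (if i \<in> I then in1 (?S A) \<cdot> \<pi> A i else in2 (?S A) \<cdot> \<pi>' A i)" for A i
  have ob: "on_Ob ?F A = sum_Ob (?S A)" for A
    by (simp add: sum_fctr_def)
  have ds: "is_direct_sum C (on_Ob F A) (on_Ob F' A) (?S A)" if "A \<in> Ob \<G>" for A
    using D P(1) P'(1) that by (simp add: direct_sum_choice_def)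
  have so: "sum_Ob (?S A) \<in> Ob C" and in1: "in1 (?S A) \<in> Hom C (on_Ob F A) (sum_Ob (?S A))"
    and in2: "in2 (?S A) \<in> Hom C (on_Ob F' A) (sum_Ob (?S A))"
    and pr1: "pr1 (?S A) \<in> Hom C (sum_Ob (?S A)) (on_Ob F A)"
    and pr2: "pr2 (?S A) \<in> Hom C (sum_Ob (?S A)) (on_Ob F' A)"
    and pi11: "pr1 (?S A) \<cdot> in1 (?S A) = Id C (on_Ob F A)"
    and pi22: "pr2 (?S A) \<cdot> in2 (?S A) = Id C (on_Ob F' A)"
    and pi21: "pr2 (?S A) \<cdot> in1 (?S A) = Zero C (on_Ob F A) (on_Ob F' A)"
    and pi12: "pr1 (?S A) \<cdot> in2 (?S A) = Zero C (on_Ob F' A) (on_Ob F A)"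
    and add: "Add C (in1 (?S A) \<cdot> pr1 (?S A)) (in2 (?S A) \<cdot> pr2 (?S A)) = Id C (sum_Ob (?S A))"
    if "A \<in> Ob \<G>" for A
    using ds[OF that] by (auto simp: is_direct_sum_def)
  have notin: "i \<notin> I" if "i \<in> I'" for i
    using disj that by auto
  have "sum_of_invariants ?F H (I \<union> I') \<iota>S \<pi>S"
    unfolding sum_of_invariants_def
  proof (intro conjI ballI allI impI)
    fix A assume A: "A \<in> Ob \<G>"
    note so = so[OF A] and in1 = in1[OF A] and in2 = in2[OF A] and pr1 = pr1[OF A] and pr2 = pr2[OF A]
    note P1 = P(1)[OF A] and P2 = P(2)[OF A] and P3 = P(3)[OF A]
    note P1' = P'(1)[OF A] and P2' = P'(2)[OF A] and P3' = P'(3)[OF A]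
    show "on_Ob ?F A \<in> Ob C"
      using so by (simp add: ob)
    fix i assume i: "i \<in> I \<union> I'"
    show "\<iota>S A i \<in> Hom C (on_Ob ?F A) (fst A)"
      using i Comp_Hom[OF pr1 P2] Comp_Hom[OF pr2 P2'] by (auto simp: \<iota>S_def ob)
    show "\<pi>S A i \<in> Hom C (fst A) (on_Ob ?F A)"
      using i Comp_Hom[OF P3 in1] Comp_Hom[OF P3' in2] by (auto simp: \<pi>S_def ob)
  next
    fix A i j assume A: "A \<in> Ob \<G>" and ij: "i \<in> I \<union> I'" "j \<in> I \<union> I'"
    note so = so[OF A] and in1 = in1[OF A] and in2 = in2[OF A] and pr1 = pr1[OF A] and pr2 = pr2[OF A]
    note P1 = P(1)[OF A] and P2 = P(2)[OF A] and P3 = P(3)[OF A]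
    note P1' = P'(1)[OF A] and P2' = P'(2)[OF A] and P3' = P'(3)[OF A]
    have chain: "(x \<cdot> p) \<cdot> (q \<cdot> y) = x \<cdot> ((p \<cdot> q) \<cdot> y)"
      if "y \<in> Hom C (fst A) Y" "q \<in> Hom C Y (sum_Ob (?S A))" "p \<in> Hom C (sum_Ob (?S A)) X"
        "x \<in> Hom C X (fst A)" for x p q y X Y
      by (simp add: Comp_assoc[OF that(1,2,3)] Comp_assoc[OF Comp_Hom[OF that(1,2)] that(3,4), symmetric])
    \<comment> \<open>The averaging matrix is diagonal, in agreement with the zero composites
      between different summands.\<close>
    have zero: "group_ring_action A (averaging H i j) = Zero C (fst A) (fst A)" if "i \<noteq> j"
      using that group_ring_action_zero[OF GObj_Ob[OF A]] by (simp add: averaging_def[abs_def])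
    consider "i \<in> I" "j \<in> I" | "i \<in> I" "j \<in> I'" | "i \<in> I'" "j \<in> I" | "i \<in> I'" "j \<in> I'"
      using ij by auto
    then show "\<iota>S A i \<cdot> \<pi>S A j = group_ring_action A (averaging H i j)"
    proof cases
      case 1
      then show ?thesis
        using chain[OF P3 in1 pr1 P2, of j i] pi11[OF A] Id_Comp[OF P3] P(4)[OF A]
        by (simp add: \<iota>S_def \<pi>S_def)
    next
      case 2
      then show ?thesis
        using chain[OF P3' in2 pr1 P2, of j i] pi12[OF A] Zero_Comp[OF P1 P3'] Comp_Zero[OF GObj_fst_Ob[OF A] P2]
          notin[of j] zero by (cases "i = j") (auto simp: \<iota>S_def \<pi>S_def)
    next
      case 3
      then show ?thesis
        using chain[OF P3 in1 pr2 P2', of j i] pi21[OF A] Zero_Comp[OF P1' P3] Comp_Zero[OF GObj_fst_Ob[OF A] P2']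
          notin[of i] zero by (cases "i = j") (auto simp: \<iota>S_def \<pi>S_def)
    next
      case 4
      then show ?thesis
        using chain[OF P3' in2 pr2 P2', of j i] pi22[OF A] Id_Comp[OF P3'] P'(4)[OF A] notin
        by (simp add: \<iota>S_def \<pi>S_def)
    qed
  next
    fix A assume A: "A \<in> Ob \<G>"
    note so = so[OF A] and in1 = in1[OF A] and in2 = in2[OF A] and pr1 = pr1[OF A] and pr2 = pr2[OF A]
    note P1 = P(1)[OF A] and P2 = P(2)[OF A] and P3 = P(3)[OF A] and P5 = P(5)[OF A]
    note P1' = P'(1)[OF A] and P2' = P'(2)[OF A] and P3' = P'(3)[OF A] and P5' = P'(5)[OF A]
    \<comment> \<open>The partition of the identity of one summand is pulled out from between its
      injection and its projection.\<close>
    have collect: "msum (sum_Ob (?S A)) (sum_Ob (?S A)) (\<lambda>i. (q \<cdot> y i) \<cdot> (x i \<cdot> p)) K = q \<cdot> p"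
      if q: "q \<in> Hom C X (sum_Ob (?S A))" and p: "p \<in> Hom C (sum_Ob (?S A)) X" and K: "finite K"
        and y: "\<And>i. i \<in> K \<Longrightarrow> y i \<in> Hom C (fst A) X" and x: "\<And>i. i \<in> K \<Longrightarrow> x i \<in> Hom C X (fst A)"
        and id: "msum X X (\<lambda>i. y i \<cdot> x i) K = Id C X" for q p X x y K
    proof -
      note X = Hom_Ob(1)[OF q]
      have "msum (sum_Ob (?S A)) (sum_Ob (?S A)) (\<lambda>i. (q \<cdot> y i) \<cdot> (x i \<cdot> p)) K =
          msum (sum_Ob (?S A)) (sum_Ob (?S A)) (\<lambda>i. q \<cdot> (y i \<cdot> x i \<cdot> p)) K"
      proof (intro msum_cong refl so)
        fix i assume i: "i \<in> K"
        show "(q \<cdot> y i) \<cdot> (x i \<cdot> p) = q \<cdot> (y i \<cdot> x i \<cdot> p)"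
          by (simp add: Comp_assoc[OF p x[OF i] y[OF i], symmetric]
              Comp_assoc[OF Comp_Hom[OF p x[OF i]] y[OF i] q])
        show "q \<cdot> (y i \<cdot> x i \<cdot> p) \<in> Hom C (sum_Ob (?S A)) (sum_Ob (?S A))"
          by (rule Comp_Hom[OF Comp_Hom[OF p Comp_Hom[OF x[OF i] y[OF i]]] q])
      qed
      also have "\<dots> = q \<cdot> msum (sum_Ob (?S A)) X (\<lambda>i. y i \<cdot> x i \<cdot> p) K"
        using K so q Comp_Hom[OF p Comp_Hom[OF x y]] by (intro Comp_msum[symmetric]) auto
      also have "msum (sum_Ob (?S A)) X (\<lambda>i. y i \<cdot> x i \<cdot> p) K = msum X X (\<lambda>i. y i \<cdot> x i) K \<cdot> p"
        using K X p Comp_Hom[OF x y] by (intro msum_Comp[symmetric]) auto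
      finally show ?thesis
        by (simp add: id Id_Comp[OF p])
    qed
    have Hom: "\<pi>S A i \<cdot> \<iota>S A i \<in> Hom C (sum_Ob (?S A)) (sum_Ob (?S A))" if "i \<in> I \<union> I'" for i
      using that Comp_Hom[OF Comp_Hom[OF pr1 P2] Comp_Hom[OF P3 in1]]
        Comp_Hom[OF Comp_Hom[OF pr2 P2'] Comp_Hom[OF P3' in2]] notin
      by (auto simp: \<iota>S_def \<pi>S_def)
    have 1: "msum (sum_Ob (?S A)) (sum_Ob (?S A)) (\<lambda>i. \<pi>S A i \<cdot> \<iota>S A i) I = in1 (?S A) \<cdot> pr1 (?S A)"
    proof -
      have "msum (sum_Ob (?S A)) (sum_Ob (?S A)) (\<lambda>i. \<pi>S A i \<cdot> \<iota>S A i) I =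
          msum (sum_Ob (?S A)) (sum_Ob (?S A)) (\<lambda>i. (in1 (?S A) \<cdot> \<pi> A i) \<cdot> (\<iota> A i \<cdot> pr1 (?S A))) I"
        using Comp_Hom[OF Comp_Hom[OF pr1 P2] Comp_Hom[OF P3 in1]]
        by (intro msum_cong refl so) (auto simp: \<iota>S_def \<pi>S_def)
      then show ?thesis
        using collect[OF in1 pr1 fin(1) P3 P2 P5] by simp
    qed
    have 2: "msum (sum_Ob (?S A)) (sum_Ob (?S A)) (\<lambda>i. \<pi>S A i \<cdot> \<iota>S A i) I' = in2 (?S A) \<cdot> pr2 (?S A)"
    proof -
      have "msum (sum_Ob (?S A)) (sum_Ob (?S A)) (\<lambda>i. \<pi>S A i \<cdot> \<iota>S A i) I' =
          msum (sum_Ob (?S A)) (sum_Ob (?S A)) (\<lambda>i. (in2 (?S A) \<cdot> \<pi>' A i) \<cdot> (\<iota>' A i \<cdot> pr2 (?S A))) I'"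
        using Comp_Hom[OF Comp_Hom[OF pr2 P2'] Comp_Hom[OF P3' in2]] notin
        by (intro msum_cong refl so) (auto simp: \<iota>S_def \<pi>S_def)
      then show ?thesis
        using collect[OF in2 pr2 fin(2) P3' P2' P5'] by simp
    qed
    show "msum (on_Ob ?F A) (on_Ob ?F A) (\<lambda>i. \<pi>S A i \<cdot> \<iota>S A i) (I \<union> I') = Id C (on_Ob ?F A)"
      unfolding ob using msum_Un_disjoint[OF so so fin disj Hom] 1 2 add[OF A] by simp
  next
    fix A B f assume f: "f \<in> Hom \<G> A B"
    note A = GObj_Hom(3)[OF f] and B = GObj_Hom(4)[OF f] and fC = GObj_Hom(1)[OF f]
    let ?t = "on_Arr ?F f"
    let ?t1 = "in1 (?S B) \<cdot> on_Arr F f \<cdot> pr1 (?S A)" and ?t2 = "in2 (?S B) \<cdot> on_Arr F' f \<cdot> pr2 (?S A)"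
    have t: "?t = Add C ?t1 ?t2"
      using f by (simp add: sum_fctr_def Let_def Hom_def)
    note h1 = Comp_Hom[OF P(6)[OF f] in1[OF B]] and h2 = Comp_Hom[OF P'(6)[OF f] in2[OF B]]
    note t1 = Comp_Hom[OF pr1[OF A] h1] and t2 = Comp_Hom[OF pr2[OF A] h2]
    have tH: "?t \<in> Hom C (sum_Ob (?S A)) (sum_Ob (?S B))"
      unfolding t by (rule Add_Hom[OF t1 t2])
    then show "?t \<in> Hom C (on_Ob ?F A) (on_Ob ?F B)"
      by (simp add: ob)
    \<comment> \<open>The morphism \<open>?t\<close> is diagonal, so it is compatible with both
      projections and both injections.\<close>
    have pr1t: "pr1 (?S B) \<cdot> ?t = on_Arr F f \<cdot> pr1 (?S A)"
    proof -
      have "pr1 (?S B) \<cdot> ?t1 = on_Arr F f \<cdot> pr1 (?S A)"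
        by (simp add: Comp_assoc[OF pr1[OF A] h1 pr1[OF B]] Comp_assoc[OF P(6)[OF f] in1[OF B] pr1[OF B]]
            pi11[OF B] Id_Comp[OF P(6)[OF f]])
      moreover have "pr1 (?S B) \<cdot> ?t2 = Zero C (sum_Ob (?S A)) (on_Ob F B)"
        by (simp add: Comp_assoc[OF pr2[OF A] h2 pr1[OF B]] Comp_assoc[OF P'(6)[OF f] in2[OF B] pr1[OF B]]
            pi12[OF B] Zero_Comp[OF P(1)[OF B] P'(6)[OF f]] Zero_Comp[OF P(1)[OF B] pr2[OF A]])
      ultimately show ?thesis
        unfolding t using Comp_Add_right[OF t1 t2 pr1[OF B]] Add_Zero[OF Comp_Hom[OF pr1[OF A] P(6)[OF f]]]
        by simp
    qed
    have pr2t: "pr2 (?S B) \<cdot> ?t = on_Arr F' f \<cdot> pr2 (?S A)"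
    proof -
      have "pr2 (?S B) \<cdot> ?t2 = on_Arr F' f \<cdot> pr2 (?S A)"
        by (simp add: Comp_assoc[OF pr2[OF A] h2 pr2[OF B]] Comp_assoc[OF P'(6)[OF f] in2[OF B] pr2[OF B]]
            pi22[OF B] Id_Comp[OF P'(6)[OF f]])
      moreover have "pr2 (?S B) \<cdot> ?t1 = Zero C (sum_Ob (?S A)) (on_Ob F' B)"
        by (simp add: Comp_assoc[OF pr1[OF A] h1 pr2[OF B]] Comp_assoc[OF P(6)[OF f] in1[OF B] pr2[OF B]]
            pi21[OF B] Zero_Comp[OF P'(1)[OF B] P(6)[OF f]] Zero_Comp[OF P'(1)[OF B] pr1[OF A]])
      ultimately show ?thesis
        unfolding t using Comp_Add_right[OF t1 t2 pr2[OF B]] Zero_Add[OF Comp_Hom[OF pr2[OF A] P'(6)[OF f]]]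
        by simp
    qed
    have in1t: "?t \<cdot> in1 (?S A) = in1 (?S B) \<cdot> on_Arr F f"
    proof -
      have "?t1 \<cdot> in1 (?S A) = in1 (?S B) \<cdot> on_Arr F f"
        by (simp add: Comp_assoc[OF in1[OF A] pr1[OF A] h1, symmetric] pi11[OF A] Comp_Id[OF h1])
      moreover have "?t2 \<cdot> in1 (?S A) = Zero C (on_Ob F A) (sum_Ob (?S B))"
        by (simp add: Comp_assoc[OF in1[OF A] pr2[OF A] h2, symmetric] pi21[OF A] Comp_Zero[OF P(1)[OF A] h2])
      ultimately show ?thesis
        unfolding t using Comp_Add_left[OF in1[OF A] t1 t2] Add_Zero[OF h1] by simp
    qed
    have in2t: "?t \<cdot> in2 (?S A) = in2 (?S B) \<cdot> on_Arr F' f"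
    proof -
      have "?t2 \<cdot> in2 (?S A) = in2 (?S B) \<cdot> on_Arr F' f"
        by (simp add: Comp_assoc[OF in2[OF A] pr2[OF A] h2, symmetric] pi22[OF A] Comp_Id[OF h2])
      moreover have "?t1 \<cdot> in2 (?S A) = Zero C (on_Ob F' A) (sum_Ob (?S B))"
        by (simp add: Comp_assoc[OF in2[OF A] pr1[OF A] h1, symmetric] pi12[OF A] Comp_Zero[OF P'(1)[OF A] h1])
      ultimately show ?thesis
        unfolding t using Comp_Add_left[OF in2[OF A] t1 t2] Zero_Add[OF h2] by simp
    qed
    fix i assume i: "i \<in> I \<union> I'"
    show "fst (snd f) \<cdot> \<iota>S A i = \<iota>S B i \<cdot> ?t"
    proof (cases "i \<in> I")
      case True
      note iA = P(2)[OF A True] and iB = P(2)[OF B True]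
      show ?thesis
        using True by (simp add: \<iota>S_def Comp_assoc[OF pr1[OF A] iA fC] Comp_assoc[OF tH pr1[OF B] iB, symmetric]
            pr1t Comp_assoc[OF pr1[OF A] P(6)[OF f] iB] P(7)[OF f])
    next
      case False
      then have i': "i \<in> I'"
        using i by simp
      note iA = P'(2)[OF A i'] and iB = P'(2)[OF B i']
      show ?thesis
        using False i' by (simp add: \<iota>S_def Comp_assoc[OF pr2[OF A] iA fC] Comp_assoc[OF tH pr2[OF B] iB, symmetric]
            pr2t Comp_assoc[OF pr2[OF A] P'(6)[OF f] iB] P'(7)[OF f])
    qed
    show "?t \<cdot> \<pi>S A i = \<pi>S B i \<cdot> fst (snd f)"
    proof (cases "i \<in> I")
      case True
      note iA = P(3)[OF A True] and iB = P(3)[OF B True]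
      show ?thesis
        using True by (simp add: \<pi>S_def Comp_assoc[OF iA in1[OF A] tH] in1t
            Comp_assoc[OF iA P(6)[OF f] in1[OF B], symmetric] Comp_assoc[OF fC iB in1[OF B], symmetric] P(8)[OF f])
    next
      case False
      then have i': "i \<in> I'"
        using i by simp
      note iA = P'(3)[OF A i'] and iB = P'(3)[OF B i']
      show ?thesis
        using False i' by (simp add: \<pi>S_def Comp_assoc[OF iA in2[OF A] tH] in2t
            Comp_assoc[OF iA P'(6)[OF f] in2[OF B], symmetric] Comp_assoc[OF fC iB in2[OF B], symmetric] P'(8)[OF f])
    qed
  qed
  then show ?thesis
    by blast
qed

end

section \<open>Counting in finite group actions\<close>

text \<open>The pairs (g, x) are counted twice: for fixed \<open>x\<close>, conjugation by
  \<open>x\<close> is a bijection of the group, so as many \<open>g\<close> qualify as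
  \<open>S\<close> has elements.\<close>

lemma (in group) sum_conj_count:
  assumes "finite (carrier G)" "S \<subseteq> carrier G"
  shows "(\<Sum>g\<in>carrier G. conj_count G S g) = card (carrier G) * card S"
proof -
  have "(\<Sum>g\<in>carrier G. conj_count G S g) = (\<Sum>g\<in>carrier G. \<Sum>x\<in>carrier G. of_bool (inv x \<otimes> g \<otimes> x \<in> S))"
    using assms by (simp add: conj_count_def sum_of_bool_eq Int_def)
  also have "\<dots> = (\<Sum>x\<in>carrier G. \<Sum>g\<in>carrier G. of_bool (inv x \<otimes> g \<otimes> x \<in> S))"
    by (rule sum.swap)
  also have "\<dots> = (\<Sum>x\<in>carrier G. card S)"
  proof (rule sum.cong)
    fix x assume x: "x \<in> carrier G"
    have "(\<Sum>g\<in>carrier G. of_bool (inv x \<otimes> g \<otimes> x \<in> S)) = (\<Sum>s\<in>carrier G. of_bool (s \<in> S) :: nat)"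
      by (rule sum.reindex_bij_witness[of _ "\<lambda>s. x \<otimes> s \<otimes> inv x" "\<lambda>g. inv x \<otimes> g \<otimes> x"])
        (use x in \<open>simp_all add: m_assoc\<close>, simp_all add: m_assoc[symmetric])
    also have "\<dots> = card S"
      using assms by (simp add: sum_of_bool_eq Int_absorb1 Int_absorb2)
    finally show "(\<Sum>g\<in>carrier G. of_bool (inv x \<otimes> g \<otimes> x \<in> S)) = card S" .
  qed simp
  finally show ?thesis
    by simp
qed

context finite_group_action
begin

lemma subgroup_stabilizer: "subgroup (stabilizer G \<phi> x) G"
proof (rule subgroupI)
  show "stabilizer G \<phi> x \<noteq> {}"
    using act_one by (auto simp: stabilizer_def)
  show "inv a \<in> stabilizer G \<phi> x" if "a \<in> stabilizer G \<phi> x" for a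
    using that act_inv(1)[of a x] by (simp add: stabilizer_def)
qed (auto simp: stabilizer_def act_mult)

lemma card_stabilizer_nonzero: "card (stabilizer G \<phi> x) \<noteq> 0"
  using subgroup.one_closed[OF subgroup_stabilizer] fin by (auto simp: stabilizer_def)

text \<open>The elements that carry x to y form a left coset of the stabilizer of x.\<close>

lemma card_transporter:
  assumes "y \<in> orbit G \<phi> x"
  shows "card {g \<in> carrier G. \<phi> g x = y} = card (stabilizer G \<phi> x)"
proof -
  obtain h where h: "h \<in> carrier G" "y = \<phi> h x"
    using assms by (auto simp: orbit_def)
  have "bij_betw (\<lambda>g. h \<otimes> g) (stabilizer G \<phi> x) {g \<in> carrier G. \<phi> g x = y}"
    by (rule bij_betw_byWitness[where f' = "\<lambda>g. inv h \<otimes> g"])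
      (use h in \<open>auto simp: stabilizer_def act_mult act_inv simp flip: m_assoc\<close>)
  then show ?thesis
    by (simp add: bij_betw_same_card)
qed

lemma card_act_in:
  "card {g \<in> carrier G. P (\<phi> g x)} = card (stabilizer G \<phi> x) * card {y \<in> orbit G \<phi> x. P y}"
proof -
  have fin_orbit: "finite (orbit G \<phi> x)"
    using fin by (simp add: orbit_def)
  have "{g \<in> carrier G. P (\<phi> g x)} = (\<Union>y\<in>{y \<in> orbit G \<phi> x. P y}. {g \<in> carrier G. \<phi> g x = y})"
    by (auto simp: orbit_def)
  also have "card \<dots> = (\<Sum>y\<in>{y \<in> orbit G \<phi> x. P y}. card {g \<in> carrier G. \<phi> g x = y})"
    using fin fin_orbit by (intro card_UN_disjoint) auto
  finally show ?thesis
    by (simp add: card_transporter)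
qed

text \<open>Two cases of \<open>\<tau>\<close> matter: the identity, and an involution that commutes with the action.\<close>

lemma conj_count_transporter:
  assumes g: "g \<in> carrier G" and \<tau>: "\<And>h. h \<in> carrier G \<Longrightarrow> \<phi> h (\<tau> x) = \<tau> (\<phi> h x)"
  shows "conj_count G {s \<in> carrier G. \<phi> s x = \<tau> x} g =
    card (stabilizer G \<phi> x) * card {y \<in> orbit G \<phi> x. \<phi> g y = \<tau> y}"
proof -
  \<comment> \<open>The conjugate of g by h moves x to \<tau> x exactly when g moves hx to \<tau>
    (hx), because \<tau> commutes with h.\<close>
  have "\<phi> (inv h \<otimes> g \<otimes> h) x = \<tau> x \<longleftrightarrow> \<phi> g (\<phi> h x) = \<tau> (\<phi> h x)" if "h \<in> carrier G" for h
    using that g act_inv(2)[OF that, of "\<phi> g (\<phi> h x)"] act_inv(1)[OF that, of "\<tau> x"] \<tau>[OF that]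
    by (auto simp: act_mult m_assoc)
  then have "{h \<in> carrier G. inv h \<otimes> g \<otimes> h \<in> {s \<in> carrier G. \<phi> s x = \<tau> x}} =
      {h \<in> carrier G. \<phi> g (\<phi> h x) = \<tau> (\<phi> h x)}"
    using g by auto
  then show ?thesis
    using card_act_in[of "\<lambda>y. \<phi> g y = \<tau> y" x] by (simp add: conj_count_def)
qed

text \<open>Burnside's lemma twisted by \<tau>: the transporter from x to \<tau> x is as large as
  the stabilizer, whose order therefore cancels from the sum of the conjugate counts.\<close>

lemma sum_twisted_fixed_points:
  assumes \<tau>: "\<And>h. h \<in> carrier G \<Longrightarrow> \<phi> h (\<tau> x) = \<tau> (\<phi> h x)" and "\<tau> x \<in> orbit G \<phi> x"
  shows "(\<Sum>g\<in>carrier G. card {y \<in> orbit G \<phi> x. \<phi> g y = \<tau> y}) = card (carrier G)"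
proof -
  have "card (stabilizer G \<phi> x) * (\<Sum>g\<in>carrier G. card {y \<in> orbit G \<phi> x. \<phi> g y = \<tau> y}) =
      card (stabilizer G \<phi> x) * card (carrier G)"
    using sum_conj_count[OF fin, of "{s \<in> carrier G. \<phi> s x = \<tau> x}"] card_transporter[OF assms(2)]
    by (simp add: sum_distrib_left conj_count_transporter[where \<tau> = \<tau>, OF _ \<tau>] mult.commute)
  then show ?thesis
    using card_stabilizer_nonzero[of x] by simp
qed

lemma sum_fixed_points: "(\<Sum>g\<in>carrier G. card {y \<in> orbit G \<phi> x. \<phi> g y = y}) = card (carrier G)"
proof -
  have "x \<in> orbit G \<phi> x"
    using act_one[of x] by (auto simp: orbit_def intro!: exI[of _ \<one>])
  then show ?thesis
    using sum_twisted_fixed_points[of "\<lambda>y. y" x] by simp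
qed

lemma conj_count_stabilizer:
  "g \<in> carrier G \<Longrightarrow> of_nat (conj_count G (stabilizer G \<phi> x) g) / of_nat (card (stabilizer G \<phi> x)) =
    (of_nat (card {y \<in> orbit G \<phi> x. \<phi> g y = y}) :: rat)"
  using conj_count_transporter[of g "\<lambda>y. y" x] card_stabilizer_nonzero[of x]
  by (simp add: stabilizer_def)

text \<open>\<open>K\<close> is the disjoint union of the stabilizer and the transporter to \<tau>
  x. These have equal size, which turns the count into the mean of plain and twisted fixed
  points.\<close>

lemma conj_count_setwise_stabilizer:
  assumes g: "g \<in> carrier G" and \<tau>: "\<And>h. h \<in> carrier G \<Longrightarrow> \<phi> h (\<tau> x) = \<tau> (\<phi> h x)"
    and \<tau>x: "\<tau> x \<in> orbit G \<phi> x" "\<tau> x \<noteq> x"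
    and K: "K = {s \<in> carrier G. \<phi> s x = x \<or> \<phi> s x = \<tau> x}"
  shows "of_nat (conj_count G K g) / of_nat (card K) =
    (of_nat (card {y \<in> orbit G \<phi> x. \<phi> g y = y}) + of_nat (card {y \<in> orbit G \<phi> x. \<phi> g y = \<tau> y})) / (2 :: rat)"
proof -
  let ?S = "stabilizer G \<phi> x" and ?W = "{s \<in> carrier G. \<phi> s x = \<tau> x}"
  have K: "K = ?S \<union> ?W" and disj: "?S \<inter> ?W = {}"
    using \<tau>x by (auto simp: K stabilizer_def)
  have fins: "finite ?S" "finite ?W"
    using fin by (auto simp: stabilizer_def)
  have "card K = 2 * card ?S"
    using card_transporter[OF \<tau>x(1)] card_Un_disjoint[OF fins disj] by (simp add: K)
  moreover have "{h \<in> carrier G. inv h \<otimes> g \<otimes> h \<in> K} =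
      {h \<in> carrier G. inv h \<otimes> g \<otimes> h \<in> ?S} \<union> {h \<in> carrier G. inv h \<otimes> g \<otimes> h \<in> ?W}"
    by (auto simp: K)
  then have "conj_count G K g = conj_count G ?S g + conj_count G ?W g"
    unfolding conj_count_def using fin disj by (simp only:) (rule card_Un_disjoint, auto)
  then have "conj_count G K g = card ?S *
      (card {y \<in> orbit G \<phi> x. \<phi> g y = y} + card {y \<in> orbit G \<phi> x. \<phi> g y = \<tau> y})"
    using conj_count_transporter[OF g, of "\<lambda>y. y" x] conj_count_transporter[OF g, where \<tau> = \<tau>, OF \<tau>]
    by (simp add: distrib_left flip: stabilizer_def)
  ultimately show ?thesis
    using card_stabilizer_nonzero[of x] by (simp add: field_simps)
qed

text \<open>The normalizers are defined as stabilizers of sets of lines; this makes them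
  subgroups.\<close>

lemma finite_group_action_image: "finite_group_action G (\<lambda>g. (`) (\<phi> g))"
proof
  show "(`) (\<phi> \<one>) X = X" for X
    by (simp add: act_one)
  show "(`) (\<phi> (g \<otimes> h)) X = (`) (\<phi> g) ((`) (\<phi> h) X)" if "g \<in> carrier G" "h \<in> carrier G" for g h X
    using that by (simp add: image_image act_mult)
qed (rule fin)

end

section \<open>Quadratic extensions of finite fields\<close>

text \<open>Multiplication by a nonzero x permutes the nonzero elements; comparing their products
  gives x^(q-1) = 1.\<close>

lemma finite_field_power_card:
  fixes x :: "'k::{field, finite}"
  shows "x ^ CARD('k) = x"
proof (cases "x = 0")
  case False
  have "(\<Prod>y\<in>UNIV - {0}. x * y) = (\<Prod>y\<in>UNIV - {0}. y)"
    by (rule prod.reindex_bij_witness[of _ "\<lambda>y. y / x" "\<lambda>y. x * y"]) (use False in auto)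
  then have "x ^ (CARD('k) - 1) = 1"
    by (simp add: prod.distrib card_Diff_singleton)
  then have "x * x ^ (CARD('k) - 1) = x"
    by simp
  then show ?thesis
    by (simp flip: power_Suc add: card_gt_0_iff)
qed (simp add: card_gt_0_iff)

lemma card_field_ge_2: "2 \<le> CARD('k::{field, finite})"
  using card_mono[of "UNIV :: 'k set" "{0, 1}"] by simp

text \<open>Besides the inclusion of the small field, automorphisms of the large field are
  instances, so both types stay arbitrary.\<close>

locale field_extension =
  fixes \<iota> :: "'k::field \<Rightarrow> 'l::field"
  assumes hom: "\<iota> \<in> ring_hom type_ring type_ring"
begin

lemma \<iota>_add: "\<iota> (x + y) = \<iota> x + \<iota> y" and \<iota>_mult: "\<iota> (x * y) = \<iota> x * \<iota> y" and \<iota>_1 [simp]: "\<iota> 1 = 1"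
  using hom by (auto simp: ring_hom_def type_ring_def)

lemma \<iota>_0 [simp]: "\<iota> 0 = 0"
  using \<iota>_add[of 0 0] by (metis add.right_neutral add_left_cancel)

lemma \<iota>_minus: "\<iota> (- x) = - \<iota> x"
  using \<iota>_add[of x "- x"] by (simp add: add_eq_0_iff)

lemma \<iota>_diff: "\<iota> (x - y) = \<iota> x - \<iota> y"
  using \<iota>_add[of x "- y"] by (simp add: \<iota>_minus)

lemma \<iota>_eq_0_iff [simp]: "\<iota> x = 0 \<longleftrightarrow> x = 0"
  using \<iota>_mult[of x "inverse x"] by (cases "x = 0") auto

lemma \<iota>_eq_iff [simp]: "\<iota> x = \<iota> y \<longleftrightarrow> x = y"
  using \<iota>_eq_0_iff[of "x - y"] by (simp add: \<iota>_diff del: \<iota>_eq_0_iff)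

lemma \<iota>_inverse: "\<iota> (inverse x) = inverse (\<iota> x)"
  using \<iota>_mult[of x "inverse x"] by (cases "x = 0") (auto simp: field_simps)

lemma \<iota>_divide: "\<iota> (x / y) = \<iota> x / \<iota> y"
  by (simp add: divide_inverse \<iota>_mult \<iota>_inverse)

lemma \<iota>_power: "\<iota> (x ^ n) = \<iota> x ^ n"
  by (induction n) (auto simp: \<iota>_mult)

lemma lin_indep:
  assumes "y \<notin> range \<iota>"
  shows "\<iota> c + \<iota> d * y = 0 \<longleftrightarrow> c = 0 \<and> d = 0"
proof -
  have "d = 0" if "\<iota> c + \<iota> d * y = 0"
  proof (rule ccontr)
    assume "d \<noteq> 0"
    then have "y = \<iota> (- c / d)"
      using that by (simp add: \<iota>_minus \<iota>_divide field_simps) (simp add: eq_neg_iff_add_eq_0 add.commute)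
    then show False
      using assms by blast
  qed
  then show ?thesis
    by auto
qed

lemmas \<iota>_simps = \<iota>_add \<iota>_mult \<iota>_minus \<iota>_diff \<iota>_divide

end

section \<open>The polynomial X^q - X and the q-th power map\<close>

locale finite_field_extension = field_extension \<iota> for \<iota> :: "'k::{field, finite} \<Rightarrow> 'l::field"
begin

lemma card_range: "card (range \<iota>) = CARD('k)"
  by (intro card_image) (auto simp: inj_on_def)

text \<open>As polynomials in x, both sides are monic of degree q and vanish at the q elements of
  \<open>range \<iota>\<close>.\<close>

lemma prod_linear_factors: "(\<Prod>d\<in>UNIV. x - \<iota> d) = x ^ CARD('k) - x"
proof -
  define p where "p = (\<Prod>d\<in>UNIV. [:- \<iota> d, 1:])"
  define q where "q = monom 1 (CARD('k)) - [:0, 1 :: 'l:]"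
  have deg_p: "degree p = CARD('k)"
    by (simp add: p_def degree_prod_eq_sum_degree)
  have lead_p: "coeff p (CARD('k)) = 1"
    using lead_coeff_prod[of "\<lambda>d. [:- \<iota> d, 1:]" UNIV] by (simp add: deg_p flip: p_def)
  have deg_q: "degree q \<le> CARD('k)"
    unfolding q_def using card_field_ge_2[where 'k = 'k]
    by (intro degree_diff_le) (auto simp: degree_monom_eq)
  have lead_q: "coeff q (CARD('k)) = 1"
    using card_field_ge_2[where 'k = 'k] by (simp add: q_def coeff_pCons split: nat.splits)
  have "p = q"
  proof (rule poly_eqI_degree_lead_coeff[where n = "CARD('k)" and A = "range \<iota>"])
    fix z assume "z \<in> range \<iota>"
    then obtain c where c: "z = \<iota> c"
      by auto
    have "poly p z = 0"
      by (auto simp: p_def poly_prod c)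
    moreover have "poly q z = 0"
      by (simp add: q_def c poly_monom finite_field_power_card flip: \<iota>_power)
    ultimately show "poly p z = poly q z"
      by simp
  qed (use deg_p deg_q lead_p lead_q card_range in auto)
  then have "poly p x = poly q x"
    by simp
  then show ?thesis
    by (simp add: p_def q_def poly_prod poly_monom)
qed

lemma power_card_eq_iff: "x ^ CARD('k) = x \<longleftrightarrow> x \<in> range \<iota>"
  using prod_linear_factors[of x] by (auto simp: finite_field_power_card simp flip: \<iota>_power)

text \<open>Translation by an element of \<open>range \<iota>\<close> permutes the linear factors of
  X^q - X.\<close>

lemma power_card_add_range: "(x + \<iota> c) ^ CARD('k) = x ^ CARD('k) + \<iota> c"
proof -
  have "(\<Prod>d\<in>UNIV. x + \<iota> c - \<iota> d) = (\<Prod>d\<in>UNIV. x - \<iota> d)"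
    by (rule prod.reindex_bij_witness[of _ "\<lambda>d. d + c" "\<lambda>d. d - c"]) (auto simp: \<iota>_simps)
  then show ?thesis
    by (simp add: prod_linear_factors algebra_simps)
qed

text \<open>Both sides are monic of degree \<open>q = CARD('k)\<close> in \<open>x\<close> and agree on the \<open>q\<close> elements of
  \<open>range \<iota>\<close>, by the translation invariance of \<open>X\<^sup>q - X\<close>. This avoids the characteristic.\<close>

lemma power_card_add:
  fixes x y :: 'l
  shows "(x + y) ^ CARD('k) = x ^ CARD('k) + y ^ CARD('k)"
proof -
  define q where "q = CARD('k)"
  have "q > 0"
    by (simp add: q_def card_gt_0_iff)
  have "[:y, 1:] ^ q = monom 1 q + [:y ^ q:]"
  proof (rule poly_eqI_degree_lead_coeff[where n = q and A = "range \<iota>"])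
    show "coeff ([:y, 1:] ^ q) q = coeff (monom 1 q + [:y ^ q:]) q"
      using \<open>q > 0\<close> lead_coeff_power[of "[:y, 1:]" q]
      by (simp add: degree_power_eq coeff_pCons split: nat.splits)
    show "degree (monom 1 q + [:y ^ q:]) \<le> q"
      by (intro degree_add_le) (auto simp: degree_monom_eq)
    show "poly ([:y, 1:] ^ q) z = poly (monom 1 q + [:y ^ q:]) z" if "z \<in> range \<iota>" for z
      using that power_card_add_range[of y]
      by (auto simp: q_def finite_field_power_card poly_monom poly_power \<iota>_power[symmetric] add.commute)
  qed (auto simp: degree_power_eq card_range q_def)
  then have "poly ([:y, 1:] ^ q) x = poly (monom 1 q + [:y ^ q:]) x"
    by simp
  then show ?thesis
    by (simp add: q_def poly_power poly_monom add.commute)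
qed

end

text \<open>The argument \<iota> conveys the type \<open>'k\<close>, whose cardinality is the
  exponent.\<close>

definition frobenius :: "('k \<Rightarrow> 'l) \<Rightarrow> 'l \<Rightarrow> 'l::field" where
  "frobenius \<iota> x = x ^ CARD('k)"

section \<open>Conjugation in a quadratic extension\<close>

locale finite_quadratic_extension = finite_field_extension \<iota>
  for \<iota> :: "'k::{field, finite} \<Rightarrow> 'l::field" +
  fixes \<theta> :: 'l
  assumes quadratic: "quadratic_extension \<iota>" and \<theta>: "\<theta> \<notin> range \<iota>"
begin

abbreviation frob :: "'l \<Rightarrow> 'l" where "frob \<equiv> frobenius \<iota>"

lemma frob_simps:
  "frob (x + y) = frob x + frob y" "frob (x * y) = frob x * frob y" "frob 1 = 1"
  by (simp_all add: frobenius_def power_card_add power_mult_distrib)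

text \<open>A spanning pair of vectors parametrises \<open>'l\<close> by pairs over
  \<open>'k\<close>, so finiteness of the large field is a consequence of its dimension.\<close>

lemma finite_ext: "finite (UNIV :: 'l set)" and card_ext_le: "card (UNIV :: 'l set) \<le> CARD('k) ^ 2"
proof -
  interpret V: vector_space "\<lambda>c x. \<iota> c * x"
    by unfold_locales (auto simp: \<iota>_simps algebra_simps)
  have "V.dim UNIV = 2"
    using quadratic by (simp add: quadratic_extension_def)
  then obtain B where B: "V.span B = UNIV" "card B = 2"
    using V.basis_exists[of UNIV] by (metis top.extremum_uniqueI)
  then obtain u v where uv: "B = {u, v}"
    by (auto simp: card_2_iff)
  have "\<exists>c d. x = \<iota> c * u + \<iota> d * v" for x
  proof -
    have "x \<in> V.span {u, v}"
      using B uv by auto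
    then obtain c where "x - \<iota> c * u \<in> V.span {v}"
      using V.span_breakdown[of u "{u, v}" x] by (metis V.span_breakdown_eq)
    then obtain d where "x - \<iota> c * u - \<iota> d * v = 0"
      by (metis V.span_breakdown_eq V.span_empty singletonD)
    then have "x = \<iota> c * u + \<iota> d * v"
      by (simp add: algebra_simps)
    then show ?thesis
      by blast
  qed
  then have surj: "(UNIV :: 'l set) = (\<lambda>(c, d). \<iota> c * u + \<iota> d * v) ` UNIV"
    by (auto simp: image_iff)
  then show "finite (UNIV :: 'l set)"
    by (metis finite finite_imageI)
  show "card (UNIV :: 'l set) \<le> CARD('k) ^ 2"
    using card_image_le[of UNIV "\<lambda>(c, d). \<iota> c * u + \<iota> d * v"]
    by (subst surj) (simp add: power2_eq_square card_prod)
qed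

text \<open>Linear independence of 1 and \<theta> gives q^2 distinct values, and the large field has
  at most q^2 elements.\<close>

lemma coordinates: "\<exists>c d. x = \<iota> c + \<iota> d * \<theta>"
proof -
  let ?f = "\<lambda>(c, d). \<iota> c + \<iota> d * \<theta>"
  have "inj ?f"
  proof (rule injI, clarify)
    fix c d c' d' assume "\<iota> c + \<iota> d * \<theta> = \<iota> c' + \<iota> d' * \<theta>"
    then have "\<iota> (c - c') + \<iota> (d - d') * \<theta> = 0"
      by (simp add: \<iota>_simps algebra_simps)
    then show "c = c' \<and> d = d'"
      by (simp add: lin_indep[OF \<theta>])
  qed
  then have "card (range ?f) = CARD('k) ^ 2"
    by (simp add: card_image power2_eq_square card_prod)
  then have "range ?f = UNIV"
    using finite_ext card_ext_le card_mono[of UNIV "range ?f"] by (intro card_subset_eq) auto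
  then have "x \<in> range ?f"
    by simp
  then show ?thesis
    by auto
qed

lemma frob_\<iota> [simp]: "frob (\<iota> c) = \<iota> c"
  by (simp add: frobenius_def power_card_eq_iff)

lemma frob_eq_iff: "frob x = x \<longleftrightarrow> x \<in> range \<iota>"
  by (simp add: frobenius_def power_card_eq_iff)

lemma frob_neq: "frob \<theta> \<noteq> \<theta>"
  using \<theta> by (simp add: frob_eq_iff)

lemma frob_coordinates: "frob (\<iota> c + \<iota> d * \<theta>) = \<iota> c + \<iota> d * frob \<theta>"
  by (simp add: frob_simps)

text \<open>\<theta> satisfies a quadratic equation over the small field, with other root s -
  \<theta>. The Frobenius image of \<theta> is a root different from \<theta>, hence that other
  root.\<close>

lemma conjugates:
  obtains s n where "\<theta> * \<theta> = \<iota> s * \<theta> - \<iota> n" and "frob \<theta> = \<iota> s - \<theta>"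
    and "\<And>y. y * y = \<iota> s * y - \<iota> n \<Longrightarrow> y = \<theta> \<or> y = frob \<theta>"
proof -
  obtain n s where ns: "\<theta> * \<theta> = \<iota> n + \<iota> s * \<theta>"
    using coordinates by blast
  have root: "y = \<theta> \<or> y = \<iota> s - \<theta>" if "y * y = \<iota> n + \<iota> s * y" for y
  proof -
    have "(y - \<theta>) * (y - (\<iota> s - \<theta>)) = y * y - \<theta> * \<theta> - \<iota> s * (y - \<theta>)"
      by (simp add: algebra_simps)
    also have "\<dots> = 0"
      by (simp add: that ns algebra_simps)
    finally show ?thesis
      by auto
  qed
  have "frob \<theta> * frob \<theta> = \<iota> n + \<iota> s * frob \<theta>"
    using frob_coordinates[of n s] by (simp flip: frob_simps(2) ns)
  then have frob: "frob \<theta> = \<iota> s - \<theta>"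
    using root frob_neq by blast
  show thesis
    using that[of s "- n"] ns root frob by (simp add: \<iota>_minus algebra_simps)
qed

text \<open>Subtraction from s is an involution on \<theta>, and conjugation fixes the coordinates
  of x with respect to 1 and \<theta>.\<close>

lemma frob_frob [simp]: "frob (frob x) = x"
proof -
  obtain s where s: "frob \<theta> = \<iota> s - \<theta>"
    using conjugates by blast
  have "frob (\<iota> s + \<iota> (- 1) * \<theta>) = \<theta>"
    unfolding frob_coordinates by (simp add: s \<iota>_minus)
  then have "frob (frob \<theta>) = \<theta>"
    by (simp add: s \<iota>_minus)
  moreover obtain c d where x: "x = \<iota> c + \<iota> d * \<theta>"
    using coordinates by blast
  ultimately show ?thesis
    by (simp add: x frob_simps)
qed

lemma frob_field_aut: "frob \<in> carrier (field_aut \<iota>)"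
proof -
  have "bij frob"
    by (rule o_bij[of frob]) auto
  then show ?thesis
    by (auto simp: field_aut_def ring_hom_def type_ring_def frob_simps)
qed

text \<open>An automorphism over the small field sends \<theta> to a root of the same quadratic
  equation.\<close>

lemma field_aut_cases:
  assumes "\<sigma> \<in> carrier (field_aut \<iota>)"
  shows "\<sigma> \<theta> = \<theta> \<or> \<sigma> \<theta> = frob \<theta>"
proof -
  interpret \<sigma>: field_extension \<sigma>
    using assms by unfold_locales (simp add: field_aut_def)
  have [simp]: "\<sigma> (\<iota> c) = \<iota> c" for c
    using assms by (simp add: field_aut_def)
  obtain s n where sn: "\<theta> * \<theta> = \<iota> s * \<theta> - \<iota> n"
    and root: "\<And>y. y * y = \<iota> s * y - \<iota> n \<Longrightarrow> y = \<theta> \<or> y = frob \<theta>"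
    using conjugates by blast
  have "\<sigma> (\<theta> * \<theta>) = \<sigma> (\<iota> s * \<theta> - \<iota> n)"
    by (simp add: sn)
  then show ?thesis
    by (intro root) (simp add: \<sigma>.\<iota>_simps)
qed

end

section \<open>Fixed points on projective lines\<close>

definition det2 :: "'a::comm_ring ^ 2 \<Rightarrow> 'a ^ 2 \<Rightarrow> 'a" where
  "det2 u v = u $ 1 * v $ 2 - u $ 2 * v $ 1"

text \<open>\<open>None\<close> is the point at infinity, \<open>Some t\<close> the point with
  affine coordinate t.\<close>

definition homogeneous :: "'a::zero_neq_one option \<Rightarrow> 'a ^ 2" where
  "homogeneous z = (case z of None \<Rightarrow> vector [1, 0] | Some t \<Rightarrow> vector [t, 1])"

definition line :: "'a::field option \<Rightarrow> ('a ^ 2) set" where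
  "line z = vec.span {homogeneous z}"

lemma span_eq_iff_det2:
  fixes u v :: "'a::field ^ 2"
  assumes "u \<noteq> 0" "v \<noteq> 0"
  shows "vec.span {u} = vec.span {v} \<longleftrightarrow> det2 u v = 0"
proof
  assume "vec.span {u} = vec.span {v}"
  then have "u \<in> vec.span {v}"
    using vec.span_base[of u "{u}"] by auto
  then show "det2 u v = 0"
    by (auto simp: vec.span_singleton det2_def)
next
  have sub: "u \<in> vec.span {v}" if v: "v \<noteq> 0" and d: "det2 u v = 0" for u v :: "'a ^ 2"
  proof -
    obtain i where i: "v $ i \<noteq> 0"
      using v by (metis vec_eq_iff zero_index)
    have "u = (u $ i / v $ i) *s v"
      using d i exhaust_2[of i] by (auto simp: vec_eq_iff forall_2 det2_def field_simps)
    then show ?thesis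
      by (auto simp: vec.span_singleton)
  qed
  assume "det2 u v = 0"
  then have "u \<in> vec.span {v}" "v \<in> vec.span {u}"
    using sub assms by (auto simp: det2_def algebra_simps)
  then show "vec.span {u} = vec.span {v}"
    by (intro equalityI vec.span_minimal) (auto simp: vec.subspace_span)
qed

lemma homogeneous_simps [simp]:
  "homogeneous None $ 1 = 1" "homogeneous None $ 2 = 0"
  "homogeneous (Some t) $ 1 = t" "homogeneous (Some t) $ 2 = 1"
  by (simp_all add: homogeneous_def vector_2)

lemma homogeneous_nonzero [simp]: "homogeneous z \<noteq> 0"
  by (cases z) (simp_all add: vec_eq_iff forall_2)

lemma span_eq_line:
  fixes u :: "'a::field ^ 2"
  assumes "u \<noteq> 0"
  shows "\<exists>z. vec.span {u} = line z"
proof (cases "u $ 2 = 0")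
  case True
  then have "vec.span {u} = line None"
    unfolding line_def by (subst span_eq_iff_det2) (use assms in \<open>auto simp: det2_def\<close>)
  then show ?thesis ..
next
  case False
  then have "vec.span {u} = line (Some (u $ 1 / u $ 2))"
    unfolding line_def by (subst span_eq_iff_det2) (use assms in \<open>auto simp: det2_def\<close>)
  then show ?thesis ..
qed

lemma P1_eq_range_line: "P1 = range line"
proof (intro equalityI subsetI)
  fix L :: "('a::field ^ 2) set"
  assume "L \<in> P1"
  then have L: "vec.subspace L" "vec.dim L = 1"
    by (auto simp: P1_def)
  obtain B where B: "B \<subseteq> L" "vec.independent B" "L \<subseteq> vec.span B" "card B = vec.dim L"
    using vec.basis_exists by blast
  then obtain u where u: "B = {u}"
    using L by (auto simp: card_1_singleton_iff)
  then have "u \<noteq> 0" "L = vec.span {u}"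
    using B L vec.span_minimal[of B L] by (auto simp: vec.dependent_zero)
  then show "L \<in> range line"
    using span_eq_line[of u] by auto
next
  fix L :: "('a ^ 2) set"
  assume "L \<in> range line"
  then obtain z where "L = vec.span {homogeneous z}"
    by (auto simp: line_def)
  then show "L \<in> P1"
    using vec.dim_eq_card_independent[of "{homogeneous z}"] by (simp add: P1_def vec.subspace_span)
qed

lemma inj_line: "inj line"
proof (rule injI)
  fix z w :: "'a::field option"
  assume "line z = line w"
  then have "det2 (homogeneous z) (homogeneous w) = 0"
    by (simp add: line_def span_eq_iff_det2)
  then show "z = w"
    by (cases z; cases w) (auto simp: det2_def)
qed

lemma line_eq_iff [simp]: "line z = line w \<longleftrightarrow> z = w"
  using inj_line by (auto dest: injD)

text \<open>\<open>moebius A z w\<close> says that the fractional linear transformation of \<open>A\<close> maps \<open>z\<close> to \<open>w\<close>.\<close>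

definition moebius :: "'a::field ^ 2 ^ 2 \<Rightarrow> 'a option \<Rightarrow> 'a option \<Rightarrow> bool" where
  "moebius A z w \<longleftrightarrow> det2 (A *v homogeneous z) (homogeneous w) = 0"

text \<open>The equations are cross-multiplied, so a vanishing denominator needs no case of its
  own.\<close>

lemma moebius_simps:
  "moebius A None None \<longleftrightarrow> A $ 2 $ 1 = 0"
  "moebius A None (Some u) \<longleftrightarrow> A $ 1 $ 1 = A $ 2 $ 1 * u"
  "moebius A (Some t) None \<longleftrightarrow> A $ 2 $ 1 * t + A $ 2 $ 2 = 0"
  "moebius A (Some t) (Some u) \<longleftrightarrow> A $ 1 $ 1 * t + A $ 1 $ 2 = (A $ 2 $ 1 * t + A $ 2 $ 2) * u"
  by (auto simp: moebius_def det2_def matrix_vector_mult_def sum_2 neg_eq_iff_add_eq_0)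

lemma line_act_span:
  "line_act A (vec.span {u}) = vec.span {A *v u}"
proof -
  have "Vector_Spaces.linear (*s) (*s) (\<lambda>v. A *v v)"
    by (rule matrix_vector_mul_linear_gen)
  then show ?thesis
    by (simp add: line_act_def flip: vec.linear_span_image)
qed

lemma invertible_mult_nonzero:
  fixes A :: "'a::field ^ 2 ^ 2"
  assumes "invertible A" "u \<noteq> 0"
  shows "A *v u \<noteq> 0"
proof
  assume "A *v u = 0"
  moreover obtain B where "B ** A = mat 1"
    using assms(1) by (auto simp: invertible_def)
  ultimately show False
    using assms(2) by (metis matrix_vector_mul_assoc matrix_vector_mul_lid matrix_vector_mult_0_right)
qed

lemma line_act_line_iff:
  assumes "invertible A"
  shows "line_act A (line z) = line w \<longleftrightarrow> moebius A z w"
  unfolding line_def line_act_span moebius_def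
  using invertible_mult_nonzero[OF assms homogeneous_nonzero] by (simp add: span_eq_iff_det2)

lemma ex1_moebius:
  assumes "invertible A"
  shows "\<exists>!w. moebius A z w"
proof -
  have "line_act A (line z) = vec.span {A *v homogeneous z}"
    by (simp add: line_def line_act_span)
  then obtain w where "line_act A (line z) = line w"
    using span_eq_line[OF invertible_mult_nonzero[OF assms homogeneous_nonzero]] by metis
  then show ?thesis
    by (metis assms line_act_line_iff line_eq_iff)
qed

section \<open>GL_2 acting on the projective lines\<close>

lemma invertible_mat_1: "invertible (mat 1 :: 'a::semiring_1 ^ 'n ^ 'n)"
  unfolding invertible_def by (rule exI[of _ "mat 1"]) simp

lemma group_GL2: "group (GL2 :: ('a::field ^ 2 ^ 2) monoid)"
proof (rule groupI)
  fix A :: "'a ^ 2 ^ 2"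
  assume "A \<in> carrier GL2"
  then show "\<exists>B\<in>carrier GL2. B \<otimes>\<^bsub>GL2\<^esub> A = \<one>\<^bsub>GL2\<^esub>"
    by (auto simp: GL2_def invertible_def)
qed (auto simp: GL2_def matrix_mul_assoc invertible_mult invertible_mat_1)

lemma carrier_GL2: "A \<in> carrier GL2 \<longleftrightarrow> invertible A"
  by (simp add: GL2_def)

lemma line_act_mult: "line_act (A ** B) L = line_act A (line_act B L)"
  by (auto simp: line_act_def image_image matrix_vector_mul_assoc)

lemma line_act_one: "line_act (mat 1) L = L"
  by (simp add: line_act_def)

lemma finite_group_action_line_act:
  "finite_group_action (GL2 :: ('k::{field, finite} ^ 2 ^ 2) monoid) line_act"
proof -
  interpret group "GL2 :: ('k ^ 2 ^ 2) monoid"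
    by (rule group_GL2)
  show ?thesis
    by unfold_locales (auto simp: GL2_def line_act_one line_act_mult)
qed

context field_extension
begin

lemma map_matrix_mult: "map_matrix \<iota> (A ** (B :: 'k ^ 2 ^ 2)) = map_matrix \<iota> A ** map_matrix \<iota> B"
  by (simp add: vec_eq_iff map_matrix_def matrix_matrix_mult_def sum_2 \<iota>_simps)

lemma map_matrix_mat_1: "map_matrix \<iota> (mat 1 :: 'k ^ 2 ^ 2) = mat 1"
  by (simp add: vec_eq_iff map_matrix_def mat_def)

lemma invertible_map_matrix: "invertible A \<Longrightarrow> invertible (map_matrix \<iota> (A :: 'k ^ 2 ^ 2))"
  unfolding invertible_def by (metis map_matrix_mat_1 map_matrix_mult)

lemma map_vec2_span:
  assumes "surj \<iota>"
  shows "map_vec2 \<iota> ` vec.span {u} = vec.span {map_vec2 \<iota> u}"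
proof -
  have "map_vec2 \<iota> (c *s u) = \<iota> c *s map_vec2 \<iota> u" for c
    by (simp add: map_vec2_def vec_eq_iff \<iota>_simps)
  then show ?thesis
    using assms by (auto simp: vec.span_singleton image_iff) (metis surjD)+
qed

lemma map_vec2_homogeneous: "map_vec2 \<iota> (homogeneous z) = homogeneous (map_option \<iota> z)"
  by (cases z) (auto simp: map_vec2_def vec_eq_iff forall_2)

lemma map_vec2_line: "surj \<iota> \<Longrightarrow> map_vec2 \<iota> ` line z = line (map_option \<iota> z)"
  by (simp add: line_def map_vec2_span map_vec2_homogeneous)

lemma P1_incl_line: "P1_incl \<iota> (line z) = line (map_option \<iota> z)"
proof -
  have "map_vec2 \<iota> (c *s u) = \<iota> c *s map_vec2 \<iota> u" for c u
    by (simp add: map_vec2_def vec_eq_iff \<iota>_simps)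
  then have "map_vec2 \<iota> ` line z \<subseteq> line (map_option \<iota> z)"
    by (auto simp: line_def vec.span_singleton map_vec2_homogeneous)
  moreover have "homogeneous (map_option \<iota> z) \<in> map_vec2 \<iota> ` line z"
    unfolding line_def by (metis image_eqI insertI1 map_vec2_homogeneous vec.span_base)
  ultimately show ?thesis
    unfolding P1_incl_def line_def
    by (intro equalityI vec.span_minimal) (auto simp: vec.subspace_span intro: vec.span_base)
qed

text \<open>The point at infinity is rational, so a nonrational point has an affine coordinate, and
  this lies outside \<open>range \<iota>\<close>.\<close>

lemma nonrational_points: "P1 - P1_incl \<iota> ` P1 = (\<lambda>\<theta>. line (Some \<theta>)) ` (- range \<iota>)"
proof -
  have "range (map_option \<iota>) = insert None (Some ` range \<iota>)"
    by (simp add: UNIV_option_conv image_image)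
  then have "P1_incl \<iota> ` P1 = line ` insert None (Some ` range \<iota>)"
    by (simp add: P1_eq_range_line image_image P1_incl_line flip: image_image[of line "map_option \<iota>"])
  then have "P1 - P1_incl \<iota> ` P1 = line ` (UNIV - insert None (Some ` range \<iota>))"
    by (simp add: P1_eq_range_line image_set_diff[OF inj_line])
  also have "UNIV - insert None (Some ` range \<iota>) = Some ` (- range \<iota>)"
    by (auto simp: UNIV_option_conv)
  finally show ?thesis
    by (simp add: image_image)
qed

end

section \<open>Ordered pairs of distinct rational lines\<close>

definition pair_act :: "'a::field ^ 2 ^ 2 \<Rightarrow> ('a ^ 2) set \<times> ('a ^ 2) set \<Rightarrow> ('a ^ 2) set \<times> ('a ^ 2) set" where
  "pair_act A = map_prod (line_act A) (line_act A)"

lemma finite_group_action_pair_act: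
  "finite_group_action (GL2 :: ('k::{field, finite} ^ 2 ^ 2) monoid) pair_act"
proof -
  interpret finite_group_action "GL2 :: ('k ^ 2 ^ 2) monoid" line_act
    by (rule finite_group_action_line_act)
  show ?thesis
    by unfold_locales (auto simp: fin pair_act_def act_one act_mult)
qed

lemma line_act_P1:
  assumes "invertible A" "L \<in> P1"
  shows "line_act A L \<in> P1"
proof -
  obtain z where "L = line z"
    using assms(2) by (auto simp: P1_eq_range_line)
  moreover obtain w where "moebius A z w"
    using ex1_moebius[OF assms(1)] by blast
  ultimately show ?thesis
    using line_act_line_iff[OF assms(1)] by (simp add: P1_eq_range_line)
qed

lemma line_act_inj:
  assumes "invertible A"
  shows "line_act A L = line_act A L' \<longleftrightarrow> L = L'"
proof
  assume eq: "line_act A L = line_act A L'"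
  obtain B where "B ** A = mat 1"
    using assms by (auto simp: invertible_def)
  then have "line_act B (line_act A K) = K" for K
    by (simp flip: line_act_mult add: line_act_one)
  then show "L = L'"
    using eq by metis
qed simp

text \<open>The matrix whose columns represent two distinct lines is invertible and carries the pair
  (infinity, 0) to them, so all such pairs form one orbit.\<close>

lemma orbit_pair:
  fixes L L' :: "('k::{field, finite} ^ 2) set"
  assumes "L \<in> P1" "L' \<in> P1" "L \<noteq> L'"
  shows "orbit GL2 pair_act (L, L') = {(K, K'). K \<in> P1 \<and> K' \<in> P1 \<and> K \<noteq> K'}"
proof -
  interpret A: finite_group_action "GL2 :: ('k ^ 2 ^ 2) monoid" pair_act
    by (rule finite_group_action_pair_act)
  have std: "\<exists>A \<in> carrier GL2. pair_act A (line None, line (Some 0)) = (line z, line w)"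
    if "z \<noteq> w" for z w :: "'k option"
  proof -
    define A :: "'k ^ 2 ^ 2" where "A = (\<chi> i j. if j = 1 then homogeneous z $ i else homogeneous w $ i)"
    have "det A = det2 (homogeneous z) (homogeneous w)"
      by (simp add: A_def det_2 det2_def)
    moreover have "\<dots> \<noteq> 0"
      using that by (cases z; cases w) (auto simp: det2_def)
    ultimately have "invertible A"
      by (simp add: invertible_det_nz)
    moreover have "A *v homogeneous None = homogeneous z" "A *v homogeneous (Some 0) = homogeneous w"
      by (auto simp: A_def vec_eq_iff matrix_vector_mult_def sum_2 forall_2)
    ultimately show ?thesis
      by (intro bexI[of _ A]) (auto simp: pair_act_def line_def line_act_span carrier_GL2)
  qed
  obtain z w where zw: "L = line z" "L' = line w" "z \<noteq> w"
    using assms by (auto simp: P1_eq_range_line)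
  obtain A where A: "A \<in> carrier GL2" "pair_act A (line None, line (Some 0)) = (L, L')"
    using std zw by blast
  show ?thesis
  proof (intro equalityI subsetI)
    fix KK assume "KK \<in> orbit GL2 pair_act (L, L')"
    then show "KK \<in> {(K, K'). K \<in> P1 \<and> K' \<in> P1 \<and> K \<noteq> K'}"
      using assms by (auto simp: orbit_def pair_act_def carrier_GL2 line_act_P1 line_act_inj)
  next
    fix KK :: "('k ^ 2) set \<times> ('k ^ 2) set"
    assume "KK \<in> {(K, K'). K \<in> P1 \<and> K' \<in> P1 \<and> K \<noteq> K'}"
    then obtain x y where "KK = (line x, line y)" "x \<noteq> y"
      by (auto simp: P1_eq_range_line)
    then obtain B where B: "B \<in> carrier GL2" "pair_act B (line None, line (Some 0)) = KK"
      using std by blast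
    have "pair_act (B \<otimes>\<^bsub>GL2\<^esub> inv\<^bsub>GL2\<^esub> A) (L, L') = KK"
      using A B A.act_inv(1)[OF A(1)] by (simp add: A.act_mult flip: A(2))
    then show "KK \<in> orbit GL2 pair_act (L, L')"
      using A B by (auto simp: orbit_def)
  qed
qed

lemma ex_other_line:
  assumes "L \<in> P1"
  shows "\<exists>L' \<in> P1. L' \<noteq> L"
proof -
  obtain z where "L = line z"
    using assms by (auto simp: P1_eq_range_line)
  then have "line (case z of None \<Rightarrow> Some 0 | Some _ \<Rightarrow> None) \<noteq> L"
    by (simp split: option.splits)
  then show ?thesis
    by (auto simp: P1_eq_range_line)
qed

text \<open>Completing each line to a pair reduces this to transitivity on pairs.\<close>

lemma orbit_line:
  fixes L :: "('k::{field, finite} ^ 2) set"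
  assumes L: "L \<in> P1"
  shows "orbit GL2 line_act L = P1"
proof (intro equalityI subsetI)
  fix K assume "K \<in> orbit GL2 line_act L"
  then obtain A where "A \<in> carrier GL2" "K = line_act A L"
    by (auto simp: orbit_def)
  then show "K \<in> P1"
    using L by (simp add: carrier_GL2 line_act_P1)
next
  fix K :: "('k ^ 2) set"
  assume K: "K \<in> P1"
  obtain L' where L': "L' \<in> P1" "L \<noteq> L'"
    using ex_other_line[OF L] by metis
  obtain K' where K': "K' \<in> P1" "K \<noteq> K'"
    using ex_other_line[OF K] by metis
  have "(K, K') \<in> orbit GL2 pair_act (L, L')"
    unfolding orbit_pair[OF L L'] using K K' by simp
  then obtain A where "A \<in> carrier GL2" "(K, K') = pair_act A (L, L')"
    by (auto simp: orbit_def)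
  then show "K \<in> orbit GL2 line_act L"
    by (auto simp: orbit_def pair_act_def)
qed

lemma fixed_pairs_card:
  fixes A :: "'k::{field, finite} ^ 2 ^ 2"
  shows "card {p \<in> {(K, K'). K \<in> P1 \<and> K' \<in> P1 \<and> K \<noteq> K'}. pair_act A p = p} =
    card {L \<in> P1. line_act A L = L} * card {L \<in> P1. line_act A L = L} - card {L \<in> P1. line_act A L = L}"
proof -
  let ?F = "{L \<in> P1. line_act A L = L}"
  have "{p \<in> {(K, K'). K \<in> P1 \<and> K' \<in> P1 \<and> K \<noteq> K'}. pair_act A p = p} = ?F \<times> ?F - (\<lambda>L. (L, L)) ` ?F"
    by (auto simp: pair_act_def)
  then show ?thesis
    by (simp add: card_Diff_subset card_image inj_on_def image_subset_iff card_cartesian_product)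
qed

lemma fixed_lines_card:
  assumes "invertible A"
  shows "card {L \<in> P1. line_act A L = L} = card {z. moebius A z z}"
proof -
  have "{L \<in> P1. line_act A L = L} = line ` {z. moebius A z z}"
    by (auto simp: P1_eq_range_line simp flip: line_act_line_iff[OF assms])
  then show ?thesis
    by (simp add: card_image inj_on_def)
qed

context field_extension
begin

text \<open>Applied both to the inclusion of the small field and to conjugation of the large
  one.\<close>

lemma moebius_map:
  "moebius (map_matrix \<iota> A) (map_option \<iota> z) (map_option \<iota> w) \<longleftrightarrow> moebius A z w"
proof -
  have "map_matrix \<iota> A $ i $ j = \<iota> (A $ i $ j)" for i j
    by (simp add: map_matrix_def)
  then show ?thesis
    by (cases z; cases w) (simp_all add: moebius_simps flip: \<iota>_mult \<iota>_add)
qed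

end

section \<open>Nonrational lines, conjugation and the two inequalities\<close>

context finite_quadratic_extension
begin

lemma frob_field_extension: "field_extension frob"
  using frob_field_aut by unfold_locales (simp add: field_aut_def)

lemma surj_frob: "surj frob"
  by (rule surjI) (rule frob_frob)

lemma frob_notin_range: "x \<notin> range \<iota> \<Longrightarrow> frob x \<notin> range \<iota>"
  by (metis frob_eq_iff frob_frob)

definition frob_line :: "('l ^ 2) set \<Rightarrow> ('l ^ 2) set" where
  "frob_line L = map_vec2 frob ` L"

lemma frob_line_line: "frob_line (line z) = line (map_option frob z)"
  unfolding frob_line_def by (rule field_extension.map_vec2_line[OF frob_field_extension surj_frob])

lemma line_act_ext_line_iff:
  "invertible A \<Longrightarrow> line_act_ext \<iota> A (line z) = line w \<longleftrightarrow> moebius (map_matrix \<iota> A) z w"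
  unfolding line_act_ext_def by (rule line_act_line_iff[OF invertible_map_matrix])

lemma finite_group_action_line_act_ext: "finite_group_action (GL2 :: ('k ^ 2 ^ 2) monoid) (line_act_ext \<iota>)"
proof -
  interpret group "GL2 :: ('k ^ 2 ^ 2) monoid"
    by (rule group_GL2)
  show ?thesis
    by unfold_locales (auto simp: GL2_def line_act_ext_def map_matrix_mult map_matrix_mat_1 line_act_one line_act_mult)
qed

text \<open>The entries of the matrix are fixed by conjugation, so conjugating the Moebius relation
  leaves the matrix unchanged.\<close>

lemma line_act_ext_frob_line:
  assumes "invertible A"
  shows "line_act_ext \<iota> A (frob_line (line z)) = frob_line (line_act_ext \<iota> A (line z))"
proof -
  obtain w where w: "moebius (map_matrix \<iota> A) z w"
    using ex1_moebius[OF invertible_map_matrix[OF assms]] by blast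
  have "map_matrix frob (map_matrix \<iota> A) = map_matrix \<iota> A"
    by (simp add: map_matrix_def)
  then have "moebius (map_matrix \<iota> A) (map_option frob z) (map_option frob w)"
    using field_extension.moebius_map[OF frob_field_extension, of "map_matrix \<iota> A" z w] w by simp
  then show ?thesis
    using w line_act_ext_line_iff[OF assms] by (metis frob_line_line)
qed

abbreviation nonrational_lines :: "('l ^ 2) set set" where
  "nonrational_lines \<equiv> (\<lambda>x. line (Some x)) ` (- range \<iota>)"

lemma orbit_nonrational: "orbit GL2 (line_act_ext \<iota>) (line (Some \<theta>)) = nonrational_lines"
proof (intro equalityI subsetI)
  fix Q assume "Q \<in> orbit GL2 (line_act_ext \<iota>) (line (Some \<theta>))"
  then obtain A where A: "invertible A" "Q = line_act_ext \<iota> A (line (Some \<theta>))"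
    by (auto simp: orbit_def carrier_GL2)
  obtain w where w: "moebius (map_matrix \<iota> A) (Some \<theta>) w"
    using ex1_moebius[OF invertible_map_matrix[OF A(1)]] by blast
  \<comment> \<open>A rational image has a rational preimage under \<open>A\<close>, and injectivity
    would identify it with \<theta>.\<close>
  have "w \<noteq> map_option \<iota> v" for v
  proof
    assume wv: "w = map_option \<iota> v"
    interpret finite_group_action "GL2 :: ('k ^ 2 ^ 2) monoid" line_act
      by (rule finite_group_action_line_act)
    have AG: "A \<in> carrier GL2"
      using A by (simp add: carrier_GL2)
    obtain z where "line_act (inv\<^bsub>GL2\<^esub> A) (line v) = line z"
      using line_act_P1[of "inv\<^bsub>GL2\<^esub> A" "line v"] inv_closed[OF AG]
      by (auto simp: P1_eq_range_line carrier_GL2)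
    then have "line_act A (line z) = line v"
      using act_inv(2)[OF AG] by metis
    then have "moebius (map_matrix \<iota> A) (map_option \<iota> z) w"
      using A(1) by (simp add: line_act_line_iff moebius_map wv)
    then have "line (Some \<theta>) = line (map_option \<iota> z)"
      using w A(1) line_act_inj[OF invertible_map_matrix[OF A(1)]]
      by (metis line_act_line_iff[OF invertible_map_matrix[OF A(1)]])
    then show False
      using \<theta> by (cases z) auto
  qed
  from this[of None] this[of "Some _"] obtain x where "w = Some x" "x \<notin> range \<iota>"
    by (cases w) auto
  then show "Q \<in> nonrational_lines"
    using w A line_act_ext_line_iff[OF A(1)] by auto
next
  fix Q assume "Q \<in> nonrational_lines"
  then obtain x where x: "Q = line (Some x)" "x \<notin> range \<iota>"
    by auto
  obtain v u where vu: "x = \<iota> v + \<iota> u * \<theta>"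
    using coordinates by blast
  with x have "u \<noteq> 0"
    by auto
  \<comment> \<open>The affine map with coefficients u and v sends \<theta> to x; u is nonzero
    because x is not rational.\<close>
  define A :: "'k ^ 2 ^ 2" where "A = vector [vector [u, v], vector [0, 1]]"
  have "det A = u"
    by (simp add: A_def det_2)
  then have A: "invertible A"
    using \<open>u \<noteq> 0\<close> by (simp add: invertible_det_nz)
  have "moebius (map_matrix \<iota> A) (Some \<theta>) (Some x)"
    by (simp add: moebius_simps A_def map_matrix_def vu)
  then show "Q \<in> orbit GL2 (line_act_ext \<iota>) (line (Some \<theta>))"
    using A x line_act_ext_line_iff[OF A] by (auto simp: orbit_def carrier_GL2 intro!: exI[of _ A])
qed

lemma nonrational_count:
  assumes "invertible A"
  shows "card {Q \<in> nonrational_lines. line_act_ext \<iota> A Q = Q} =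
      card {x \<in> - range \<iota>. moebius (map_matrix \<iota> A) (Some x) (Some x)}"
    and "card {Q \<in> nonrational_lines. line_act_ext \<iota> A Q = frob_line Q} =
      card {x \<in> - range \<iota>. moebius (map_matrix \<iota> A) (Some x) (Some (frob x))}"
proof -
  have "{Q \<in> nonrational_lines. line_act_ext \<iota> A Q = Q} =
      (\<lambda>x. line (Some x)) ` {x \<in> - range \<iota>. moebius (map_matrix \<iota> A) (Some x) (Some x)}"
    by (auto simp flip: line_act_ext_line_iff[OF assms])
  then show "card {Q \<in> nonrational_lines. line_act_ext \<iota> A Q = Q} =
      card {x \<in> - range \<iota>. moebius (map_matrix \<iota> A) (Some x) (Some x)}"
    by (simp add: card_image inj_on_def)
  have "{Q \<in> nonrational_lines. line_act_ext \<iota> A Q = frob_line Q} =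
      (\<lambda>x. line (Some x)) ` {x \<in> - range \<iota>. moebius (map_matrix \<iota> A) (Some x) (Some (frob x))}"
    by (auto simp: frob_line_line simp flip: line_act_ext_line_iff[OF assms])
  then show "card {Q \<in> nonrational_lines. line_act_ext \<iota> A Q = frob_line Q} =
      card {x \<in> - range \<iota>. moebius (map_matrix \<iota> A) (Some x) (Some (frob x))}"
    by (simp add: card_image inj_on_def)
qed

text \<open>For a scalar matrix a = q + 1, and the bound is the number q^2 - q of nonrational
  points. Otherwise a nonrational fixed point is a root of a genuine quadratic with rational sum of
  roots, which leaves at most two such points and no rational one. Without nonrational fixed points
  the claim is (a - 1)(a - 2) \<ge> 0.\<close>

lemma fixed_points_bound:
  fixes A :: "'k ^ 2 ^ 2"
  defines "a \<equiv> card {z. moebius A z z}"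
  shows "card {x \<in> - range \<iota>. moebius (map_matrix \<iota> A) (Some x) (Some x)} + 2 * a \<le> a * a - a + 2"
proof -
  define r s t u where "r = A $ 1 $ 1" and "s = A $ 1 $ 2" and "t = A $ 2 $ 1" and "u = A $ 2 $ 2"
  let ?X = "{x \<in> - range \<iota>. moebius (map_matrix \<iota> A) (Some x) (Some x)}"
  have X: "?X = {x \<in> - range \<iota>. \<iota> r * x + \<iota> s = (\<iota> t * x + \<iota> u) * x}"
    by (simp add: moebius_simps map_matrix_def r_def s_def t_def u_def)
  have fin: "finite (S :: 'l set)" for S
    by (rule finite_subset[OF subset_UNIV finite_ext])
  show ?thesis
  proof (cases "t = 0 \<and> s = 0 \<and> r = u")
    case True
    have "moebius A z z" for z
      using True by (cases z) (auto simp: moebius_simps r_def s_def t_def u_def)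
    then have a: "a = CARD('k) + 1"
      by (simp add: a_def card_UNIV_option)
    have "card ?X \<le> card (- range \<iota>)"
      by (rule card_mono) (auto simp: fin)
    also have "\<dots> = card (UNIV :: 'l set) - CARD('k)"
      using card_Diff_subset[of "range \<iota>" UNIV] by (simp add: Compl_eq_Diff_UNIV card_range)
    finally have "card ?X + CARD('k) \<le> CARD('k) ^ 2"
      using card_ext_le card_mono[OF finite_ext, of "range \<iota>"] by (simp add: card_range)
    then show ?thesis
      by (simp add: a power2_eq_square)
  next
    case False
    \<comment> \<open>With t = 0 the fixed point equation is linear, and a nonrational solution
      makes all its coefficients vanish.\<close>
    have t: "t \<noteq> 0" if x: "x \<in> ?X" for x
    proof
      assume "t = 0"
      then have "\<iota> s + \<iota> (r - u) * x = 0" and "x \<notin> range \<iota>"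
        using x unfolding X by (auto simp: \<iota>_simps algebra_simps)
      then have "s = 0 \<and> r - u = 0"
        using lin_indep by blast
      then show False
        using \<open>t = 0\<close> False by simp
    qed
    \<comment> \<open>Sum of the roots of t X^2 + (u - r) X - s.\<close>
    have sum: "y = (\<iota> r - \<iota> u) / \<iota> t - x"
      if "t \<noteq> 0" "x \<noteq> y" "\<iota> r * x + \<iota> s = (\<iota> t * x + \<iota> u) * x" "\<iota> r * y + \<iota> s = (\<iota> t * y + \<iota> u) * y" for x y
    proof -
      have "(x - y) * (\<iota> t * (x + y) - (\<iota> r - \<iota> u)) =
          ((\<iota> t * x + \<iota> u) * x - \<iota> r * x) - ((\<iota> t * y + \<iota> u) * y - \<iota> r * y)"
        by (simp add: algebra_simps)
      also have "\<dots> = 0"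
        by (simp flip: that(3,4))
      finally have "\<iota> t * (x + y) = \<iota> r - \<iota> u"
        using that(2) by (simp only: mult_eq_0_iff right_minus_eq) simp
      then show ?thesis
        using that(1) by (simp add: field_simps)
    qed
    show ?thesis
    proof (cases "?X = {}")
      case True
      have "2 * a \<le> a * a - a + 2"
      proof (cases "a \<ge> 3")
        case True
        then have "3 * a \<le> a * a"
          by simp
        then show ?thesis
          by linarith
      next
        case False
        then have "a = 0 \<or> a = 1 \<or> a = 2"
          by auto
        then show ?thesis
          by auto
      qed
      then show ?thesis
        unfolding True by simp
    next
      case False
      then obtain x where x: "x \<in> ?X"
        by blast
      have "?X \<subseteq> {x, (\<iota> r - \<iota> u) / \<iota> t - x}"
      proof
        fix y assume "y \<in> ?X"
        then show "y \<in> {x, (\<iota> r - \<iota> u) / \<iota> t - x}"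
          using sum[OF t[OF x], of x y] x unfolding X by (cases "x = y") simp_all
      qed
      then have "card ?X \<le> 2"
        using card_mono[of "{x, (\<iota> r - \<iota> u) / \<iota> t - x}" ?X] by (simp add: card_insert_if split: if_splits)
      moreover have "\<not> moebius A z z" for z
      proof -
        \<comment> \<open>A rational root would force the other root x to be rational.\<close>
        have "\<not> moebius A (Some c) (Some c)" for c
        proof
          assume "moebius A (Some c) (Some c)"
          then have "\<iota> r * \<iota> c + \<iota> s = (\<iota> t * \<iota> c + \<iota> u) * \<iota> c"
            by (simp add: moebius_simps r_def s_def t_def u_def flip: \<iota>_mult \<iota>_add)
          then have "x = (\<iota> r - \<iota> u) / \<iota> t - \<iota> c"
            using sum[OF t[OF x], of "\<iota> c" x] x unfolding X by (cases "\<iota> c = x") auto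
          then have "x = \<iota> ((r - u) / t - c)"
            by (simp add: \<iota>_simps)
          then show False
            using x by auto
        qed
        then show ?thesis
          using t[OF x] by (cases z) (simp_all add: moebius_simps(1) t_def)
      qed
      ultimately show ?thesis
        by (simp add: a_def)
    qed
  qed
qed

text \<open>If \<open>A\<close> maps some nonrational \<open>x\<close> to its conjugate, then \<open>A\<close> has trace zero, so it is an
  involution of the projective line and all its non-fixed points are swapped in pairs. The points
  mapped to their conjugates, rational or not, are roots of a polynomial of degree \<open>q + 1\<close>.\<close>

lemma swapped_points_bound:
  fixes A :: "'k ^ 2 ^ 2"
  assumes A: "invertible A"
  shows "card {x \<in> - range \<iota>. moebius (map_matrix \<iota> A) (Some x) (Some (frob x))} \<le>
    card {(z, w). z \<noteq> w \<and> moebius A z w \<and> moebius A w z}"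
proof -
  define r s t u where "r = A $ 1 $ 1" and "s = A $ 1 $ 2" and "t = A $ 2 $ 1" and "u = A $ 2 $ 2"
  let ?X = "{x \<in> - range \<iota>. moebius (map_matrix \<iota> A) (Some x) (Some (frob x))}"
  let ?F = "{z. moebius A z z}"
  have X: "?X = {x \<in> - range \<iota>. \<iota> r * x + \<iota> s = (\<iota> t * x + \<iota> u) * frob x}"
    by (simp add: moebius_simps map_matrix_def r_def s_def t_def u_def)
  have fin: "finite (S :: 'l set)" for S
    by (rule finite_subset[OF subset_UNIV finite_ext])
  show ?thesis
  proof (cases "?X = {}")
    case True
    show ?thesis
      unfolding True by simp
  next
    case False
    then obtain x where x: "x \<notin> range \<iota>" "\<iota> r * x + \<iota> s = (\<iota> t * x + \<iota> u) * frob x"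
      unfolding X by blast
    \<comment> \<open>Conjugating the relation for x and subtracting gives (r + u)(frob x - x) = 0,
      so the trace vanishes.\<close>
    have "frob (\<iota> r * x + \<iota> s) = frob ((\<iota> t * x + \<iota> u) * frob x)"
      by (simp add: x)
    then have "\<iota> r * frob x + \<iota> s = (\<iota> t * frob x + \<iota> u) * x"
      by (simp add: frob_simps)
    moreover have "(\<iota> r + \<iota> u) * (frob x - x) =
        ((\<iota> t * x + \<iota> u) * frob x - (\<iota> r * x + \<iota> s)) - ((\<iota> t * frob x + \<iota> u) * x - (\<iota> r * frob x + \<iota> s))"
      by (simp add: algebra_simps)
    ultimately have "(\<iota> r + \<iota> u) * (frob x - x) = 0"
      using x(2) by simp
    moreover have "frob x \<noteq> x"
      using x by (simp add: frob_eq_iff)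
    ultimately have "\<iota> (r + u) = 0"
      by (simp add: \<iota>_simps)
    then have u: "u = - r"
      by (simp add: eq_neg_iff_add_eq_0 add.commute)
    \<comment> \<open>Trace zero makes the relation symmetric; each non-fixed point is then the
      first component of exactly one swapped pair.\<close>
    have sym: "moebius A z w \<longleftrightarrow> moebius A w z" for z w
      using u by (cases z; cases w) (auto simp: moebius_simps r_def s_def t_def u_def algebra_simps)
    obtain m where m: "\<And>z w. moebius A z w \<longleftrightarrow> w = m z"
      using ex1_moebius[OF A] by metis
    have "m (m z) = z" for z
      using sym m by metis
    then have "{(z, w). z \<noteq> w \<and> moebius A z w \<and> moebius A w z} = (\<lambda>z. (z, m z)) ` (- ?F)"
      by (auto simp: m)
    then have swapped: "card {(z, w). z \<noteq> w \<and> moebius A z w \<and> moebius A w z} = card (- ?F)"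
      by (simp add: card_image inj_on_def)
    have "card (- ?F) + card ?F = CARD('k option)"
      using card_Un_disjoint[of "- ?F" ?F] by (simp add: Compl_partition2)
    then have total: "card (- ?F) + card ?F = CARD('k) + 1"
      by (simp add: card_UNIV_option)
    \<comment> \<open>The condition that \<open>A\<close> sends y to y^q, multiplied out with u =
      -r. A rational y is its own conjugate, so rational fixed points are roots as well.\<close>
    define p where "p = monom (\<iota> t) (CARD('k) + 1) - monom (\<iota> r) (CARD('k)) - [:\<iota> s, \<iota> r:]"
    define E where "E = {c. moebius A (Some c) (Some c)}"
    have poly_p: "poly p y = \<iota> t * y * frob y - \<iota> r * frob y - (\<iota> s + \<iota> r * y)" for y
      by (simp add: p_def poly_monom frobenius_def algebra_simps)
    have roots: "?X \<union> \<iota> ` E \<subseteq> {y. poly p y = 0}"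
    proof -
      have "poly p (\<iota> c) = 0" if "c \<in> E" for c
      proof -
        have "poly p (\<iota> c) = \<iota> (t * c * c - r * c - (s + r * c))"
          by (simp only: poly_p frob_\<iota> \<iota>_add \<iota>_mult \<iota>_diff)
        also have "t * c * c - r * c - (s + r * c) = (t * c + u) * c - (r * c + s)"
          by (simp add: u left_diff_distrib)
        also have "\<dots> = 0"
          using that by (simp add: E_def moebius_simps r_def s_def t_def u_def)
        finally show ?thesis
          by simp
      qed
      moreover have "poly p y = 0" if "y \<in> ?X" for y
        using that unfolding X poly_p by (simp add: u \<iota>_simps algebra_simps)
      ultimately show ?thesis
        by blast
    qed
    have "card ?X + card E = card (?X \<union> \<iota> ` E)"
      using card_image[of \<iota> E] by (subst card_Un_disjoint) (auto simp: fin inj_on_def)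
    then have le: "card ?X + card E \<le> degree p" if "p \<noteq> 0"
      using card_mono[OF fin roots] card_poly_roots_bound[OF that] by simp
    have F: "?F = (if t = 0 then insert None (Some ` E) else Some ` E)"
    proof (rule Set.set_eqI)
      fix z show "z \<in> ?F \<longleftrightarrow> z \<in> (if t = 0 then insert None (Some ` E) else Some ` E)"
        by (cases z) (auto simp: E_def moebius_simps(1) t_def)
    qed
    have "finite E"
      by simp
    then have card_F: "card ?F = (if t = 0 then 1 else 0) + card E"
      unfolding F by (simp add: card_image card_insert_if image_iff)
    \<comment> \<open>If t = 0 the degree drops to q, but then infinity is a fixed point beyond the
      affine ones; the two effects cancel.\<close>
    have "card ?X + card ?F \<le> CARD('k) + 1"
    proof (cases "t = 0")
      case True
      \<comment> \<open>The determinant is -r^2 here.\<close>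
      have "r \<noteq> 0"
        using A True u by (auto simp: invertible_det_nz det_2 r_def s_def t_def u_def)
      have "coeff p (CARD('k)) = - \<iota> r"
        using True card_field_ge_2[where 'k = 'k] by (simp add: p_def coeff_pCons split: nat.splits)
      then have "p \<noteq> 0"
        using \<open>r \<noteq> 0\<close> by auto
      moreover have "degree p \<le> CARD('k)"
        unfolding p_def using True card_field_ge_2[where 'k = 'k]
        by (intro degree_diff_le) (auto simp: degree_monom_le)
      ultimately show ?thesis
        using le card_F True by simp
    next
      case False
      have "coeff p (CARD('k) + 1) = \<iota> t"
        using card_field_ge_2[where 'k = 'k] by (simp add: p_def coeff_pCons split: nat.splits)
      then have "p \<noteq> 0"
        using False by auto
      moreover have "degree p \<le> CARD('k) + 1"
        unfolding p_def using card_field_ge_2[where 'k = 'k]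
        by (intro degree_diff_le) (auto simp: degree_monom_le intro: order_trans[OF degree_monom_le])
      ultimately show ?thesis
        using le card_F False by simp
    qed
    then show ?thesis
      using swapped total by simp
  qed
qed

end

lemma swapped_pairs_card:
  assumes "invertible A"
  shows "card {p \<in> {(K, K'). K \<in> P1 \<and> K' \<in> P1 \<and> K \<noteq> K'}. pair_act A p = prod.swap p} =
    card {(z, w). z \<noteq> w \<and> moebius A z w \<and> moebius A w z}"
proof -
  have "{p \<in> {(K, K'). K \<in> P1 \<and> K' \<in> P1 \<and> K \<noteq> K'}. pair_act A p = prod.swap p} =
      map_prod line line ` {(z, w). z \<noteq> w \<and> moebius A z w \<and> moebius A w z}"
    by (auto simp: pair_act_def P1_eq_range_line map_prod_def image_iff simp flip: line_act_line_iff[OF assms])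
  then show ?thesis
    by (simp add: card_image inj_on_def map_prod_def split_paired_all)
qed

section \<open>The given subgroups as stabilizers, and their permutation characters\<close>

lemma split_torus_eq: "split_torus L L' = stabilizer GL2 pair_act (L, L')"
  by (auto simp: split_torus_def stabilizer_def pair_act_def)

lemma split_normalizer_eq:
  "split_normalizer L L' = {s \<in> carrier GL2. pair_act s (L, L') = (L, L') \<or> pair_act s (L, L') = prod.swap (L, L')}"
  by (auto simp: split_normalizer_def stabilizer_def pair_act_def doubleton_eq_iff)

context finite_quadratic_extension
begin

lemma frob_line_frob_line: "frob_line (frob_line (line z)) = line z"
  by (cases z) (simp_all add: frob_line_line)

text \<open>Automorphisms send \<theta> to itself or to its conjugate, and the identity and
  \<open>frob\<close> realise both cases.\<close>

lemma field_aut_orbit: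
  "orbit (field_aut \<iota>) (\<lambda>\<sigma>. (`) (map_vec2 \<sigma>)) (line (Some \<theta>)) = {line (Some \<theta>), frob_line (line (Some \<theta>))}"
proof (intro equalityI subsetI)
  fix Q assume "Q \<in> orbit (field_aut \<iota>) (\<lambda>\<sigma>. (`) (map_vec2 \<sigma>)) (line (Some \<theta>))"
  then obtain \<sigma> where \<sigma>: "\<sigma> \<in> carrier (field_aut \<iota>)" "Q = map_vec2 \<sigma> ` line (Some \<theta>)"
    by (auto simp: orbit_def)
  have "field_extension \<sigma>" "surj \<sigma>"
    using \<sigma>(1) by (auto simp: field_aut_def field_extension_def bij_is_surj)
  then have "Q = line (Some (\<sigma> \<theta>))"
    using \<sigma>(2) by (simp add: field_extension.map_vec2_line)
  then show "Q \<in> {line (Some \<theta>), frob_line (line (Some \<theta>))}"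
    using field_aut_cases[OF \<sigma>(1)] by (auto simp: frob_line_line)
next
  fix Q assume "Q \<in> {line (Some \<theta>), frob_line (line (Some \<theta>))}"
  moreover have "line (Some \<theta>) = map_vec2 id ` line (Some \<theta>)"
    by (simp add: map_vec2_def)
  moreover have "id \<in> carrier (field_aut \<iota>)"
    by (auto simp: field_aut_def ring_hom_def type_ring_def)
  ultimately have "\<exists>\<sigma> \<in> carrier (field_aut \<iota>). Q = map_vec2 \<sigma> ` line (Some \<theta>)"
    using frob_field_aut unfolding frob_line_def by blast
  then show "Q \<in> orbit (field_aut \<iota>) (\<lambda>\<sigma>. (`) (map_vec2 \<sigma>)) (line (Some \<theta>))"
    unfolding orbit_def by blast
qed

text \<open>Conjugation commutes with a rational matrix, so the image of one line determines that of
  its conjugate.\<close>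

lemma nonsplit_normalizer_eq:
  "nonsplit_normalizer \<iota> (line (Some \<theta>)) =
    {s \<in> carrier GL2. line_act_ext \<iota> s (line (Some \<theta>)) = line (Some \<theta>) \<or>
       line_act_ext \<iota> s (line (Some \<theta>)) = frob_line (line (Some \<theta>))}"
proof -
  let ?P = "line (Some \<theta>)"
  have "line_act_ext \<iota> s ` {?P, frob_line ?P} = {?P, frob_line ?P} \<longleftrightarrow>
      line_act_ext \<iota> s ?P = ?P \<or> line_act_ext \<iota> s ?P = frob_line ?P" if "s \<in> carrier GL2" for s
  proof -
    have "line_act_ext \<iota> s (frob_line ?P) = frob_line (line_act_ext \<iota> s ?P)"
      using that by (intro line_act_ext_frob_line) (simp add: carrier_GL2)
    then show ?thesis
      by (auto simp: doubleton_eq_iff frob_line_frob_line)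
  qed
  then show ?thesis
    unfolding nonsplit_normalizer_def field_aut_orbit stabilizer_def by blast
qed

context
  fixes L0 L1 :: "('k ^ 2) set"
  assumes L: "L0 \<in> P1" "L1 \<in> P1" "L0 \<noteq> L1"
begin

interpretation lines: finite_group_action "GL2 :: ('k ^ 2 ^ 2) monoid" line_act
  by (rule finite_group_action_line_act)

interpretation pairs: finite_group_action "GL2 :: ('k ^ 2 ^ 2) monoid" pair_act
  by (rule finite_group_action_pair_act)

interpretation ext: finite_group_action "GL2 :: ('k ^ 2 ^ 2) monoid" "line_act_ext \<iota>"
  by (rule finite_group_action_line_act_ext)

abbreviation (input) "fix_lines g \<equiv> card {K \<in> orbit GL2 line_act L1. line_act g K = K}"
abbreviation (input) "fix_pairs g \<equiv> card {p \<in> orbit GL2 pair_act (L0, L1). pair_act g p = p}"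
abbreviation (input) "swap_pairs g \<equiv> card {p \<in> orbit GL2 pair_act (L0, L1). pair_act g p = prod.swap p}"
abbreviation (input) "fix_ext g \<equiv>
  card {Q \<in> orbit GL2 (line_act_ext \<iota>) (line (Some \<theta>)). line_act_ext \<iota> g Q = Q}"
abbreviation (input) "swap_ext g \<equiv>
  card {Q \<in> orbit GL2 (line_act_ext \<iota>) (line (Some \<theta>)). line_act_ext \<iota> g Q = frob_line Q}"

text \<open>The hypotheses on \<tau> in the twisted counts, for the swap of a pair;
  \<open>frob_properties\<close> supplies them for conjugation.\<close>

lemma swap_properties:
  "pair_act h (prod.swap (L0, L1)) = prod.swap (pair_act h (L0, L1))"
  "prod.swap (L0, L1) \<in> orbit GL2 pair_act (L0, L1)" "prod.swap (L0, L1) \<noteq> (L0, L1)"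
  using L orbit_pair[OF L] by (auto simp: pair_act_def)

lemma frob_properties:
  "h \<in> carrier GL2 \<Longrightarrow>
    line_act_ext \<iota> h (frob_line (line (Some \<theta>))) = frob_line (line_act_ext \<iota> h (line (Some \<theta>)))"
  "frob_line (line (Some \<theta>)) \<in> orbit GL2 (line_act_ext \<iota>) (line (Some \<theta>))"
  "frob_line (line (Some \<theta>)) \<noteq> line (Some \<theta>)"
  using frob_notin_range[OF \<theta>] frob_neq
  by (simp_all add: carrier_GL2 line_act_ext_frob_line) (simp_all add: frob_line_line orbit_nonrational)

text \<open>In both identities one inequality holds pointwise, and both sides have the same sum over the
  group because every orbit contributes \<open>card (carrier GL2)\<close>.\<close>

lemma fixed_points_identity:
  assumes "g \<in> carrier GL2"
  shows "fix_ext g + 2 * fix_lines g = fix_pairs g + 2"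
proof (rule sum_mono_inv[of "\<lambda>g. fix_ext g + 2 * fix_lines g" "carrier GL2" "\<lambda>g. fix_pairs g + 2"])
  \<comment> \<open>Each orbit sum is the order of the group, so both sides add up to three times
    that order.\<close>
  show "(\<Sum>g\<in>carrier GL2. fix_ext g + 2 * fix_lines g) = (\<Sum>g\<in>carrier GL2. fix_pairs g + 2)"
    using ext.sum_fixed_points[of "line (Some \<theta>)"] lines.sum_fixed_points[of L1] pairs.sum_fixed_points[of "(L0, L1)"]
    by (simp add: sum.distrib del: add_2_eq_Suc add_2_eq_Suc' flip: sum_distrib_left)
  show "fix_ext g + 2 * fix_lines g \<le> fix_pairs g + 2" if "g \<in> carrier GL2" for g
    unfolding orbit_nonrational orbit_line[OF L(2)] orbit_pair[OF L] fixed_pairs_card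
    using that fixed_points_bound[of g] by (simp add: carrier_GL2 nonrational_count(1) fixed_lines_card)
qed (use assms in simp_all)

lemma swapped_points_identity:
  assumes "g \<in> carrier GL2"
  shows "swap_ext g = swap_pairs g"
proof (rule sum_mono_inv[of swap_ext "carrier GL2" swap_pairs])
  show "(\<Sum>g\<in>carrier GL2. swap_ext g) = (\<Sum>g\<in>carrier GL2. swap_pairs g)"
    using ext.sum_twisted_fixed_points[OF frob_properties(1,2)]
      pairs.sum_twisted_fixed_points[OF swap_properties(1,2)] by simp
  fix g :: "'k ^ 2 ^ 2"
  assume "g \<in> carrier GL2"
  then have "invertible g"
    by (simp add: carrier_GL2)
  then show "swap_ext g \<le> swap_pairs g"
    unfolding orbit_nonrational orbit_pair[OF L] using swapped_points_bound
    by (simp only: nonrational_count(2) swapped_pairs_card)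
qed (use assms in simp_all)

lemma subgroups:
  "subgroup (borel L1) GL2" "subgroup (split_torus L0 L1) GL2" "subgroup (split_normalizer L0 L1) GL2"
  "subgroup (nonsplit_torus \<iota> (line (Some \<theta>))) GL2" "subgroup (nonsplit_normalizer \<iota> (line (Some \<theta>))) GL2"
  "subgroup (carrier GL2) (GL2 :: ('k ^ 2 ^ 2) monoid)"
  unfolding borel_def split_torus_eq split_normalizer_def nonsplit_torus_def nonsplit_normalizer_def
  using lines.subgroup_stabilizer pairs.subgroup_stabilizer ext.subgroup_stabilizer
    finite_group_action.subgroup_stabilizer[OF lines.finite_group_action_image]
    finite_group_action.subgroup_stabilizer[OF ext.finite_group_action_image] lines.subgroup_self
  by blast+

lemma conj_count_carrier:
  assumes "g \<in> carrier (GL2 :: ('k ^ 2 ^ 2) monoid)"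
  shows "of_nat (conj_count GL2 (carrier GL2) g) / of_nat (card (carrier (GL2 :: ('k ^ 2 ^ 2) monoid))) = (1 :: rat)"
proof -
  have "conj_count GL2 (carrier GL2) g = card (carrier (GL2 :: ('k ^ 2 ^ 2) monoid))"
    using assms by (auto simp: conj_count_def intro: arg_cong[of _ _ card])
  moreover have "card (carrier (GL2 :: ('k ^ 2 ^ 2) monoid)) \<noteq> 0"
    using lines.one_closed by auto
  ultimately show ?thesis
    by simp
qed

text \<open>Each ratio is a fixed point count, or for a normalizer the mean of a plain and a twisted
  one. In the second identity the twisted counts cancel, leaving half of
  \<open>fixed_points_identity\<close>.\<close>

lemma conj_count_identities:
  assumes g: "g \<in> carrier GL2"
  defines "ratio \<equiv> \<lambda>H. of_nat (conj_count GL2 H g) / of_nat (card H) :: rat"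
  shows "ratio (split_torus L0 L1) + ratio (carrier GL2) + ratio (carrier GL2) =
      ratio (nonsplit_torus \<iota> (line (Some \<theta>))) + ratio (borel L1) + ratio (borel L1)"
    and "ratio (split_normalizer L0 L1) + ratio (carrier GL2) =
      ratio (nonsplit_normalizer \<iota> (line (Some \<theta>))) + ratio (borel L1)"
proof -
  have T: "ratio (split_torus L0 L1) = of_nat (fix_pairs g)"
    unfolding ratio_def split_torus_eq by (rule pairs.conj_count_stabilizer[OF g])
  have B: "ratio (borel L1) = of_nat (fix_lines g)"
    unfolding ratio_def borel_def by (rule lines.conj_count_stabilizer[OF g])
  have T': "ratio (nonsplit_torus \<iota> (line (Some \<theta>))) = of_nat (fix_ext g)"
    unfolding ratio_def nonsplit_torus_def by (rule ext.conj_count_stabilizer[OF g])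
  have G: "ratio (carrier GL2) = 1"
    unfolding ratio_def by (rule conj_count_carrier[OF g])
  have N: "ratio (split_normalizer L0 L1) = (of_nat (fix_pairs g) + of_nat (swap_pairs g)) / 2"
    unfolding ratio_def
    by (rule pairs.conj_count_setwise_stabilizer[OF g swap_properties split_normalizer_eq])
  have N': "ratio (nonsplit_normalizer \<iota> (line (Some \<theta>))) = (of_nat (fix_ext g) + of_nat (swap_ext g)) / 2"
    unfolding ratio_def
    by (rule ext.conj_count_setwise_stabilizer[OF g frob_properties nonsplit_normalizer_eq])
  have fix_eq: "of_nat (fix_ext g) + 2 * of_nat (fix_lines g) = (of_nat (fix_pairs g) + 2 :: rat)"
    using arg_cong[OF fixed_points_identity[OF g], of "of_nat :: nat \<Rightarrow> rat"] by simp
  show "ratio (split_torus L0 L1) + ratio (carrier GL2) + ratio (carrier GL2) =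
      ratio (nonsplit_torus \<iota> (line (Some \<theta>))) + ratio (borel L1) + ratio (borel L1)"
    using fix_eq by (simp add: T B T' G)
  show "ratio (split_normalizer L0 L1) + ratio (carrier GL2) =
      ratio (nonsplit_normalizer \<iota> (line (Some \<theta>))) + ratio (borel L1)"
    using fix_eq swapped_points_identity[OF g] by (simp add: N B N' G field_simps)
qed

end

end

theorem mainTheorem1:
  fixes \<iota> :: "'k::{field, finite} \<Rightarrow> 'l::field"
    and P_inf P_0 :: "('k ^ 2) set"
    and P :: "('l ^ 2) set"
    and C :: "('o, 'm) lin_cat"
    and J :: "'o \<times> ('k ^ 2 ^ 2 \<Rightarrow> 'm) \<Rightarrow> ('k ^ 2 ^ 2) set \<Rightarrow> 'o \<times> 'm"
    and D :: "'o \<Rightarrow> 'o \<Rightarrow> ('o, 'm) dsum"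
  assumes "quadratic_extension \<iota>"
    and "P_inf \<in> P1" and "P_0 \<in> P1" and "P_0 \<noteq> P_inf"
    and "P \<in> P1 - P1_incl \<iota> ` P1"
    and "additive_rat_linear_category C"
    and "direct_sum_choice C D"
    and "invariants_choice C GL2 J"
  shows "let G = carrier GL2;
             B = borel P_inf;
             T = split_torus P_0 P_inf;
             N = split_normalizer P_0 P_inf;
             T' = nonsplit_torus \<iota> P;
             N' = nonsplit_normalizer \<iota> P;
             M = inv_fctr C J;
             S = sum_fctr C D (GObj C GL2)
         in naturally_isomorphic (GObj C GL2) C
              (S (S (M T) (M G)) (M G)) (S (S (M T') (M B)) (M B)) \<and>
            naturally_isomorphic (GObj C GL2) C
              (S (M N) (M G)) (S (M N') (M B))"
proof -
  interpret field_extension \<iota>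
    using assms(1) by unfold_locales (simp add: quadratic_extension_def)
  obtain \<theta> where P: "\<theta> \<notin> range \<iota>" "P = line (Some \<theta>)"
    using assms(5) unfolding nonrational_points by auto
  interpret finite_quadratic_extension \<iota> \<theta>
    using assms(1) P(1) by unfold_locales
  interpret additive_rat_linear_category C
    by (rule assms(6))
  interpret finite_group_in_category C "GL2 :: ('k ^ 2 ^ 2) monoid"
    by (intro finite_group_in_category.intro assms(6) group_GL2 finite_group_in_category_axioms.intro) simp
  note L = assms(3,2,4)
  note sub = subgroups[OF L, folded P(2)] and count = conj_count_identities[OF L, folded P(2)]
  let ?G = "carrier GL2" and ?B = "borel P_inf" and ?T = "split_torus P_0 P_inf"
    and ?N = "split_normalizer P_0 P_inf" and ?T' = "nonsplit_torus \<iota> P" and ?N' = "nonsplit_normalizer \<iota> P"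
  let ?M = "inv_fctr C J" and ?S = "sum_fctr C D (GObj C GL2)"
  note inv = inv_fctr_sum_of_invariants[OF assms(8)]
  note add = sum_fctr_sum_of_invariants[OF assms(7)]
  \<comment> \<open>Index 1 carries \<open>U\<close>, the other two elements of the type
    \<open>3\<close> carry \<open>V\<close>: the common shape of both sides of the first
    isomorphism.\<close>
  have triple: "\<exists>\<iota> \<pi>. sum_of_invariants (?S (?S (?M U) (?M V)) (?M V)) (\<lambda>i :: 3. if i = 1 then U else V) UNIV \<iota> \<pi>"
    if UV: "subgroup U GL2" "subgroup V GL2" for U V
  proof -
    let ?H = "\<lambda>i :: 3. if i = 1 then U else V"
    have 1: "\<exists>\<iota> \<pi>. sum_of_invariants (?M U) ?H {1} \<iota> \<pi>"
      and 2: "\<exists>\<iota> \<pi>. sum_of_invariants (?M V) ?H {2} \<iota> \<pi>"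
      and 3: "\<exists>\<iota> \<pi>. sum_of_invariants (?M V) ?H {3} \<iota> \<pi>"
      using inv[of ?H 1] inv[of ?H 2] inv[of ?H 3] UV by simp_all
    have "\<exists>\<iota> \<pi>. sum_of_invariants (?S (?S (?M U) (?M V)) (?M V)) ?H ({1} \<union> {2} \<union> {3}) \<iota> \<pi>"
      by (intro add 1 2 3) simp_all
    \<comment> \<open>In the type \<open>3\<close> the numeral 3 denotes 0, so these are three
      distinct indices.\<close>
    also have "{1} \<union> {2} \<union> {3} = (UNIV :: 3 set)"
      by (auto simp: UNIV_3)
    finally show ?thesis .
  qed
  have double: "\<exists>\<iota> \<pi>. sum_of_invariants (?S (?M U) (?M V)) (\<lambda>i :: 2. if i = 1 then U else V) UNIV \<iota> \<pi>"
    if UV: "subgroup U GL2" "subgroup V GL2" for U V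
  proof -
    let ?H = "\<lambda>i :: 2. if i = 1 then U else V"
    have 1: "\<exists>\<iota> \<pi>. sum_of_invariants (?M U) ?H {1} \<iota> \<pi>" and 2: "\<exists>\<iota> \<pi>. sum_of_invariants (?M V) ?H {2} \<iota> \<pi>"
      using inv[of ?H 1] inv[of ?H 2] UV by simp_all
    have "\<exists>\<iota> \<pi>. sum_of_invariants (?S (?M U) (?M V)) ?H ({1} \<union> {2}) \<iota> \<pi>"
      by (intro add 1 2) simp_all
    also have "{1} \<union> {2} = (UNIV :: 2 set)"
      by (auto simp: UNIV_2)
    finally show ?thesis .
  qed
  have "naturally_isomorphic (GObj C GL2) C (?S (?S (?M ?T) (?M ?G)) (?M ?G)) (?S (?S (?M ?T') (?M ?B)) (?M ?B))"
    by (rule sums_of_invariants_naturally_isomorphic[OF triple triple averaging_equivalent[OF group_GL2]])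
      (use sub count(1) in \<open>auto simp: sum_3\<close>)
  moreover have "naturally_isomorphic (GObj C GL2) C (?S (?M ?N) (?M ?G)) (?S (?M ?N') (?M ?B))"
    by (rule sums_of_invariants_naturally_isomorphic[OF double double averaging_equivalent[OF group_GL2]])
      (use sub count(2) in \<open>auto simp: sum_2\<close>)
  ultimately show ?thesis
    by (simp add: Let_def)
qed

end
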